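(* Fix $c>0$ and $\eta\in[0,1)$ satisfying $c<\overline c(\eta)$. If $p=p(n)=(1+o(1))\,c/\sqrt n$ and $G$ is distributed as $G(n,p)$ conditioned on the event $\{X\le\eta\,\mathbb E_pX\}$, then with high probability (i.e. with probability tending to $1$ as $n\to\infty$) $\mathrm{MC}(G)=1/2+o(1)$.
   Context: $G(n,p)$ is the Erdős–Rényi random graph on $n$ labeled vertices, $X$ its number of triangles and $\mathbb E_p$ expectation for $G(n,p)$. $\mathrm{MC}(G)$ denotes the fraction of the edges of $G$ that lie in a maximum cut of $G$, with $\mathrm{MC}(G)=0$ if $G$ has no edges. $W$ is the Lambert-W function, the inverse of $x\mapsto xe^x$ on the nonnegative reals. Define $$\eta^\ast=\left(\frac{W(2/e)}{2/e}\right)^{3/2},\qquad \overline c(\eta)=\begin{cases}\dfrac{1}{\sqrt{e(1-\eta/\eta^\ast)}} & \text{if }\eta<\eta^\ast,\\ +\infty & \text{if }\eta\ge\eta^\ast.\end{cases}$$ *)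

theory Defs
  imports "HOL-Probability.Probability" "HOL-Library.Landau_Symbols" "HOL-Library.Ramsey"
    "HOL-Library.Extended_Real"
begin

text \<open>A graph on the vertex set \<open>{1..n}\<close> is represented by its edge set, a subset of
  \<open>[{1..n}]\<^bsup>2\<^esup>\<close>, the set of all two-element subsets of \<open>{1..n}\<close>.\<close>

type_synonym edge_set = "nat set set"

text \<open>The parameter of \<^const>\<open>bernoulli_pmf\<close> is truncated to \<open>[0, 1]\<close>, so \<open>Gnp n p\<close> is a
  distribution for every real \<open>p\<close>, and it is the usual one for \<open>p \<in> [0, 1]\<close>.\<close>

definition Gnp :: "nat \<Rightarrow> real \<Rightarrow> edge_set pmf" where
  "Gnp n p = map_pmf (\<lambda>f. {e \<in> [{1..n}]\<^bsup>2\<^esup>. f e})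
     (Pi_pmf ([{1..n}]\<^bsup>2\<^esup>) False (\<lambda>_. bernoulli_pmf p))"

definition triangle_count :: "nat \<Rightarrow> edge_set \<Rightarrow> nat" where
  "triangle_count n E = card {T \<in> [{1..n}]\<^bsup>3\<^esup>. [T]\<^bsup>2\<^esup> \<subseteq> E}"

definition expected_triangles :: "nat \<Rightarrow> real \<Rightarrow> real" where
  "expected_triangles n p =
     measure_pmf.expectation (Gnp n p) (\<lambda>E. real (triangle_count n E))"

definition cut_edges :: "nat \<Rightarrow> edge_set \<Rightarrow> nat set \<Rightarrow> edge_set" where
  "cut_edges n E S = {e \<in> E. \<exists>u\<in>S. \<exists>v\<in>{1..n} - S. e = {u, v}}"

definition MC :: "nat \<Rightarrow> edge_set \<Rightarrow> real" where
  "MC n E = (if E = {} then 0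
     else real (Max {card (cut_edges n E S) | S. S \<subseteq> {1..n}}) / real (card E))"

definition lambert_W :: "real \<Rightarrow> real" where
  "lambert_W = the_inv_into {0..} (\<lambda>x. x * exp x)"

definition eta_star :: real where
  "eta_star = (lambert_W (2 / exp 1) / (2 / exp 1)) powr (3 / 2)"

definition c_bar :: "real \<Rightarrow> ereal" where
  "c_bar \<eta> = (if \<eta> < eta_star then ereal (1 / sqrt (exp 1 * (1 - \<eta> / eta_star))) else \<infinity>)"

end

theory Submission
  imports Defs "HOL-Real_Asymp.Real_Asymp"
begin

text \<open>Proof idea. Tilting \<open>G(n, p)\<close> by \<open>s ^ X\<close> gives a Gibbs measure on edge sets, i.e. a (soft)
  hard-core model on the linear 3-uniform hypergraph whose vertices are the pairs and whose hyperedges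
  are the triangles. Adding the \<open>n - 2\<close> triangles through a pair \<open>e\<close> one at a time expresses the
  density of \<open>e\<close> by conditional densities of other pairs, up to a bounded number of exceptional
  triangles, and in the limit the normalised density satisfies \<open>y = exp (- (1 - s) c\<^sup>2 y\<^sup>2)\<close>. This
  recursion is a contraction when \<open>2 (1 - s) c\<^sup>2 < 1\<close>, which the hypothesis \<open>c < c_bar \<eta>\<close>
  guarantees for the \<open>s\<close> with \<open>s y\<^sup>3 = \<eta>\<close>. Hence all edge densities agree asymptotically, even
  after a small inhomogeneous change of the activities. Changing the activities according to a
  fixed cut is the exponential tilt of a Chernoff bound, so a cut of relative size \<open>1/2 + \<delta>\<close> has
  probability \<open>exp (- \<Omega>(n\<^bsup>3/2\<^esup>))\<close>, which survives both the union bound over \<open>2 ^ n\<close> cuts and the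
  passage from the tilted to the conditioned measure.\<close>

text \<open>The conditioning event may itself be exponentially rare on the scale n^(3/2), the same
  scale on which unbalanced cuts are suppressed. Comparing the tilted with the conditioned measure
  may therefore cost only an arbitrarily small rate, which forces the tilt \<open>s\<close> to be
  the one whose typical triangle count is \<eta> times the expectation: a given triangle is present
  with probability about \<open>s * y ^ 3 * p ^ 3\<close>. In place of a variance bound, convexity
  of the log partition function reduces concentration of the triangle count to its means at nearby
  tilts, so that only conditional densities have to be computed. For \<eta> = 0 the tilt is
  \<open>s = 0\<close>. All density estimates are made to survive zero weights, but the passage
  between tilts takes logarithms of \<open>s\<close>, so this case ends with an argument of its own.
  The contraction factor \<open>2 * a\<close>, with \<open>a = (1 - s) * c\<^sup>2\<close>, comes
  from the crude bound 2 for the slope of the square on [0, 1]. It suffices because the hypothesis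
  yields \<open>a < 1 / exp 1\<close>, and 2 / e < 1.\<close>

section \<open>Gibbs sums on set systems\<close>

text \<open>\<open>l\<close> holds the activities, which are \<open>p / (1 - p)\<close> in the application. The elements of \<open>A\<close> are
  forced to be present; their own factor \<open>prod l A\<close> is left out.\<close>

definition gibbs_sum :: "real \<Rightarrow> ('a \<Rightarrow> real) \<Rightarrow> 'a set \<Rightarrow> 'a set set \<Rightarrow> 'a set \<Rightarrow> real" where
  "gibbs_sum s l V H A = (\<Sum>G\<in>Pow (V - A). prod l G * s ^ card {t \<in> H. t \<subseteq> G \<union> A})"

lemma gibbs_sum_restrict:
  assumes "finite V" "B \<subseteq> V"
  shows "(\<Sum>G | G \<in> Pow (V - A) \<and> B \<subseteq> G \<union> A. prod l G * s ^ card {t \<in> H. t \<subseteq> G \<union> A})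
    = prod l (B - A) * gibbs_sum s l V H (A \<union> B)"
proof -
  have "(\<Sum>G | G \<in> Pow (V - A) \<and> B \<subseteq> G \<union> A. prod l G * s ^ card {t \<in> H. t \<subseteq> G \<union> A})
    = (\<Sum>G\<in>Pow (V - (A \<union> B)). prod l ((B - A) \<union> G) * s ^ card {t \<in> H. t \<subseteq> G \<union> (A \<union> B)})"
  proof (rule sum.reindex_bij_witness[where i = "\<lambda>G. (B - A) \<union> G" and j = "\<lambda>G. G - B"])
    fix G assume "G \<in> {G \<in> Pow (V - A). B \<subseteq> G \<union> A}"
    then have G: "G \<subseteq> V - A" "B \<subseteq> G \<union> A" by auto
    show "B - A \<union> (G - B) = G" using G by auto
    then show "prod l (B - A \<union> (G - B)) * s ^ card {t \<in> H. t \<subseteq> G - B \<union> (A \<union> B)}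
      = prod l G * s ^ card {t \<in> H. t \<subseteq> G \<union> A}"
    proof -
      have "G - B \<union> (A \<union> B) = G \<union> A" using G by auto
      then show ?thesis using \<open>B - A \<union> (G - B) = G\<close> by simp
    qed
  qed (use assms in auto)
  also have "\<dots> = (\<Sum>G\<in>Pow (V - (A \<union> B)). prod l (B - A) * (prod l G * s ^ card {t \<in> H. t \<subseteq> G \<union> (A \<union> B)}))"
  proof (rule sum.cong[OF refl])
    fix G assume "G \<in> Pow (V - (A \<union> B))"
    then have "finite G" "finite (B - A)" "(B - A) \<inter> G = {}"
      using assms finite_subset by (auto intro: finite_subset)
    then show "prod l ((B - A) \<union> G) * s ^ card {t \<in> H. t \<subseteq> G \<union> (A \<union> B)} =
      prod l (B - A) * (prod l G * s ^ card {t \<in> H. t \<subseteq> G \<union> (A \<union> B)})"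
      by (simp add: prod.union_disjoint)
  qed
  finally show ?thesis by (simp add: gibbs_sum_def sum_distrib_left)
qed

text \<open>When \<open>e\<close> is absent, hyperedges through \<open>e\<close> cannot be
  completed; once they are deleted, forcing \<open>e\<close> is harmless. Both terms thus force the
  same set and differ only in the hypergraph.\<close>

lemma gibbs_sum_insert:
  assumes "finite V" "e \<in> V - A"
  shows "gibbs_sum s l V H A = l e * gibbs_sum s l V H (insert e A) + gibbs_sum s l V {t \<in> H. e \<notin> t} (insert e A)"
proof -
  let ?f = "\<lambda>G. prod l G * s ^ card {t \<in> H. t \<subseteq> G \<union> A}"
  have "gibbs_sum s l V H A = (\<Sum>G | G \<in> Pow (V - A) \<and> {e} \<subseteq> G \<union> A. ?f G)
      + (\<Sum>G | G \<in> Pow (V - A) \<and> \<not> {e} \<subseteq> G \<union> A. ?f G)"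
    unfolding gibbs_sum_def using assms
    by (subst sum.union_disjoint[symmetric]) (auto intro!: sum.cong)
  also have "(\<Sum>G | G \<in> Pow (V - A) \<and> {e} \<subseteq> G \<union> A. ?f G) = l e * gibbs_sum s l V H (insert e A)"
    using assms by (subst gibbs_sum_restrict) (auto simp: insert_Diff_if)
  also have "(\<Sum>G | G \<in> Pow (V - A) \<and> \<not> {e} \<subseteq> G \<union> A. ?f G) = gibbs_sum s l V {t \<in> H. e \<notin> t} (insert e A)"
    unfolding gibbs_sum_def
  proof (rule sum.cong)
    fix G assume "G \<in> Pow (V - insert e A)"
    then have "{t \<in> H. t \<subseteq> G \<union> A} = {t \<in> {t \<in> H. e \<notin> t}. t \<subseteq> G \<union> insert e A}"
      using assms by auto
    then show "?f G = prod l G * s ^ card {t \<in> {t \<in> H. e \<notin> t}. t \<subseteq> G \<union> insert e A}" by simp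
  qed (use assms in auto)
  finally show ?thesis .
qed

text \<open>The hyperedge \<open>t\<close> contributes its factor \<open>s\<close> exactly to the
  configurations that complete it, so deleting it gains a proportion \<open>1 - s\<close> of that
  part alone.\<close>

lemma gibbs_sum_remove:
  assumes "finite V" "finite H" "t \<in> H" "t \<subseteq> V"
  shows "gibbs_sum s l V (H - {t}) A
    = gibbs_sum s l V H A + (1 - s) * (prod l (t - A) * gibbs_sum s l V (H - {t}) (A \<union> t))"
proof -
  let ?f = "\<lambda>H G. prod l G * s ^ card {t \<in> H. t \<subseteq> G \<union> A}"
  have "gibbs_sum s l V (H - {t}) A - gibbs_sum s l V H A
     = (\<Sum>G\<in>Pow (V - A). if t \<subseteq> G \<union> A then (1 - s) * ?f (H - {t}) G else 0)"
    unfolding gibbs_sum_def sum_subtractf[symmetric]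
  proof (rule sum.cong[OF refl])
    fix G
    show "?f (H - {t}) G - ?f H G = (if t \<subseteq> G \<union> A then (1 - s) * ?f (H - {t}) G else 0)"
    proof (cases "t \<subseteq> G \<union> A")
      case True
      then have "{t \<in> H. t \<subseteq> G \<union> A} = insert t {t' \<in> H - {t}. t' \<subseteq> G \<union> A}" using assms by auto
      then have "card {t \<in> H. t \<subseteq> G \<union> A} = Suc (card {t' \<in> H - {t}. t' \<subseteq> G \<union> A})"
        using assms by simp
      then show ?thesis using True by (simp add: algebra_simps)
    next
      case False
      then have "{t \<in> H. t \<subseteq> G \<union> A} = {t' \<in> H - {t}. t' \<subseteq> G \<union> A}" by auto
      then show ?thesis using False by simp
    qed
  qed
  also have "\<dots> = (1 - s) * (\<Sum>G | G \<in> Pow (V - A) \<and> t \<subseteq> G \<union> A. ?f (H - {t}) G)"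
    using assms by (simp add: sum.inter_filter[symmetric] sum_distrib_left)
  also have "\<dots> = (1 - s) * (prod l (t - A) * gibbs_sum s l V (H - {t}) (A \<union> t))"
    using assms by (subst gibbs_sum_restrict) auto
  finally show ?thesis by simp
qed

lemma gibbs_weight_nonneg:
  fixes l :: "'a \<Rightarrow> real"
  assumes "0 \<le> s" "\<And>e. e \<in> V \<Longrightarrow> 0 < l e" "G \<subseteq> V"
  shows "0 \<le> prod l G * s ^ k"
proof -
  have "0 \<le> l e" if "e \<in> G" for e using assms that by (meson less_imp_le subsetD)
  then show ?thesis using assms by (simp add: prod_nonneg)
qed

text \<open>Because \<open>prod l A\<close> is left out of the weight, forcing more elements only
  drops configurations, and each further completed hyperedge costs a factor
  \<open>s \<le> 1\<close>.\<close>

lemma gibbs_sum_antimono: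
  assumes "finite V" "finite H" "0 \<le> s" "s \<le> 1" "\<And>e. e \<in> V \<Longrightarrow> 0 < l e" "H' \<subseteq> H" "A \<subseteq> B"
  shows "gibbs_sum s l V H B \<le> gibbs_sum s l V H' A"
  unfolding gibbs_sum_def
proof (rule order_trans[OF sum_mono sum_mono2])
  fix G assume G: "G \<in> Pow (V - B)"
  have "0 \<le> prod l G" using gibbs_weight_nonneg[of 1 V l G] G assms by auto
  moreover have "card {t \<in> H'. t \<subseteq> G \<union> A} \<le> card {t \<in> H. t \<subseteq> G \<union> B}"
    using assms by (intro card_mono) auto
  ultimately show "prod l G * s ^ card {t \<in> H. t \<subseteq> G \<union> B} \<le> prod l G * s ^ card {t \<in> H'. t \<subseteq> G \<union> A}"
    using assms by (intro mult_left_mono power_decreasing)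
next
  fix G assume "G \<in> Pow (V - A) - Pow (V - B)"
  then show "0 \<le> prod l G * s ^ card {t \<in> H'. t \<subseteq> G \<union> A}"
    using assms by (intro gibbs_weight_nonneg[of s V]) auto
qed (use assms in auto)

lemma gibbs_sum_pos:
  assumes "finite V" "0 \<le> s" "\<And>e. e \<in> V \<Longrightarrow> 0 < l e" "\<And>t. t \<in> H \<Longrightarrow> \<not> t \<subseteq> A"
  shows "0 < gibbs_sum s l V H A"
  unfolding gibbs_sum_def
\<comment> \<open>Positivity has to cover \<open>s = 0\<close>, where the empty configuration, of
  weight \<open>s ^ 0 = 1\<close>, is a safe witness.\<close>
proof (rule sum_pos2[of _ "{}"])
  have "{t \<in> H. t \<subseteq> {} \<union> A} = {}" using assms by auto
  then show "0 < prod l {} * s ^ card {t \<in> H. t \<subseteq> {} \<union> A}"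
    by (simp only: card.empty power_0 prod.empty)
next
  fix G assume "G \<in> Pow (V - A)"
  then show "0 \<le> prod l G * s ^ card {t \<in> H. t \<subseteq> G \<union> A}"
    using assms by (intro gibbs_weight_nonneg[of s V]) auto
qed (use assms in auto)

section \<open>Densities in linear hypergraphs\<close>

text \<open>Guards the denominators: at \<open>s = 0\<close> the Gibbs sum vanishes as soon as the
  forced set contains a hyperedge.\<close>

definition contains_none :: "'a set set \<Rightarrow> 'a set \<Rightarrow> bool" where
  "contains_none T A \<longleftrightarrow> (\<forall>t\<in>T. \<not> t \<subseteq> A)"

locale linear_hypergraph =
  fixes V :: "'a set" and H :: "'a set set" and D :: nat
  assumes finite_V: "finite V"
    and edge_subset: "t \<in> H \<Longrightarrow> t \<subseteq> V"
    and edge_card: "t \<in> H \<Longrightarrow> card t = 3"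
    and edge_eqI: "t \<in> H \<Longrightarrow> t' \<in> H \<Longrightarrow> {e, f} \<subseteq> t \<inter> t' \<Longrightarrow> e \<noteq> f \<Longrightarrow> t = t'"
    and degree: "e \<in> V \<Longrightarrow> card {t \<in> H. e \<in> t} = D"
begin

lemma finite_H: "finite H"
  by (rule finite_subset[of _ "Pow V"]) (use finite_V edge_subset in auto)

lemma edge_finite: "t \<in> H \<Longrightarrow> finite t"
  using edge_subset finite_V finite_subset by metis

text \<open>By linearity a hyperedge through \<open>e\<close> is determined by any second vertex, so
  choosing one in \<open>F\<close> is injective.\<close>

lemma card_edges_meeting:
  assumes "finite F"
  shows "card {t \<in> H. e \<in> t \<and> (t - {e}) \<inter> F \<noteq> {}} \<le> card F"
proof -
  define h where "h t = (SOME f. f \<in> (t - {e}) \<inter> F)" for t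
  have h: "h t \<in> (t - {e}) \<inter> F" if "(t - {e}) \<inter> F \<noteq> {}" for t
    unfolding h_def using that by (metis some_in_eq)
  show ?thesis
  proof (rule card_inj_on_le[of h])
    show "inj_on h {t \<in> H. e \<in> t \<and> (t - {e}) \<inter> F \<noteq> {}}"
    proof (rule inj_onI)
      fix t t' assume "t \<in> {t \<in> H. e \<in> t \<and> (t - {e}) \<inter> F \<noteq> {}}"
        "t' \<in> {t \<in> H. e \<in> t \<and> (t - {e}) \<inter> F \<noteq> {}}" "h t = h t'"
      then show "t = t'" using h[of t] h[of t'] by (intro edge_eqI[of t t' e "h t"]) auto
    qed
  qed (use h assms in auto)
qed

text \<open>The conditional measures that the recursion produces: \<open>A\<close> is forced to be present, and only
  a bounded number of hyperedges have been deleted at each remaining vertex.\<close>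

definition admissible :: "'a set set \<Rightarrow> 'a set \<Rightarrow> bool" where
  "admissible T A \<longleftrightarrow> T \<subseteq> H \<and> A \<subseteq> V \<and> contains_none T A \<and> (\<forall>e\<in>V - A. card {t \<in> H - T. e \<in> t} \<le> card A)"

text \<open>For \<open>e \<in> t\<close>: both other vertices of \<open>t\<close> can be added to \<open>insert e A\<close> without completing
  a hyperedge other than \<open>t\<close>, so their conditional densities obey the same recursion.\<close>

definition free_edge :: "'a set set \<Rightarrow> 'a set \<Rightarrow> 'a set \<Rightarrow> bool" where
  "free_edge T A t \<longleftrightarrow> t \<inter> A = {} \<and> contains_none (T - {t}) (A \<union> t)"

lemma admissible_mono:
  assumes "admissible U B" "B \<subseteq> C" "C \<subseteq> V" "contains_none U C"
  shows "admissible U C"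
proof -
  have "card B \<le> card C" using assms finite_V finite_subset by (metis card_mono)
  then show ?thesis using assms unfolding admissible_def by (blast intro: order_trans)
qed

text \<open>The invariant survives because only hyperedges through \<open>e\<close> are deleted: by
  linearity at most one of them passes through any other \<open>f\<close>, while
  \<open>card A\<close> grows by one.\<close>

lemma admissible_insert:
  assumes "admissible T A" "e \<in> V - A" "contains_none T (insert e A)" "{t \<in> T. e \<notin> t} \<subseteq> U" "U \<subseteq> T"
  shows "admissible U (insert e A)"
proof -
  have fA: "finite A" using assms finite_V finite_subset unfolding admissible_def by metis
  have "card {t \<in> H - U. f \<in> t} \<le> card (insert e A)" if "f \<in> V - insert e A" for f
  proof -
    have "{t \<in> H - U. f \<in> t} \<subseteq> {t \<in> H - T. f \<in> t} \<union> {t \<in> H. f \<in> t \<and> (t - {f}) \<inter> {e} \<noteq> {}}"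
      using assms that by auto
    then have "card {t \<in> H - U. f \<in> t}
        \<le> card ({t \<in> H - T. f \<in> t} \<union> {t \<in> H. f \<in> t \<and> (t - {f}) \<inter> {e} \<noteq> {}})"
      using finite_H by (intro card_mono) auto
    also have "\<dots> \<le> card {t \<in> H - T. f \<in> t} + card {t \<in> H. f \<in> t \<and> (t - {f}) \<inter> {e} \<noteq> {}}"
      by (rule card_Un_le)
    also have "\<dots> \<le> card A + card {e}"
      using assms that card_edges_meeting[of "{e}" f] unfolding admissible_def by (intro add_mono) auto
    finally show ?thesis using assms fA by simp
  qed
  then show ?thesis using assms unfolding admissible_def contains_none_def by auto
qed

lemma card_not_free:
  assumes "admissible T A" "e \<in> V - A" "contains_none T (insert e A)"
  shows "card {t \<in> T. e \<in> t \<and> \<not> free_edge T A t} \<le> card A + 3 * (card A)^2"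
proof -
  \<comment> \<open>A hyperedge through \<open>e\<close> that is not free meets \<open>F\<close> outside \<open>e\<close>, and by linearity each point
    of \<open>F\<close> accounts for at most one such hyperedge.\<close>
  define W where "W p = \<Union>{t \<in> H. fst p \<in> t \<and> snd p \<in> t}" for p
  define P where "P = {p \<in> A \<times> A. fst p \<noteq> snd p}"
  define F where "F = A \<union> (\<Union>p\<in>P. W p)"
  have fA: "finite A" and AV: "A \<subseteq> V" and TH: "T \<subseteq> H"
    using assms finite_V finite_subset unfolding admissible_def by auto
  have fP: "finite P" unfolding P_def using fA by auto
  have W: "card (W p) \<le> 3 \<and> finite (W p)" if "p \<in> P" for p
  proof (cases "W p = {}")
    case False
    then obtain t where t: "t \<in> H" "fst p \<in> t" "snd p \<in> t" unfolding W_def by auto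
    have "W p = t" unfolding W_def
      using t that edge_eqI[of _ t "fst p" "snd p"] unfolding P_def by blast
    then show ?thesis using t edge_card edge_finite by simp
  qed auto
  have "card F \<le> card A + card (\<Union>p\<in>P. W p)" unfolding F_def by (rule card_Un_le)
  also have "card (\<Union>p\<in>P. W p) \<le> (\<Sum>p\<in>P. card (W p))" by (rule card_UN_le[OF fP])
  also have "\<dots> \<le> card P * 3" using W sum_bounded_above[of P "\<lambda>p. card (W p)" 3] by simp
  also have "card P \<le> card (A \<times> A)" unfolding P_def using fA by (intro card_mono) auto
  also have "card (A \<times> A) = (card A)^2" by (simp add: card_cartesian_product power2_eq_square)
  finally have F: "card F \<le> card A + 3 * (card A)^2" by simp
  have fF: "finite F" unfolding F_def using fA fP W by auto
  have "{t \<in> T. e \<in> t \<and> \<not> free_edge T A t} \<subseteq> {t \<in> H. e \<in> t \<and> (t - {e}) \<inter> F \<noteq> {}}"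
  proof
    fix t assume "t \<in> {t \<in> T. e \<in> t \<and> \<not> free_edge T A t}"
    then have t: "t \<in> T" "t \<in> H" "e \<in> t" "\<not> free_edge T A t" using TH by auto
    have "(t - {e}) \<inter> F \<noteq> {}"
    proof (cases "t \<inter> A = {}")
      case False
      then show ?thesis using assms unfolding F_def by auto
    next
      case True
      then obtain t' where t': "t' \<in> T" "t' \<noteq> t" "t' \<subseteq> A \<union> t"
        using t unfolding free_edge_def contains_none_def by auto
      obtain f where f: "f \<in> t'" "f \<notin> A" "f \<noteq> e" using t' assms unfolding contains_none_def by blast
      have "t' - {f} \<subseteq> A"
      proof
        fix x assume x: "x \<in> t' - {f}"
        show "x \<in> A"
        proof (rule ccontr)
          assume "x \<notin> A"
          then have "t' = t" using x f t' t TH by (intro edge_eqI[of t' t x f]) auto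
          then show False using t' by simp
        qed
      qed
      moreover have "card (t' - {f}) = 2" using f edge_card[of t'] t' TH by auto
      ultimately obtain a b where ab: "a \<in> A" "b \<in> A" "a \<noteq> b" "a \<in> t'" "b \<in> t'"
        by (auto simp: card_2_iff)
      then have "(a, b) \<in> P" "f \<in> W (a, b)" using f t' TH unfolding P_def W_def by auto
      then have "f \<in> F" unfolding F_def by blast
      then show ?thesis using f t' by auto
    qed
    then show "t \<in> {t \<in> H. e \<in> t \<and> (t - {e}) \<inter> F \<noteq> {}}" using t by simp
  qed
  then have "card {t \<in> T. e \<in> t \<and> \<not> free_edge T A t} \<le> card {t \<in> H. e \<in> t \<and> (t - {e}) \<inter> F \<noteq> {}}"
    using finite_H by (intro card_mono) auto
  also have "\<dots> \<le> card F" by (rule card_edges_meeting[OF fF])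
  finally show ?thesis using F by simp
qed

end

locale gibbs_hypergraph = linear_hypergraph V H D for V :: "'a set" and H D +
  fixes s :: real and l :: "'a \<Rightarrow> real"
  assumes s_nonneg: "0 \<le> s" and s_le_1: "s \<le> 1" and l_pos: "e \<in> V \<Longrightarrow> 0 < l e"
begin

abbreviation Z :: "'a set set \<Rightarrow> 'a set \<Rightarrow> real" where "Z \<equiv> gibbs_sum s l V"

text \<open>The conditional probability of \<open>e\<close> given \<open>A\<close> is \<open>l e * Q T A e\<close>.\<close>

definition Q :: "'a set set \<Rightarrow> 'a set \<Rightarrow> 'a \<Rightarrow> real" where
  "Q T A e = Z T (insert e A) / Z T A"

lemma Z_antimono: "T' \<subseteq> T \<Longrightarrow> A \<subseteq> B \<Longrightarrow> T \<subseteq> H \<Longrightarrow> Z T B \<le> Z T' A"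
  using finite_V finite_H s_nonneg s_le_1 l_pos
  by (intro gibbs_sum_antimono) (auto intro: finite_subset)

lemma Z_nonneg: "0 \<le> Z T A"
  unfolding gibbs_sum_def using s_nonneg l_pos
  by (intro sum_nonneg gibbs_weight_nonneg[of s V]) auto

lemma Z_pos: "contains_none T A \<Longrightarrow> 0 < Z T A"
  using finite_V s_nonneg l_pos by (intro gibbs_sum_pos) (auto simp: contains_none_def)

lemma Q_le_1: "admissible T A \<Longrightarrow> Q T A e \<le> 1"
  unfolding Q_def admissible_def using Z_pos[of T A] Z_antimono[of T T A "insert e A"]
  by (auto simp: divide_le_eq)

lemma Q_nonneg: "0 \<le> Q T A e"
  unfolding Q_def by (simp add: Z_nonneg)

text \<open>Here \<open>l e * r\<close> is the conditional odds of \<open>e\<close>, presence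
  against absence; the formula turns odds into a probability, divided by \<open>l e\<close>.\<close>

lemma Q_eq:
  assumes "admissible T A" "e \<in> V - A"
    "r = Z T (insert e A) / Z {t \<in> T. e \<notin> t} (insert e A)"
  shows "Q T A e = r / (1 + l e * r)"
proof -
  have 0: "contains_none {t \<in> T. e \<notin> t} (insert e A)"
    using assms unfolding admissible_def contains_none_def by auto
  have "Z T A = l e * Z T (insert e A) + Z {t \<in> T. e \<notin> t} (insert e A)"
    using assms by (intro gibbs_sum_insert finite_V) auto
  then show ?thesis unfolding Q_def assms(3) using Z_pos[OF 0] by (simp add: field_simps)
qed

text \<open>Telescoping product: restoring \<open>t\<close> to \<open>U\<close> multiplies the sum
  by \<open>1 - (1 - s) * m\<close>, where \<open>m\<close> is the conditional probability, given
  \<open>A\<close>, that \<open>t\<close> gets completed. The order of restoration is arbitrary, so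
  the bounds are demanded for every intermediate \<open>U\<close>.\<close>

lemma ratio_bounds:
  assumes "T \<subseteq> H" "contains_none T A" "\<And>t. t \<in> R \<Longrightarrow> 0 \<le> lb t" "\<And>t. t \<in> R \<Longrightarrow> ub t \<le> 1"
    and "R \<subseteq> T"
    and "\<And>U t. t \<in> R \<Longrightarrow> T - R \<subseteq> U \<Longrightarrow> U \<subseteq> T - {t} \<Longrightarrow>
      prod l (t - A) * Z U (A \<union> t) / Z U A \<in> {lb t .. ub t}"
  shows "Z T A / Z (T - R) A \<in> {\<Prod>t\<in>R. 1 - (1 - s) * ub t .. \<Prod>t\<in>R. 1 - (1 - s) * lb t}"
proof -
  define T0 where "T0 = T - R"
  have "finite R" using assms(1,5) finite_H finite_subset by metis
  moreover have "R \<subseteq> R" by simp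
  ultimately have "Z (T0 \<union> R) A / Z T0 A
    \<in> {\<Prod>t\<in>R. 1 - (1 - s) * ub t .. \<Prod>t\<in>R. 1 - (1 - s) * lb t}"
  proof (induction rule: finite_subset_induct')
    case empty
    have "0 < Z T0 A" using assms(2) by (intro Z_pos) (auto simp: contains_none_def T0_def)
    then show ?case by simp
  next
    case (insert t S)
    define U where "U = T0 \<union> S"
    define m where "m = prod l (t - A) * Z U (A \<union> t) / Z U A"
    have m: "m \<in> {lb t..ub t}"
      unfolding m_def using assms(5) insert by (intro assms(6)) (auto simp: U_def T0_def)
    have U: "U \<subseteq> T" using insert assms(5) by (auto simp: U_def T0_def)
    have Upos: "0 < Z U A" using assms(2) U by (intro Z_pos) (auto simp: contains_none_def)
    have Rpos: "0 < Z T0 A" using assms(2) by (intro Z_pos) (auto simp: contains_none_def T0_def)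
    have tU: "t \<notin> U" using insert by (auto simp: U_def T0_def)
    have tH: "t \<in> H" using assms(1,5) insert by auto
    have "finite (insert t U)" using U tH assms(1) finite_H by (auto intro: finite_subset)
    then have "Z (insert t U - {t}) A
        = Z (insert t U) A + (1 - s) * (prod l (t - A) * Z (insert t U - {t}) (A \<union> t))"
      using edge_subset[OF tH] by (intro gibbs_sum_remove finite_V) auto
    then have "Z U A = Z (insert t U) A + (1 - s) * (prod l (t - A) * Z U (A \<union> t))"
      using tU by simp
    then have "Z (insert t U) A = Z U A * (1 - (1 - s) * m)"
      unfolding m_def using Upos by (simp add: field_simps)
    then have eq: "Z (T0 \<union> insert t S) A / Z T0 A
        = (1 - (1 - s) * m) * (Z U A / Z T0 A)"
      unfolding U_def by simp
    have "(1 - s) * ub t \<le> (1 - s) * 1" using assms(4) insert s_le_1 by (intro mult_left_mono) auto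
    then have sm: "(1 - s) * lb t \<le> (1 - s) * m" "(1 - s) * m \<le> (1 - s) * ub t" "(1 - s) * ub t \<le> 1"
      using m s_le_1 s_nonneg by (auto intro: mult_left_mono)
    have IH: "Z U A / Z T0 A \<in> {\<Prod>t\<in>S. 1 - (1 - s) * ub t .. \<Prod>t\<in>S. 1 - (1 - s) * lb t}"
      using insert unfolding U_def by simp
    have ge0: "0 \<le> (\<Prod>t\<in>S. 1 - (1 - s) * ub t)"
    proof (rule prod_nonneg)
      fix t assume "t \<in> S"
      then have "ub t \<le> 1" using assms(4) insert by auto
      then have "(1 - s) * ub t \<le> (1 - s) * 1" using s_le_1 by (intro mult_left_mono) auto
      then show "0 \<le> 1 - (1 - s) * ub t" using s_nonneg by simp
    qed
    have "(\<Prod>t\<in>insert t S. 1 - (1 - s) * ub t) \<le> (1 - (1 - s) * m) * (Z U A / Z T0 A)"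
      unfolding prod.insert[OF insert(1,4)] using sm IH ge0 by (intro mult_mono) auto
    moreover have "(1 - (1 - s) * m) * (Z U A / Z T0 A) \<le> (\<Prod>t\<in>insert t S. 1 - (1 - s) * lb t)"
      unfolding prod.insert[OF insert(1,4)] using sm IH ge0 Upos Rpos by (intro mult_mono) auto
    ultimately show ?case unfolding eq by simp
  qed
  moreover have "T0 \<union> R = T" using assms(5) by (auto simp: T0_def)
  ultimately show ?thesis by (simp add: T0_def)
qed

end

section \<open>Scalar estimates for one level of the recursion\<close>

lemma exp_neg_diff_le:
  fixes x y :: real
  assumes "0 \<le> x" "x \<le> y"
  shows "exp (- x) - exp (- y) \<le> y - x"
proof -
  have "exp (- x) - exp (- y) = exp (- x) * (1 - exp (x - y))"
    by (simp add: algebra_simps exp_add[symmetric])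
  also have "\<dots> \<le> 1 * (1 - exp (x - y))"
    using assms by (intro mult_right_mono) auto
  also have "\<dots> \<le> y - x" using exp_ge_add_one_self[of "x - y"] by argo
  finally show ?thesis .
qed

text \<open>\<open>L\<close> is the lower bound for the other densities, cut off at 0. As
  \<open>y\<close> solves the fixed-point equation and \<open>exp (- x)\<close> is 1-Lipschitz for
  nonnegative \<open>x\<close>, the error is at most \<open>a * (y\<^sup>2 - L\<^sup>2)\<close>, and
  \<open>y + L \<le> 2\<close> produces the contraction factor \<open>2 * a\<close>. Exceptional
  hyperedges have factors at most 1 and are dropped.\<close>

lemma step_upper:
  fixes y d a \<theta> \<alpha> lo r :: real
  assumes y: "0 < y" "y \<le> 1" "y = exp (- (a * y\<^sup>2))" and "0 \<le> a" "0 \<le> d" "0 \<le> \<theta>" "0 \<le> \<alpha>" "\<alpha> \<le> 1"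
    "0 \<le> lo" "lo \<le> 1" and L: "L = max 0 (y - d)"
    and r: "r \<le> (1 - \<alpha> * (lo\<^sup>2 * L\<^sup>2)) ^ g" and m: "m \<le> g" "a - \<theta> \<le> \<alpha> * lo\<^sup>2 * real m"
  shows "r \<le> y + 2 * a * d + \<theta>"
proof -
  define x where "x = \<alpha> * (lo\<^sup>2 * L\<^sup>2)"
  have L01: "0 \<le> L" "L \<le> y" "y - L \<le> d" "L \<le> 1" using L y assms by auto
  have L2: "0 \<le> L\<^sup>2" "L\<^sup>2 \<le> 1" using L01 by (auto simp: power_le_one)
  have lo2: "0 \<le> lo\<^sup>2" "lo\<^sup>2 \<le> 1" using assms by (auto simp: power_le_one)
  have x: "0 \<le> x" "x \<le> 1" unfolding x_def using assms L2 lo2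
    by (auto intro!: mult_le_one)
  have "r \<le> (1 - x) ^ m"
    using r power_decreasing[OF m(1), of "1 - x"] x unfolding x_def by simp
  also have "\<dots> \<le> exp (- x) ^ m" using x exp_ge_add_one_self[of "- x"] by (intro power_mono) auto
  also have "\<dots> = exp (- (x * m))" by (simp add: exp_of_nat_mult[symmetric] mult.commute)
  \<comment> \<open>The cut-off at 0 keeps the exponent in the range where \<open>exp (- x)\<close>
    is 1-Lipschitz.\<close>
  also have "\<dots> \<le> exp (- max 0 (a * L\<^sup>2 - \<theta>))"
  proof -
    have "(a - \<theta>) * L\<^sup>2 \<le> \<alpha> * lo\<^sup>2 * real m * L\<^sup>2" using m L2 by (intro mult_right_mono) auto
    moreover have "\<theta> * L\<^sup>2 \<le> \<theta> * 1" using L2 assms by (intro mult_left_mono) auto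
    ultimately have "a * L\<^sup>2 - \<theta> \<le> x * m" unfolding x_def by (simp add: algebra_simps)
    then show ?thesis using x by simp
  qed
  also have "\<dots> \<le> exp (- (a * L\<^sup>2)) + \<theta>"
    using exp_neg_diff_le[of "max 0 (a * L\<^sup>2 - \<theta>)" "a * L\<^sup>2"] assms L2 by (auto simp: max_def)
  also have "exp (- (a * L\<^sup>2)) \<le> y + (a * y\<^sup>2 - a * L\<^sup>2)"
    using exp_neg_diff_le[of "a * L\<^sup>2" "a * y\<^sup>2"] assms L01 y by (smt (verit) mult_left_mono power_mono
        mult_nonneg_nonneg zero_le_power2)
  also have "a * y\<^sup>2 - a * L\<^sup>2 = a * ((y - L) * (y + L))" by (simp add: power2_eq_square algebra_simps)
  also have "\<dots> \<le> a * (d * 2)" using assms L01 y by (intro mult_left_mono mult_mono) auto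
  finally show ?thesis by (simp add: algebra_simps)
qed

text \<open>In this direction the \<open>b\<close> exceptional hyperedges count: by the Bernoulli
  inequality their factors lose at most \<open>K * hi\<close>. The correction
  \<open>1 + 2 * hi\<^sup>2\<close> comes from \<open>ln (1 - x) \<ge> - x - 2 * x\<^sup>2\<close>
  with \<open>x \<le> hi\<^sup>2\<close>.\<close>

lemma step_lower:
  fixes y d a \<theta> \<alpha> hi r :: real and K :: nat
  assumes y: "0 < y" "y \<le> 1" "y = exp (- (a * y\<^sup>2))" and "0 \<le> a" "0 \<le> d" "0 \<le> \<theta>" "0 \<le> \<alpha>" "\<alpha> \<le> 1"
    "0 \<le> hi" "hi \<le> 1/2" and u: "u = min 1 (y + d)"
    and r: "(1 - \<alpha> * (hi\<^sup>2 * u\<^sup>2)) ^ g * (1 - \<alpha> * hi) ^ b \<le> r"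
    and g: "g \<le> D" "b \<le> K" and D: "\<alpha> * hi\<^sup>2 * (1 + 2 * hi\<^sup>2) * real D \<le> a + \<theta>"
  shows "y - 2 * a * d - \<theta> - K * hi \<le> r" "0 \<le> r"
proof -
  define x where "x = \<alpha> * (hi\<^sup>2 * u\<^sup>2)"
  have u01: "0 \<le> u" "y \<le> u" "u - y \<le> d" "u \<le> 1" using u y assms by auto
  have u2: "0 \<le> u\<^sup>2" "u\<^sup>2 \<le> 1" using u01 by (auto simp: power_le_one)
  have hi2: "0 \<le> hi\<^sup>2" "hi\<^sup>2 \<le> 1/4" using assms power_mono[of hi "1/2" 2] by (auto simp: power2_eq_square)
  have "x \<le> 1 * (hi\<^sup>2 * 1)" unfolding x_def using assms u2 hi2 by (intro mult_mono) auto
  then have x: "0 \<le> x" "x \<le> hi\<^sup>2" "x \<le> 1/4" unfolding x_def using assms u2 hi2 by auto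
  have ahi: "0 \<le> \<alpha> * hi" "\<alpha> * hi \<le> 1 * hi" using assms by (simp, intro mult_right_mono) auto
  have P: "0 \<le> (1 - x) ^ g" "(1 - x) ^ g \<le> 1" using x by (auto simp: power_le_one)
  have "0 \<le> (1 - x) ^ g * (1 - \<alpha> * hi) ^ b"
    using x ahi \<open>hi \<le> 1/2\<close> by (intro mult_nonneg_nonneg zero_le_power) linarith+
  then show "0 \<le> r" using r unfolding x_def by linarith
  have "1 - K * hi \<le> 1 - b * (\<alpha> * hi)"
    using mult_mono[of "real b" "real K" "\<alpha> * hi" hi] g ahi assms by simp
  also have "\<dots> \<le> (1 - \<alpha> * hi) ^ b" using Bernoulli_inequality[of "- (\<alpha> * hi)" b] ahi assms by simp
  finally have "(1 - x) ^ g * (1 - K * hi) \<le> r" using r P unfolding x_def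
    by (meson mult_left_mono order_trans)
  moreover have "(1 - x) ^ g * (K * hi) \<le> 1 * (K * hi)" using P assms by (intro mult_right_mono) auto
  ultimately have 1: "(1 - x) ^ g - K * hi \<le> r" by (simp add: algebra_simps)
  have "exp (- (a * u\<^sup>2)) - \<theta> \<le> exp (- (a * u\<^sup>2 + \<theta>))"
    using exp_neg_diff_le[of "a * u\<^sup>2" "a * u\<^sup>2 + \<theta>"] assms u2 by auto
  also have "\<dots> \<le> exp (- (D * (x + 2 * x\<^sup>2)))"
  proof -
    have "x * (1 + 2 * x) \<le> x * (1 + 2 * hi\<^sup>2)" using x by (intro mult_left_mono) auto
    then have "D * (x + 2 * x\<^sup>2) \<le> D * (x * (1 + 2 * hi\<^sup>2))"
      by (intro mult_left_mono) (auto simp: power2_eq_square algebra_simps)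
    also have "\<dots> = \<alpha> * hi\<^sup>2 * (1 + 2 * hi\<^sup>2) * real D * u\<^sup>2" unfolding x_def by simp
    also have "\<dots> \<le> (a + \<theta>) * u\<^sup>2" using D u2 by (intro mult_right_mono) auto
    also have "\<dots> \<le> a * u\<^sup>2 + \<theta>" using u2 assms mult_left_mono[of "u\<^sup>2" 1 \<theta>] by (simp add: algebra_simps)
    finally show ?thesis by simp
  qed
  also have "\<dots> = exp (- (x + 2 * x\<^sup>2)) ^ D" by (simp add: exp_of_nat_mult[symmetric] algebra_simps)
  also have "\<dots> \<le> (1 - x) ^ D"
  proof -
    have "- x - 2 * x\<^sup>2 \<le> ln (1 - x)" using x by (intro ln_one_minus_pos_lower_bound) auto
    then have "exp (- x - 2 * x\<^sup>2) \<le> exp (ln (1 - x))" by simp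
    then have "exp (- (x + 2 * x\<^sup>2)) \<le> 1 - x" using x by (simp add: algebra_simps)
    then show ?thesis by (intro power_mono) auto
  qed
  also have "\<dots> \<le> (1 - x) ^ g" using x g by (intro power_decreasing) auto
  finally have 2: "exp (- (a * u\<^sup>2)) - \<theta> \<le> (1 - x) ^ g" .
  have "a * y\<^sup>2 \<le> a * u\<^sup>2" using u01 y assms by (intro mult_left_mono power_mono) auto
  then have "exp (- (a * y\<^sup>2)) - exp (- (a * u\<^sup>2)) \<le> a * u\<^sup>2 - a * y\<^sup>2"
    using assms by (intro exp_neg_diff_le) auto
  also have "a * u\<^sup>2 - a * y\<^sup>2 = a * ((u - y) * (u + y))" by (simp add: power2_eq_square algebra_simps)
  also have "\<dots> \<le> a * (d * 2)" using assms u01 y by (intro mult_left_mono mult_mono) auto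
  finally have "y - exp (- (a * u\<^sup>2)) \<le> 2 * a * d" using y by simp
  then show "y - 2 * a * d - \<theta> - K * hi \<le> r" using 1 2 by linarith
qed

lemma prod_if_const:
  fixes x y :: real
  assumes "finite R"
  shows "(\<Prod>t\<in>R. 1 - \<alpha> * (if P t then x else y))
    = (1 - \<alpha> * x) ^ card {t \<in> R. P t} * (1 - \<alpha> * y) ^ card {t \<in> R. \<not> P t}"
proof -
  have "(\<Prod>t\<in>R. 1 - \<alpha> * (if P t then x else y))
    = (\<Prod>t\<in>R. if P t then 1 - \<alpha> * x else 1 - \<alpha> * y)" by (intro prod.cong) auto
  then show ?thesis using assms by (simp add: prod.If_cases Int_def)
qed

section \<open>The density recursion and its iteration\<close>

context gibbs_hypergraph
begin

text \<open>Crude bound for the exceptional hyperedges: at least one vertex of \<open>t\<close> is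
  still missing and costs a factor of at most \<open>hi\<close>.\<close>

lemma insertion_ratio_bounds:
  assumes adm: "admissible U A" and t: "t \<in> H" "\<not> t \<subseteq> A"
    and l: "\<And>f. f \<in> V \<Longrightarrow> l f \<le> hi" and hi: "hi \<le> 1"
  shows "0 \<le> prod l (t - A) * Z U (A \<union> t) / Z U A" "prod l (t - A) * Z U (A \<union> t) / Z U A \<le> hi"
proof -
  have tV: "t \<subseteq> V" using t edge_subset by simp
  have l0: "0 < l f" "l f \<le> 1" if "f \<in> t" for f using that tV l_pos l[of f] hi by fastforce+
  have prod0: "0 \<le> prod l (t - A)" using l0 by (intro prod_nonneg) (auto intro: less_imp_le)
  then show "0 \<le> prod l (t - A) * Z U (A \<union> t) / Z U A" by (simp add: Z_nonneg)
  obtain x where x: "x \<in> t" "x \<notin> A" using t by auto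
  have "prod l (t - A) = l x * prod l (t - A - {x})"
    using x edge_finite[OF t(1)] by (intro prod.remove) auto
  also have "\<dots> \<le> hi * 1"
    using l0 x l[of x] tV l_pos by (intro mult_mono prod_le_1 prod_nonneg) (fastforce intro: less_imp_le order_trans)+
  finally have P: "prod l (t - A) \<le> hi" by simp
  have Zpos: "0 < Z U A" using adm Z_pos unfolding admissible_def by auto
  have "Z U (A \<union> t) \<le> Z U A" using adm unfolding admissible_def by (intro Z_antimono) auto
  then have "prod l (t - A) * Z U (A \<union> t) \<le> hi * Z U A"
    using P prod0 Zpos Z_nonneg by (intro mult_mono) auto
  then show "prod l (t - A) * Z U (A \<union> t) / Z U A \<le> hi" using Zpos by (simp add: divide_le_eq)
qed

text \<open>Chain rule: after \<open>e\<close>, completing \<open>t\<close> means adding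
  \<open>f\<close> and then \<open>g\<close>. Freeness keeps both conditionings admissible, so the
  induction hypothesis will apply to both densities; the second one is conditioned on two elements
  more than \<open>A\<close>.\<close>

lemma insertion_ratio_free:
  assumes adm: "admissible T A" "e \<in> V - A" "contains_none T (insert e A)"
    and t: "t \<in> T" "e \<in> t" "free_edge T A t"
    and U: "{t \<in> T. e \<notin> t} \<subseteq> U" "U \<subseteq> T - {t}"
  obtains f g where "f \<in> V" "g \<in> V"
    "admissible U (insert e A)" "f \<in> V - insert e A" "contains_none U (insert f (insert e A))"
    "admissible U (insert f (insert e A))" "g \<in> V - insert f (insert e A)"
    "contains_none U (insert g (insert f (insert e A)))"
    "prod l (t - insert e A) * Z U (insert e A \<union> t) / Z U (insert e A)
      = (l f * l g) * (Q U (insert e A) f * Q U (insert f (insert e A)) g)"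
proof -
  define A' where "A' = insert e A"
  have tH: "t \<in> H" using t adm unfolding admissible_def by auto
  then have "card (t - {e}) = 2" using t edge_card[of t] by simp
  then obtain f g where fg: "t - {e} = {f, g}" "f \<noteq> g" by (auto simp: card_2_iff)
  have tA: "t \<inter> A = {}" "contains_none (T - {t}) (A \<union> t)" using t unfolding free_edge_def by auto
  have V: "f \<in> V" "g \<in> V" using fg edge_subset[OF tH] by auto
  have n: "f \<notin> A'" "g \<notin> A'" using fg tA unfolding A'_def by auto
  have tm: "t - A' = {f, g}" "A' \<union> t = insert g (insert f A')" "A \<union> t = insert g (insert f A')"
    using fg tA t unfolding A'_def by auto
  have aU: "admissible U A'" unfolding A'_def using U by (intro admissible_insert[OF adm]) auto
  have i2: "contains_none U (insert g (insert f A'))" using tA U unfolding tm contains_none_def by auto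
  then have i1: "contains_none U (insert f A')" unfolding contains_none_def by auto
  have A'V: "A' \<subseteq> V" using aU unfolding admissible_def by auto
  have aU1: "admissible U (insert f A')"
    by (rule admissible_mono[OF aU]) (use V A'V i1 in auto)
  have "prod l (t - A') * Z U (A' \<union> t) / Z U A' = (l f * l g) * (Q U A' f * Q U (insert f A') g)"
    unfolding tm Q_def using fg Z_pos[OF i1] by simp
  then show thesis using that[of f g] V n aU i1 aU1 i2 fg unfolding A'_def by auto
qed

text \<open>One level of the recursion multiplies the error \<open>d\<close> by the contraction factor \<open>2 * a\<close>; the term
  \<open>2 * \<theta>\<close> absorbs the finite-size effects and the exceptional hyperedges.\<close>

lemma Q_step:
  assumes adm: "admissible T A" "e \<in> V - A" "contains_none T (insert e A)" "card A \<le> k"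
    and l: "\<And>f. f \<in> V \<Longrightarrow> lo \<le> l f" "\<And>f. f \<in> V \<Longrightarrow> l f \<le> hi"
    and IH: "\<And>U B f. admissible U B \<Longrightarrow> f \<in> V - B \<Longrightarrow> contains_none U (insert f B) \<Longrightarrow> card B \<le> card A + 2
      \<Longrightarrow> \<bar>Q U B f - y\<bar> \<le> d"
    and y: "0 < y" "y \<le> 1" "y = exp (- (a * y\<^sup>2))" and a0: "0 \<le> a" and d0: "0 \<le> d" and \<theta>0: "0 \<le> \<theta>"
    and lo0: "0 \<le> lo" and hi2: "hi \<le> 1/2" and K: "K = k + 3 * k\<^sup>2"
    and lower: "a - \<theta> \<le> (1 - s) * lo\<^sup>2 * real (D - (k + K))"
    and upper: "(1 - s) * hi\<^sup>2 * (1 + 2 * hi\<^sup>2) * real D \<le> a + \<theta>"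
    and small: "(K + 1) * hi \<le> \<theta>"
  shows "\<bar>Q T A e - y\<bar> \<le> 2 * a * d + 2 * \<theta>"
proof -
  define A' where "A' = insert e A"
  define R where "R = {t \<in> T. e \<in> t}"
  define L where "L = max 0 (y - d)"
  define u where "u = min 1 (y + d)"
  define lb where "lb t = (if free_edge T A t then lo\<^sup>2 * L\<^sup>2 else 0)" for t
  define ub where "ub t = (if free_edge T A t then hi\<^sup>2 * u\<^sup>2 else hi)" for t
  define r where "r = Z T A' / Z {t \<in> T. e \<notin> t} A'"
  have eV: "e \<in> V" using adm by simp
  have TH: "T \<subseteq> H" and AV: "A \<subseteq> V" using adm unfolding admissible_def by auto
  have fA: "finite A" using AV finite_V finite_subset by metis
  have hi0: "0 < hi" using l_pos[OF eV] l(2)[OF eV] by simp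
  have lohi: "lo \<le> hi" using l[OF eV] by simp
  have u01: "0 \<le> u" "u \<le> 1" unfolding u_def using y(1,2) d0 by auto
  have L01: "0 \<le> L" "L \<le> 1" unfolding L_def using y(1,2) d0 by auto
  have fR: "finite R" unfolding R_def using TH by (intro finite_subset[OF _ finite_H]) auto
  have TR: "T - R = {t \<in> T. e \<notin> t}" unfolding R_def by auto
  have Qb: "L \<le> Q U B f" "Q U B f \<le> u"
    if "admissible U B" "f \<in> V - B" "contains_none U (insert f B)" "card B \<le> card A + 2" for U B f
    using IH[OF that] Q_le_1[OF that(1), of f] Q_nonneg[of U B f] unfolding L_def u_def by auto
  have mb: "prod l (t - A') * Z U (A' \<union> t) / Z U A' \<in> {lb t..ub t}"
    if t: "t \<in> R" and U: "T - R \<subseteq> U" "U \<subseteq> T - {t}" for U t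
  proof (cases "free_edge T A t")
    case True
    have tt: "t \<in> T" "e \<in> t" using t unfolding R_def by auto
    obtain f g where fg: "f \<in> V" "g \<in> V"
      "admissible U A'" "f \<in> V - A'" "contains_none U (insert f A')"
      "admissible U (insert f A')" "g \<in> V - insert f A'" "contains_none U (insert g (insert f A'))"
      "prod l (t - A') * Z U (A' \<union> t) / Z U A' = (l f * l g) * (Q U A' f * Q U (insert f A') g)"
      using insertion_ratio_free[OF adm(1-3) tt True U[unfolded TR]] unfolding A'_def by metis
    have c: "card A' \<le> card A + 2" "card (insert f A') \<le> card A + 2"
      unfolding A'_def using fA adm fg(4) by (auto simp: card_insert_if)
    have q1: "L \<le> Q U A' f" "Q U A' f \<le> u" using Qb fg c by auto
    have q2: "L \<le> Q U (insert f A') g" "Q U (insert f A') g \<le> u" using Qb fg c by auto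
    have "lo * lo \<le> l f * l g" "l f * l g \<le> hi * hi"
      using l[OF fg(1)] l[OF fg(2)] lo0 hi0 l_pos[OF fg(1)] l_pos[OF fg(2)]
      by (auto intro!: mult_mono)
    moreover have "L * L \<le> Q U A' f * Q U (insert f A') g" "Q U A' f * Q U (insert f A') g \<le> u * u"
      using q1 q2 L01 u01 Q_nonneg by (auto intro!: mult_mono)
    ultimately show ?thesis unfolding fg(9) lb_def ub_def power2_eq_square
      using True lo0 L01 u01 l_pos[OF fg(1)] l_pos[OF fg(2)] Q_nonneg
      by (auto intro!: mult_mono)
  next
    case False
    have "admissible U A'" unfolding A'_def using adm U TR by (intro admissible_insert[OF adm(1-3)]) auto
    moreover have "t \<in> H" "\<not> t \<subseteq> A'" using t TH adm(3) unfolding R_def A'_def contains_none_def by auto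
    ultimately show ?thesis
      using insertion_ratio_bounds[of U A' t hi] l hi2 False unfolding lb_def ub_def by auto
  qed
  have ub1: "ub t \<le> 1" for t
  proof -
    have "hi\<^sup>2 * u\<^sup>2 \<le> 1 * 1" using u01 hi0 hi2 by (intro mult_mono power_le_one) auto
    then show ?thesis unfolding ub_def using hi2 by auto
  qed
  have rb: "r \<in> {\<Prod>t\<in>R. 1 - (1 - s) * ub t .. \<Prod>t\<in>R. 1 - (1 - s) * lb t}"
    unfolding r_def TR[symmetric]
  proof (rule ratio_bounds)
    show "T \<subseteq> H" "contains_none T A'" "R \<subseteq> T" using TH adm(3) unfolding A'_def R_def by auto
    show "0 \<le> lb t" for t unfolding lb_def by simp
  qed (use ub1 mb in auto)
  define g where "g = card {t \<in> R. free_edge T A t}"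
  define b where "b = card {t \<in> R. \<not> free_edge T A t}"
  have r1: "(1 - (1 - s) * (hi\<^sup>2 * u\<^sup>2)) ^ g * (1 - (1 - s) * hi) ^ b \<le> r"
    using rb prod_if_const[OF fR, of "1 - s"] unfolding ub_def g_def b_def by simp
  have r2: "r \<le> (1 - (1 - s) * (lo\<^sup>2 * L\<^sup>2)) ^ g"
    using rb prod_if_const[OF fR, of "1 - s"] unfolding lb_def g_def b_def by simp
  have k2: "(card A)\<^sup>2 \<le> k\<^sup>2" using adm(4) by (intro power_mono) auto
  have bK: "b \<le> K"
  proof -
    have "{t \<in> R. \<not> free_edge T A t} = {t \<in> T. e \<in> t \<and> \<not> free_edge T A t}" unfolding R_def by auto
    then have "b = card {t \<in> T. e \<in> t \<and> \<not> free_edge T A t}" unfolding b_def by simp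
    then show ?thesis using card_not_free[OF adm(1-3)] adm(4) k2 unfolding K by linarith
  qed
  have gD: "g \<le> D"
  proof -
    have "g \<le> card {t \<in> H. e \<in> t}" unfolding g_def R_def using finite_H TH by (intro card_mono) auto
    then show ?thesis using degree[OF eV] by simp
  qed
  \<comment> \<open>Of the \<open>D\<close> hyperedges at \<open>e\<close>, at most
    \<open>card A\<close> were deleted earlier and at most \<open>K\<close> are not free.\<close>
  have mg: "D - (k + K) \<le> g"
  proof -
    have "{t \<in> H. e \<in> t} = {t \<in> H - T. e \<in> t} \<union> ({t \<in> R. free_edge T A t} \<union> {t \<in> R. \<not> free_edge T A t})"
      unfolding R_def using TH by auto
    then have "D = card ({t \<in> H - T. e \<in> t} \<union> ({t \<in> R. free_edge T A t} \<union> {t \<in> R. \<not> free_edge T A t}))"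
      using degree[OF eV] by simp
    also have "\<dots> \<le> card {t \<in> H - T. e \<in> t} + (g + b)"
      unfolding g_def b_def by (intro order_trans[OF card_Un_le] add_mono card_Un_le order_refl)
    also have "card {t \<in> H - T. e \<in> t} \<le> card A" using adm unfolding admissible_def by auto
    finally show ?thesis using bK adm(4) by simp
  qed
  have up: "r \<le> y + 2 * a * d + \<theta>"
    by (rule step_upper[OF y _ _ _ _ _ _ _ L_def r2 mg lower]) (use a0 d0 \<theta>0 lo0 hi2 lohi s_nonneg s_le_1 in auto)
  have low: "y - 2 * a * d - \<theta> - K * hi \<le> r" "0 \<le> r"
    by (rule step_lower[OF y _ _ _ _ _ _ _ u_def r1 gD bK upper];
        use a0 d0 \<theta>0 hi2 hi0 s_nonneg s_le_1 in auto)+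
  have r3: "r \<le> 1"
  proof -
    have "(1 - s) * (lo\<^sup>2 * L\<^sup>2) \<le> 1 * (1 * 1)"
      using lo0 hi2 lohi L01 s_nonneg s_le_1 by (intro mult_mono power_le_one) auto
    moreover have "0 \<le> (1 - s) * (lo\<^sup>2 * L\<^sup>2)" using s_le_1 by simp
    ultimately show ?thesis using r2 by (smt (verit) power_le_one)
  qed
  have Qr: "Q T A e = r / (1 + l e * r)"
    using Q_eq[OF adm(1,2)] r_def A'_def by simp
  have le: "0 < l e" "l e \<le> hi" using l_pos eV l by auto
  have lr: "0 \<le> l e * r" using le low by simp
  then have "Q T A e \<le> r" unfolding Qr using low by (simp add: divide_le_eq mult_le_cancel_left1)
  \<comment> \<open>Passing from \<open>r\<close> to \<open>Q\<close> costs one further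
    \<open>hi\<close>; with the \<open>K * hi\<close> of \<open>low\<close> this accounts for
    \<open>K + 1\<close> in \<open>small\<close>.\<close>
  moreover have "r - hi \<le> Q T A e"
  proof -
    have "r * (1 - l e * r) * (1 + l e * r) \<le> r"
      using low by (simp add: algebra_simps) 
    then have "r * (1 - l e * r) \<le> Q T A e" unfolding Qr using lr by (simp add: le_divide_eq)
    moreover have "l e * (r * r) \<le> hi * (1 * 1)" using le low r3 by (intro mult_mono) auto
    ultimately show ?thesis by (simp add: algebra_simps)
  qed
  ultimately show ?thesis using up low small \<theta>0 by (simp add: abs_le_iff algebra_simps) 
qed

text \<open>Starts from the trivial error 1 and unrolls \<open>j\<close> levels, each forcing up to
  two more elements, whence \<open>card A + 2 * j \<le> k\<close>. The second summand is the fixed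
  point of the error map that sends \<open>d\<close> to
  \<open>2 * a * d + 2 * \<theta>\<close>.\<close>

lemma Q_iterate:
  assumes "admissible T A" "e \<in> V - A" "contains_none T (insert e A)" "card A + 2 * j \<le> k"
    and l: "\<And>f. f \<in> V \<Longrightarrow> lo \<le> l f" "\<And>f. f \<in> V \<Longrightarrow> l f \<le> hi"
    and y: "0 < y" "y \<le> 1" "y = exp (- (a * y\<^sup>2))" and a: "0 \<le> a" "2 * a < 1" and \<theta>0: "0 \<le> \<theta>"
    and lo0: "0 \<le> lo" and hi2: "hi \<le> 1/2" and K: "K = k + 3 * k\<^sup>2"
    and lower: "a - \<theta> \<le> (1 - s) * lo\<^sup>2 * real (D - (k + K))"
    and upper: "(1 - s) * hi\<^sup>2 * (1 + 2 * hi\<^sup>2) * real D \<le> a + \<theta>"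
    and small: "(K + 1) * hi \<le> \<theta>"
  shows "\<bar>Q T A e - y\<bar> \<le> (2 * a) ^ j + 2 * \<theta> / (1 - 2 * a)"
  using assms(1-4)
proof (induction j arbitrary: T A e)
  case 0
  have "\<bar>Q T A e - y\<bar> \<le> 1" using Q_le_1[OF 0(1), of e] Q_nonneg[of T A e] y(1,2) by auto
  moreover have "0 \<le> 2 * \<theta> / (1 - 2 * a)" using a \<theta>0 by simp
  ultimately show ?case by simp
next
  case (Suc j)
  have "\<bar>Q T A e - y\<bar> \<le> 2 * a * ((2 * a) ^ j + 2 * \<theta> / (1 - 2 * a)) + 2 * \<theta>"
  proof (rule Q_step[OF Suc.prems(1-3) _ l _ y a(1) _ _ _ _ K lower upper small])
    show "0 \<le> (2 * a) ^ j + 2 * \<theta> / (1 - 2 * a)" using a \<theta>0 by simp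
    show "card A \<le> k" using Suc.prems by simp
    fix U B f assume "admissible U B" "f \<in> V - B" "contains_none U (insert f B)" "card B \<le> card A + 2"
    then show "\<bar>Q U B f - y\<bar> \<le> (2 * a) ^ j + 2 * \<theta> / (1 - 2 * a)"
      using Suc.prems(4) by (intro Suc.IH) auto
  qed (use \<theta>0 lo0 hi2 in auto)
  also have "\<dots> = (2 * a) ^ Suc j + 2 * \<theta> / (1 - 2 * a)"
    using a by (simp add: field_simps)
  finally show ?case .
qed

end

section \<open>The triangle hypergraph\<close>

definition pairs :: "nat \<Rightarrow> nat set set" where
  "pairs n = [{1..n}]\<^bsup>2\<^esup>"

definition triangles :: "nat \<Rightarrow> nat set set set" where
  "triangles n = (\<lambda>T. [T]\<^bsup>2\<^esup>) ` [{1..n}]\<^bsup>3\<^esup>"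

lemma card_nsets: "finite A \<Longrightarrow> card ([A]\<^bsup>k\<^esup>) = card A choose k"
proof -
  assume A: "finite A"
  then have "[A]\<^bsup>k\<^esup> = {B. B \<subseteq> A \<and> card B = k}" using finite_subset by (auto simp: nsets_def)
  then show ?thesis using n_subsets[OF A] by simp
qed

lemma finite_pairs: "finite (pairs n)"
  unfolding pairs_def by (simp add: finite_imp_finite_nsets)

lemma card_pairs: "card (pairs n) = n choose 2"
  unfolding pairs_def by (simp add: card_nsets)

lemma inj_on_pairs_of_triple: "inj_on (\<lambda>T. [T]\<^bsup>2\<^esup>) ([A]\<^bsup>3\<^esup>)"
proof (rule inj_onI)
  fix T T' :: "'a set" assume T: "T \<in> [A]\<^bsup>3\<^esup>" "T' \<in> [A]\<^bsup>3\<^esup>" "[T]\<^bsup>2\<^esup> = [T']\<^bsup>2\<^esup>"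
  have *: "S = \<Union>([S]\<^bsup>2\<^esup>)" if "S \<in> [A]\<^bsup>3\<^esup>" for S :: "'a set"
    using that by (auto simp: nsets_3_eq nsets_2_eq)
  show "T = T'" using *[OF T(1)] *[OF T(2)] T(3) by simp
qed

lemma card_triangles: "card (triangles n) = n choose 3"
  unfolding triangles_def by (simp add: card_image[OF inj_on_pairs_of_triple] card_nsets)

lemma triangle_count_eq: "triangle_count n E = card {t \<in> triangles n. t \<subseteq> E}"
proof -
  have "{t \<in> triangles n. t \<subseteq> E} = (\<lambda>T. [T]\<^bsup>2\<^esup>) ` {T \<in> [{1..n}]\<^bsup>3\<^esup>. [T]\<^bsup>2\<^esup> \<subseteq> E}"
    unfolding triangles_def by auto
  moreover have "inj_on (\<lambda>T. [T]\<^bsup>2\<^esup>) {T \<in> [{1..n}]\<^bsup>3\<^esup>. [T]\<^bsup>2\<^esup> \<subseteq> E}"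
    by (rule inj_on_subset[OF inj_on_pairs_of_triple]) auto
  ultimately show ?thesis unfolding triangle_count_def by (simp add: card_image)
qed

text \<open>Two distinct pairs cover at least three points, so they determine the triple containing
  them; a pair is completed to a triple by each of the \<open>n - 2\<close> other points.\<close>

lemma linear_hypergraph_triangles: "linear_hypergraph (pairs n) (triangles n) (n - 2)"
proof
  show "finite (pairs n)" by (rule finite_pairs)
  fix t assume "t \<in> triangles n"
  then obtain T where T: "T \<in> [{1..n}]\<^bsup>3\<^esup>" "t = [T]\<^bsup>2\<^esup>" unfolding triangles_def by auto
  then have T': "T \<subseteq> {1..n}" "finite T" "card T = 3" by (auto simp: nsets_def)
  show "t \<subseteq> pairs n" unfolding pairs_def T(2) by (rule nsets_mono[OF T'(1)])
  show "card t = 3" unfolding T(2) card_nsets[OF T'(2)] T'(3) by (simp add: numeral_eq_Suc)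
next
  fix t t' e f assume t: "t \<in> triangles n" "t' \<in> triangles n" "{e, f} \<subseteq> t \<inter> t'" "e \<noteq> f"
  obtain T T' where T: "t = [T]\<^bsup>2\<^esup>" "t' = [T']\<^bsup>2\<^esup>" "finite T" "card T = 3" "finite T'" "card T' = 3"
    using t unfolding triangles_def by (auto simp: nsets_def)
  have ef: "e \<subseteq> T" "e \<subseteq> T'" "f \<subseteq> T" "f \<subseteq> T'" "finite e" "finite f" "card e = 2" "card f = 2"
    using t(3) T by (auto simp: nsets_def)
  have "e \<noteq> e \<union> f"
    using ef t(4) card_subset_eq[of e f] by (metis sup.absorb_iff1 sup_commute)
  then have "e \<subset> e \<union> f" by auto
  then have "card e < card (e \<union> f)" using ef by (intro psubset_card_mono) auto
  then have "3 \<le> card (e \<union> f)" using ef by simp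
  then have *: "e \<union> f = S" if "e \<union> f \<subseteq> S" "finite S" "card S = 3" for S
    using that card_seteq[of S "e \<union> f"] by simp
  have "e \<union> f = T" by (rule *) (use ef T in auto)
  moreover have "e \<union> f = T'" by (rule *) (use ef T in auto)
  ultimately have "T = T'" by simp
  then show "t = t'" using T by simp
next
  fix e assume "e \<in> pairs n"
  then have e: "e \<subseteq> {1..n}" "finite e" "card e = 2" by (auto simp: pairs_def nsets_def)
  have "{t \<in> triangles n. e \<in> t} = (\<lambda>w. [insert w e]\<^bsup>2\<^esup>) ` ({1..n} - e)"
  proof (intro equalityI subsetI)
    fix t assume "t \<in> {t \<in> triangles n. e \<in> t}"
    then obtain T where T: "t = [T]\<^bsup>2\<^esup>" "T \<subseteq> {1..n}" "finite T" "card T = 3" "e \<subseteq> T"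
      unfolding triangles_def by (auto simp: nsets_def)
    then have "card (T - e) = 1" using e by (simp add: card_Diff_subset)
    then obtain w where w: "T - e = {w}" by (auto simp: card_1_singleton_iff)
    then have "T = insert w e" "w \<in> {1..n} - e" using T by auto
    then show "t \<in> (\<lambda>w. [insert w e]\<^bsup>2\<^esup>) ` ({1..n} - e)" using T by auto
  next
    fix t assume "t \<in> (\<lambda>w. [insert w e]\<^bsup>2\<^esup>) ` ({1..n} - e)"
    then obtain w where w: "t = [insert w e]\<^bsup>2\<^esup>" "w \<in> {1..n}" "w \<notin> e" by auto
    then have "insert w e \<in> [{1..n}]\<^bsup>3\<^esup>" "e \<in> [insert w e]\<^bsup>2\<^esup>" using e by (auto simp: nsets_def)
    then show "t \<in> {t \<in> triangles n. e \<in> t}" unfolding triangles_def w(1) by auto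
  qed
  moreover have "inj_on (\<lambda>w. [insert w e]\<^bsup>2\<^esup>) ({1..n} - e)"
  proof (rule inj_onI)
    fix v w assume vw: "v \<in> {1..n} - e" "w \<in> {1..n} - e" "[insert v e]\<^bsup>2\<^esup> = [insert w e]\<^bsup>2\<^esup>"
    then have "insert v e \<in> [{1..n}]\<^bsup>3\<^esup>" "insert w e \<in> [{1..n}]\<^bsup>3\<^esup>" using e by (auto simp: nsets_def)
    then have "insert v e = insert w e" using inj_onD[OF inj_on_pairs_of_triple vw(3)] by simp
    then show "v = w" using vw by auto
  qed
  ultimately have "card {t \<in> triangles n. e \<in> t} = card ({1..n} - e)" by (simp add: card_image)
  then show "card {t \<in> triangles n. e \<in> t} = n - 2" using e by (simp add: card_Diff_subset)
qed

lemma triangle_count_empty: "triangle_count n {} = 0"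
proof -
  have "{t \<in> triangles n. t \<subseteq> {}} = {}"
    using linear_hypergraph.edge_card[OF linear_hypergraph_triangles, of _ n] by fastforce
  then show ?thesis unfolding triangle_count_eq by (simp only: card.empty)
qed

lemma gibbs_hypergraph_triangles:
  "0 \<le> s \<Longrightarrow> s \<le> 1 \<Longrightarrow> (\<And>e. e \<in> pairs n \<Longrightarrow> 0 < l e) \<Longrightarrow>
    gibbs_hypergraph (pairs n) (triangles n) (n - 2) s l"
  by (intro gibbs_hypergraph.intro linear_hypergraph_triangles gibbs_hypergraph_axioms.intro)

text \<open>The order of choices matters: the depth \<open>j\<close> fixes the number
  \<open>K\<close> of exceptional hyperedges, and only then does \<open>n\<close> become large.
  Activities may vary from pair to pair so that measures tilted towards a cut are covered;
  \<open>card A \<le> 2\<close> is what the three pairs of a triangle require.\<close>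

lemma Q_asymptotic:
  fixes s c y \<kappa> :: real
  assumes s: "0 \<le> s" "s \<le> 1" and c: "0 < c" and y: "0 < y" "y \<le> 1"
    and fp: "y = exp (- ((1 - s) * c\<^sup>2 * y\<^sup>2))" and contr: "2 * ((1 - s) * c\<^sup>2) < 1" and \<kappa>: "0 < \<kappa>"
  obtains \<epsilon> where "0 < \<epsilon>" "\<epsilon> < 1"
    "\<forall>\<^sub>F n in sequentially. \<forall>l T A e.
      (\<forall>f\<in>pairs n. (1 - \<epsilon>) * c / sqrt n \<le> l f \<and> l f \<le> (1 + \<epsilon>) * c / sqrt n) \<longrightarrow>
      linear_hypergraph.admissible (pairs n) (triangles n) T A \<longrightarrow> e \<in> pairs n - A \<longrightarrow>
      contains_none T (insert e A) \<longrightarrow> card A \<le> 2 \<longrightarrow>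
      \<bar>gibbs_hypergraph.Q (pairs n) s l T A e - y\<bar> \<le> \<kappa>"
proof -
  define a where "a = (1 - s) * c\<^sup>2"
  have a: "0 \<le> a" "2 * a < 1" using s contr by (auto simp: a_def)
  \<comment> \<open>With this choice the accumulated error \<open>2 * \<theta> / (1 - 2 * a)\<close>
    is \<kappa> / 2, which leaves the other half for \<open>(2 * a) ^ j\<close>.\<close>
  define \<theta> where "\<theta> = \<kappa> * (1 - 2 * a) / 4"
  have \<theta>: "0 < \<theta>" using \<kappa> a by (simp add: \<theta>_def)
  have "(\<lambda>j. (2 * a) ^ j) \<longlonglongrightarrow> 0" using a by (intro LIMSEQ_power_zero) auto
  then have "\<forall>\<^sub>F j in sequentially. (2 * a) ^ j < \<kappa> / 2" using \<kappa> by (intro order_tendstoD) auto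
  then obtain j where j: "(2 * a) ^ j < \<kappa> / 2" by (auto simp: eventually_sequentially)
  \<comment> \<open>Two forced pairs per level, on top of the at most two present at the
    start.\<close>
  define k where "k = 2 + 2 * j"
  define K where "K = k + 3 * k\<^sup>2"
  \<comment> \<open>Small enough that changing all activities by a factor 1 + \<epsilon> or 1 -
    \<epsilon> moves \<open>a\<close> by less than \<theta>.\<close>
  define \<epsilon> where "\<epsilon> = min (1/2) (\<theta> / (4 * (a + 1)))"
  have \<epsilon>: "0 < \<epsilon>" "\<epsilon> \<le> 1/2"
    using \<theta> a by (simp add: \<epsilon>_def) (simp only: \<epsilon>_def min.cobounded1)
  have "a * \<epsilon> \<le> a * (\<theta> / (4 * (a + 1)))" using a by (intro mult_left_mono) (auto simp: \<epsilon>_def)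
  also have "\<dots> \<le> \<theta> / 4" using a \<theta> by (simp add: field_simps)
  finally have a\<epsilon>: "a * \<epsilon> \<le> \<theta> / 4" .
  have "a * \<epsilon> * \<epsilon> \<le> a * \<epsilon> * 1" using \<epsilon> a by (intro mult_left_mono) auto
  moreover have "0 \<le> a * \<epsilon> * \<epsilon>" "0 \<le> a * \<epsilon>" using \<epsilon> a by auto
  moreover have "a * (1 + \<epsilon>)\<^sup>2 = a + 2 * (a * \<epsilon>) + a * \<epsilon> * \<epsilon>"
    "a * (1 - \<epsilon>)\<^sup>2 = a - 2 * (a * \<epsilon>) + a * \<epsilon> * \<epsilon>"
    by (simp_all add: power2_eq_square algebra_simps)
  ultimately have lim: "a * (1 + \<epsilon>)\<^sup>2 < a + \<theta>" "a - \<theta> < a * (1 - \<epsilon>)\<^sup>2"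
    using a\<epsilon> \<theta> by linarith+
  define lo where "lo n = (1 - \<epsilon>) * c / sqrt n" for n :: nat
  define hi where "hi n = (1 + \<epsilon>) * c / sqrt n" for n :: nat
  have "(\<lambda>n::nat. a * (1 - \<epsilon>)\<^sup>2 * ((real n - 2 - (k + K)) / real n)) \<longlonglongrightarrow> a * (1 - \<epsilon>)\<^sup>2 * 1"
    by (intro tendsto_mult tendsto_const) real_asymp
  then have "\<forall>\<^sub>F n in sequentially. a - \<theta> < a * (1 - \<epsilon>)\<^sup>2 * ((real n - 2 - (k + K)) / real n)"
    using lim by (intro order_tendstoD) auto
  then have ev1: "\<forall>\<^sub>F n in sequentially. a - \<theta> \<le> (1 - s) * (lo n)\<^sup>2 * real (n - 2 - (k + K))"
    using eventually_gt_at_top[of "2 + (k + K)"]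
  proof eventually_elim
    case (elim n)
    have "(1 - s) * (lo n)\<^sup>2 * real (n - 2 - (k + K)) = a * (1 - \<epsilon>)\<^sup>2 * ((real n - 2 - (k + K)) / real n)"
      using elim by (simp add: lo_def a_def power_divide power_mult_distrib of_nat_diff)
    then show ?case using elim by simp
  qed
  have "(\<lambda>n::nat. a * (1 + \<epsilon>)\<^sup>2 * ((1 + 2 * ((1 + \<epsilon>)\<^sup>2 * c\<^sup>2 / real n)) * ((real n - 2) / real n)))
      \<longlonglongrightarrow> a * (1 + \<epsilon>)\<^sup>2 * 1"
    by (intro tendsto_mult tendsto_const) real_asymp
  then have "\<forall>\<^sub>F n in sequentially.
      a * (1 + \<epsilon>)\<^sup>2 * ((1 + 2 * ((1 + \<epsilon>)\<^sup>2 * c\<^sup>2 / real n)) * ((real n - 2) / real n)) < a + \<theta>"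
    using lim by (intro order_tendstoD) auto
  then have ev2: "\<forall>\<^sub>F n in sequentially. (1 - s) * (hi n)\<^sup>2 * (1 + 2 * (hi n)\<^sup>2) * real (n - 2) \<le> a + \<theta>"
    using eventually_gt_at_top[of 2]
  proof eventually_elim
    case (elim n)
    have "(1 - s) * (hi n)\<^sup>2 * (1 + 2 * (hi n)\<^sup>2) * real (n - 2)
      = a * (1 + \<epsilon>)\<^sup>2 * ((1 + 2 * ((1 + \<epsilon>)\<^sup>2 * c\<^sup>2 / real n)) * ((real n - 2) / real n))"
      using elim by (simp add: hi_def a_def power_divide power_mult_distrib of_nat_diff)
    then show ?case using elim by simp
  qed
  have hi0: "hi \<longlonglongrightarrow> 0" unfolding hi_def by real_asymp
  then have ev3: "\<forall>\<^sub>F n in sequentially. hi n < 1/2" by (rule order_tendstoD) simp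
  have "(\<lambda>n. (K + 1) * hi n) \<longlonglongrightarrow> real (K + 1) * 0" using hi0 by (intro tendsto_mult tendsto_const)
  then have ev4: "\<forall>\<^sub>F n in sequentially. (K + 1) * hi n < \<theta>" using \<theta> by (intro order_tendstoD) auto
  have "\<forall>\<^sub>F n in sequentially. \<forall>l T A e.
      (\<forall>f\<in>pairs n. (1 - \<epsilon>) * c / sqrt n \<le> l f \<and> l f \<le> (1 + \<epsilon>) * c / sqrt n) \<longrightarrow>
      linear_hypergraph.admissible (pairs n) (triangles n) T A \<longrightarrow> e \<in> pairs n - A \<longrightarrow>
      contains_none T (insert e A) \<longrightarrow> card A \<le> 2 \<longrightarrow>
      \<bar>gibbs_hypergraph.Q (pairs n) s l T A e - y\<bar> \<le> \<kappa>"
    using ev1 ev2 ev3 ev4 eventually_gt_at_top[of 0]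
  proof eventually_elim
    case (elim n)
    show ?case
    proof (intro allI impI)
      fix l T A e
      assume l: "\<forall>f\<in>pairs n. (1 - \<epsilon>) * c / sqrt n \<le> l f \<and> l f \<le> (1 + \<epsilon>) * c / sqrt n"
        and TA: "linear_hypergraph.admissible (pairs n) (triangles n) T A" "e \<in> pairs n - A"
          "contains_none T (insert e A)" "card A \<le> 2"
      have lo0: "0 < lo n" using \<epsilon> c elim by (simp add: lo_def)
      then have "0 < l f" if "f \<in> pairs n" for f using l that by (fastforce simp: lo_def)
      then interpret gibbs_hypergraph "pairs n" "triangles n" "n - 2" s l
        using s by (intro gibbs_hypergraph_triangles) auto
      have "\<bar>Q T A e - y\<bar> \<le> (2 * a) ^ j + 2 * \<theta> / (1 - 2 * a)"
      proof (rule Q_iterate[OF TA(1-3) _ _ _ y _ a _ _ _ K_def])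
        show "card A + 2 * j \<le> k" using TA by (simp add: k_def)
        show "lo n \<le> l f" "l f \<le> hi n" if "f \<in> pairs n" for f
          using l that by (auto simp: lo_def hi_def)
        show "y = exp (- (a * y\<^sup>2))" using fp unfolding a_def .
        show "0 \<le> \<theta>" "0 \<le> lo n" "hi n \<le> 1/2" using \<theta> lo0 elim(3) by simp_all
        show "a - \<theta> \<le> (1 - s) * (lo n)\<^sup>2 * real (n - 2 - (k + K))"
          "(1 - s) * (hi n)\<^sup>2 * (1 + 2 * (hi n)\<^sup>2) * real (n - 2) \<le> a + \<theta>" using elim(1,2) .
        show "real (K + 1) * hi n \<le> \<theta>" using elim(4) by simp
      qed
      also have "2 * \<theta> / (1 - 2 * a) = \<kappa> / 2" using a by (simp add: \<theta>_def field_simps)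
      finally show "\<bar>Q T A e - y\<bar> \<le> \<kappa>" using j by simp
    qed
  qed
  then show thesis using that[of \<epsilon>] \<epsilon> by simp
qed

section \<open>Exponential tilting\<close>

text \<open>The tangent-line bound \<open>exp (- x) \<ge> 1 - x\<close> at the tilted mean plays the role of the convexity of
  the logarithmic moment generating function, so only the mean of the tilted measure is needed.\<close>

lemma chernoff_tilt:
  fixes W f :: "'b \<Rightarrow> real"
  assumes "finite \<Omega>" "\<And>x. x \<in> \<Omega> \<Longrightarrow> 0 \<le> W x" "0 \<le> t"
    and mean: "(\<Sum>x\<in>\<Omega>. W x * exp (t * f x) * f x) \<le> m * (\<Sum>x\<in>\<Omega>. W x * exp (t * f x))"
  shows "(\<Sum>x\<in>\<Omega>. W x * exp (t * f x)) \<le> exp (t * m) * sum W \<Omega>"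
proof -
  let ?S = "\<Sum>x\<in>\<Omega>. W x * exp (t * f x)"
  have "exp (- (t * m)) * (1 - t * (f x - m)) * exp (t * f x) \<le> 1" for x
  proof -
    have "exp (- (t * m)) * (1 - t * (f x - m)) * exp (t * f x)
       \<le> exp (- (t * m)) * exp (- (t * (f x - m))) * exp (t * f x)"
      using exp_ge_add_one_self[of "- (t * (f x - m))"] by (intro mult_right_mono mult_left_mono) auto
    also have "\<dots> = 1" by (simp add: exp_add[symmetric] algebra_simps)
    finally show ?thesis .
  qed
  then have "W x * (exp (- (t * m)) * (1 - t * (f x - m)) * exp (t * f x)) \<le> W x * 1" if "x \<in> \<Omega>" for x
    using assms that by (intro mult_left_mono) auto
  then have "(\<Sum>x\<in>\<Omega>. W x * (exp (- (t * m)) * (1 - t * (f x - m)) * exp (t * f x))) \<le> sum W \<Omega>"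
    by (intro sum_mono) simp
  also have "(\<Sum>x\<in>\<Omega>. W x * (exp (- (t * m)) * (1 - t * (f x - m)) * exp (t * f x)))
     = (\<Sum>x\<in>\<Omega>. exp (- (t * m)) * (W x * exp (t * f x))
        - exp (- (t * m)) * t * (W x * exp (t * f x) * f x - m * (W x * exp (t * f x))))"
    by (intro sum.cong) (auto simp: algebra_simps)
  also have "\<dots> = exp (- (t * m)) * ?S - exp (- (t * m)) * t * ((\<Sum>x\<in>\<Omega>. W x * exp (t * f x) * f x) - m * ?S)"
    by (simp add: sum_subtractf sum_distrib_left right_diff_distrib mult.assoc)
  finally have "exp (- (t * m)) * ?S - exp (- (t * m)) * t * ((\<Sum>x\<in>\<Omega>. W x * exp (t * f x) * f x) - m * ?S)
    \<le> sum W \<Omega>" .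
  moreover have "exp (- (t * m)) * t * ((\<Sum>x\<in>\<Omega>. W x * exp (t * f x) * f x) - m * ?S) \<le> 0"
    using mean assms by (intro mult_nonneg_nonpos) auto
  ultimately have "exp (- (t * m)) * ?S \<le> sum W \<Omega>" by linarith
  then have "exp (t * m) * (exp (- (t * m)) * ?S) \<le> exp (t * m) * sum W \<Omega>"
    by (rule mult_left_mono) simp
  then show ?thesis by (simp add: mult.assoc[symmetric] exp_add[symmetric])
qed

text \<open>Markov's inequality for \<open>exp (t * f x)\<close>. It is applied with
  \<open>m < 0\<close>: even under the measure tilted towards large \<open>f\<close>, the mean of
  \<open>f\<close> stays negative.\<close>

lemma chernoff_bound:
  fixes W f :: "'b \<Rightarrow> real"
  assumes "finite \<Omega>" "\<And>x. x \<in> \<Omega> \<Longrightarrow> 0 \<le> W x" "0 \<le> t"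
    and mean: "(\<Sum>x\<in>\<Omega>. W x * exp (t * f x) * f x) \<le> m * (\<Sum>x\<in>\<Omega>. W x * exp (t * f x))"
  shows "(\<Sum>x | x \<in> \<Omega> \<and> 0 \<le> f x. W x) \<le> exp (t * m) * sum W \<Omega>"
proof -
  have "(\<Sum>x | x \<in> \<Omega> \<and> 0 \<le> f x. W x) \<le> (\<Sum>x | x \<in> \<Omega> \<and> 0 \<le> f x. W x * exp (t * f x))"
  proof (rule sum_mono)
    fix x assume x: "x \<in> {x. x \<in> \<Omega> \<and> 0 \<le> f x}"
    then have "1 \<le> exp (t * f x)" using assms(3) by simp
    then have "W x * 1 \<le> W x * exp (t * f x)" using assms(2) x by (intro mult_left_mono) auto
    then show "W x \<le> W x * exp (t * f x)" by simp
  qed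
  also have "\<dots> \<le> (\<Sum>x\<in>\<Omega>. W x * exp (t * f x))"
    using assms by (intro sum_mono2) auto
  also have "\<dots> \<le> exp (t * m) * sum W \<Omega>" by (rule chernoff_tilt[OF assms])
  finally show ?thesis .
qed

section \<open>Expected edge weights and hyperedge counts under a Gibbs measure\<close>

context gibbs_hypergraph
begin

definition weight :: "'a set \<Rightarrow> real" where
  "weight G = prod l G * s ^ card {t \<in> H. t \<subseteq> G}"

lemma sum_weight: "sum weight (Pow V) = Z H {}"
  by (simp add: gibbs_sum_def weight_def)

lemma sum_weight_containing:
  assumes "B \<subseteq> V"
  shows "(\<Sum>G | G \<in> Pow V \<and> B \<subseteq> G. weight G) = prod l B * Z H B"
  using gibbs_sum_restrict[OF finite_V assms, where A = "{}" and H = H] by (simp add: weight_def)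

lemma contains_none_small: "T \<subseteq> H \<Longrightarrow> finite A \<Longrightarrow> card A < 3 \<Longrightarrow> contains_none T A"
  unfolding contains_none_def by (metis card_mono edge_card not_le subsetD)

lemma admissible_empty: "admissible H {}"
  unfolding admissible_def using contains_none_small[of H "{}"] by auto

lemma Z_empty_pos: "0 < Z H {}"
  using admissible_empty Z_pos unfolding admissible_def by blast

lemma mean_edges:
  "(\<Sum>G\<in>Pow V. weight G * sum w G) = Z H {} * (\<Sum>e\<in>V. w e * (l e * Q H {} e))"
proof -
  have "(\<Sum>G\<in>Pow V. weight G * sum w G) = (\<Sum>G\<in>Pow V. \<Sum>e\<in>V. if e \<in> G then w e * weight G else 0)"
  proof (rule sum.cong[OF refl])
    fix G assume "G \<in> Pow V"
    then have "{e \<in> V. e \<in> G} = G" by auto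
    then have "(\<Sum>e\<in>V. if e \<in> G then w e * weight G else 0) = (\<Sum>e\<in>G. w e * weight G)"
      using sum.inter_filter[OF finite_V, of "\<lambda>e. w e * weight G" "\<lambda>e. e \<in> G"] by simp
    then show "weight G * sum w G = (\<Sum>e\<in>V. if e \<in> G then w e * weight G else 0)"
      by (simp add: sum_distrib_right mult.commute)
  qed
  also have "\<dots> = (\<Sum>e\<in>V. \<Sum>G\<in>Pow V. if {e} \<subseteq> G then w e * weight G else 0)"
    unfolding insert_subset by (subst sum.swap) simp
  also have "\<dots> = (\<Sum>e\<in>V. w e * (l e * Z H {e}))"
  proof (rule sum.cong[OF refl])
    fix e assume e: "e \<in> V"
    have "(\<Sum>G\<in>Pow V. if {e} \<subseteq> G then w e * weight G else 0) = (\<Sum>G | G \<in> Pow V \<and> {e} \<subseteq> G. w e * weight G)"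
      using finite_V by (intro sum.inter_filter[symmetric]) simp
    also have "\<dots> = w e * (l e * Z H {e})"
      unfolding sum_distrib_left[symmetric] using sum_weight_containing[of "{e}"] e by simp
    finally show "(\<Sum>G\<in>Pow V. if {e} \<subseteq> G then w e * weight G else 0) = w e * (l e * Z H {e})" .
  qed
  also have "\<dots> = (\<Sum>e\<in>V. Z H {} * (w e * (l e * Q H {} e)))"
    using Z_empty_pos by (intro sum.cong refl) (simp add: Q_def)
  finally show ?thesis by (simp add: sum_distrib_left)
qed

lemma mean_hyperedges:
  "(\<Sum>G\<in>Pow V. weight G * real (card {t \<in> H. t \<subseteq> G})) = (\<Sum>t\<in>H. prod l t * Z H t)"
proof -
  have "weight G * real (card {t \<in> H. t \<subseteq> G}) = (\<Sum>t\<in>H. if t \<subseteq> G then weight G else 0)" for G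
    using sum.inter_filter[OF finite_H, of "\<lambda>t. weight G" "\<lambda>t. t \<subseteq> G"]
    by (simp add: mult.commute)
  then have "(\<Sum>G\<in>Pow V. weight G * real (card {t \<in> H. t \<subseteq> G}))
      = (\<Sum>t\<in>H. \<Sum>G\<in>Pow V. if t \<subseteq> G then weight G else 0)"
    by (simp only: sum.swap[of _ H])
  also have "\<dots> = (\<Sum>t\<in>H. prod l t * Z H t)"
  proof (rule sum.cong[OF refl])
    fix t assume "t \<in> H"
    then show "(\<Sum>G\<in>Pow V. if t \<subseteq> G then weight G else 0) = prod l t * Z H t"
      using sum.inter_filter[of "Pow V" weight "\<lambda>G. t \<subseteq> G"] finite_V sum_weight_containing[of t] edge_subset[of t]
      by simp
  qed
  finally show ?thesis .
qed

text \<open>Chain rule over the three vertices of \<open>t\<close>. The last vertex is added in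
  \<open>H - {t}\<close>, where it completes nothing; \<open>t\<close> itself then contributes
  exactly \<open>s\<close>, and its deletion changes the normalisation only by a factor
  \<open>1 - \<beta>\<close> with \<open>\<beta> \<le> hi\<close>.\<close>

lemma hyperedge_ratio:
  assumes t: "t \<in> H" and y: "0 \<le> y" "y \<le> 1" and hi: "\<And>f. f \<in> V \<Longrightarrow> l f \<le> hi" "hi \<le> 1/2"
    and Q: "\<And>U B f. admissible U B \<Longrightarrow> f \<in> V - B \<Longrightarrow> contains_none U (insert f B) \<Longrightarrow> card B \<le> 2
      \<Longrightarrow> \<bar>Q U B f - y\<bar> \<le> \<kappa>"
  shows "\<bar>Z H t / Z H {} - s * y ^ 3\<bar> \<le> 3 * \<kappa> + 2 * hi"
proof -
  obtain e f g where efg: "t = {e, f, g}" "e \<noteq> f" "f \<noteq> g" "e \<noteq> g"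
    using edge_card[OF t] by (auto simp: card_3_iff)
  have V: "e \<in> V" "f \<in> V" "g \<in> V" using edge_subset[OF t] efg by auto
  have cn: "contains_none H {e}" "contains_none H {f, e}" using efg by (auto intro!: contains_none_small)
  have cn3: "contains_none (H - {t}) {g, f, e}" unfolding contains_none_def
  proof (intro ballI notI)
    fix t' assume t': "t' \<in> H - {t}" "t' \<subseteq> {g, f, e}"
    then have "t' = t" using edge_card[OF t] edge_card[of t'] edge_finite[OF t] efg
      by (intro card_subset_eq) auto
    then show False using t' by simp
  qed
  have a1: "admissible H {e}" by (rule admissible_mono[OF admissible_empty]) (use V cn in auto)
  have a2: "admissible H {f, e}" by (rule admissible_mono[OF a1]) (use V cn in auto)
  have a3: "admissible (H - {t}) {f, e}"
  proof -
    have "card {t' \<in> H - (H - {t}). x \<in> t'} \<le> card {f, e}" for x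
    proof -
      have "card {t' \<in> H - (H - {t}). x \<in> t'} \<le> card {t}" by (intro card_mono) auto
      then show ?thesis using efg by simp
    qed
    then show ?thesis using a2 unfolding admissible_def contains_none_def by auto
  qed
  define q1 where "q1 = Q H {} e"
  define q2 where "q2 = Q H {e} f"
  define q3 where "q3 = Q (H - {t}) {f, e} g"
  have c: "card {f, e} = 2" using efg by simp
  have q1: "\<bar>q1 - y\<bar> \<le> \<kappa>" "0 \<le> q1" "q1 \<le> 1" unfolding q1_def
    using Q[OF admissible_empty] V cn Q_nonneg Q_le_1[OF admissible_empty] by auto
  have q2: "\<bar>q2 - y\<bar> \<le> \<kappa>" "0 \<le> q2" "q2 \<le> 1" unfolding q2_def
    using Q[OF a1] V cn efg Q_nonneg Q_le_1[OF a1] by auto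
  have q3: "\<bar>q3 - y\<bar> \<le> \<kappa>" "0 \<le> q3" "q3 \<le> 1" unfolding q3_def
    using Q[OF a3] V cn3 efg c Q_nonneg Q_le_1[OF a3] by auto
  define B where "B = Z (H - {t}) {f, e}"
  have Bpos: "0 < B" unfolding B_def using a3 Z_pos unfolding admissible_def by auto
  have Z1: "Z H {e} = q1 * Z H {}" unfolding q1_def Q_def using Z_empty_pos by simp
  have Z2: "Z H {f, e} = q2 * Z H {e}" unfolding q2_def Q_def using Z_pos[OF cn(1)] by simp
  have Z3: "Z (H - {t}) t = q3 * B" unfolding q3_def Q_def B_def using Bpos efg
    by (simp add: B_def insert_commute)
  have d: "t - {f, e} = {g}" "{f, e} \<union> t = t" "t - t = {}" "t \<union> t = t" using efg by auto
  have Z4: "Z H {f, e} = B * (1 - (1 - s) * l g * q3)"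
    using gibbs_sum_remove[OF finite_V finite_H t edge_subset[OF t], of s l "{f, e}"] Z3
    unfolding d B_def[symmetric] by (simp add: algebra_simps)
  have Z5: "Z H t = s * q3 * B"
    using gibbs_sum_remove[OF finite_V finite_H t edge_subset[OF t], of s l t] Z3
    unfolding d by (simp add: algebra_simps)
  define \<beta> where "\<beta> = (1 - s) * l g * q3"
  have lg: "0 < l g" "l g \<le> hi" using l_pos hi V by auto
  have "(1 - s) * l g * q3 \<le> 1 * hi * 1" using s_nonneg s_le_1 lg q3 by (intro mult_mono) auto
  then have \<beta>: "0 \<le> \<beta>" "\<beta> \<le> hi" unfolding \<beta>_def using s_le_1 lg q3 by auto
  define q where "q = s * (q1 * q2 * q3)"
  have q01: "0 \<le> q1 * q2 * q3" "q1 * q2 * q3 \<le> 1"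
    using q1 q2 q3 by (auto intro!: mult_le_one)
  then have q: "0 \<le> q" "q \<le> 1" unfolding q_def using s_nonneg s_le_1 by (auto intro!: mult_le_one)
  have "Z H t / Z H {} * (1 - \<beta>) = s * q3 * (B * (1 - \<beta>)) / Z H {}" unfolding Z5 by simp
  also have "B * (1 - \<beta>) = q2 * q1 * Z H {}" using Z4 Z2 Z1 unfolding \<beta>_def by simp
  finally have R: "Z H t / Z H {} * (1 - \<beta>) = q" unfolding q_def using Z_empty_pos by simp
  define R where "R = Z H t / Z H {}"
  have R0: "0 \<le> R" unfolding R_def using Z_nonneg by simp
  have "R * (1 / 2) \<le> R * (1 - \<beta>)" using R0 \<beta> hi by (intro mult_left_mono) auto
  then have "R \<le> 2" using R q unfolding R_def[symmetric] by linarith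
  then have "R * \<beta> \<le> 2 * hi" using R0 \<beta> by (intro mult_mono) auto
  moreover have "0 \<le> R * \<beta>" using R0 \<beta> by simp
  ultimately have R1: "\<bar>R - q\<bar> \<le> 2 * hi" using R unfolding R_def[symmetric] by (simp add: algebra_simps)
  have "q1 * q2 * q3 - y ^ 3 = (q1 - y) * (q2 * q3) + y * ((q2 - y) * q3) + y * y * (q3 - y)"
    by (simp add: algebra_simps power3_eq_cube)
  also have "\<bar>\<dots>\<bar> \<le> \<bar>(q1 - y) * (q2 * q3)\<bar> + \<bar>y * ((q2 - y) * q3)\<bar> + \<bar>y * y * (q3 - y)\<bar>" by linarith
  also have "\<dots> \<le> \<kappa> * 1 + 1 * (\<kappa> * 1) + 1 * \<kappa>"
    unfolding abs_mult using q1 q2 q3 y by (intro add_mono mult_mono mult_le_one) auto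
  finally have "\<bar>q1 * q2 * q3 - y ^ 3\<bar> \<le> 3 * \<kappa>" by simp
  then have "s * \<bar>q1 * q2 * q3 - y ^ 3\<bar> \<le> 1 * (3 * \<kappa>)"
    using s_nonneg s_le_1 by (intro mult_mono) auto
  moreover have "\<bar>q - s * y ^ 3\<bar> = s * \<bar>q1 * q2 * q3 - y ^ 3\<bar>"
    unfolding q_def right_diff_distrib[symmetric] abs_mult using s_nonneg by simp
  ultimately show ?thesis using R1 unfolding R_def by linarith
qed

end

section \<open>Maximum cuts and the law of the random graph\<close>

lemma cut_edges_eq:
  assumes "E \<subseteq> pairs n"
  shows "cut_edges n E S = {e \<in> E. card (e \<inter> S) = 1}"
proof -
  have "(\<exists>u\<in>S. \<exists>v\<in>{1..n} - S. e = {u, v}) \<longleftrightarrow> card (e \<inter> S) = 1" if "e \<in> E" for e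
  proof -
    have "e \<subseteq> {1..n}" "card e = 2" using assms that by (auto simp: pairs_def nsets_def)
    then obtain a b where e: "e = {a, b}" "a \<noteq> b" "a \<in> {1..n}" "b \<in> {1..n}"
      by (auto simp: card_2_iff)
    have "e \<inter> S = (if a \<in> S then {a} else {}) \<union> (if b \<in> S then {b} else {})" using e by auto
    then have "card (e \<inter> S) = 1 \<longleftrightarrow> (a \<in> S \<longleftrightarrow> b \<notin> S)" using e by simp
    also have "\<dots> \<longleftrightarrow> (\<exists>u\<in>S. \<exists>v\<in>{1..n} - S. e = {u, v})"
    proof
      assume "a \<in> S \<longleftrightarrow> b \<notin> S"
      then show "\<exists>u\<in>S. \<exists>v\<in>{1..n} - S. e = {u, v}"
        using e by (cases "a \<in> S") (blast, metis Diff_iff insert_commute)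
    next
      assume "\<exists>u\<in>S. \<exists>v\<in>{1..n} - S. e = {u, v}"
      then obtain u v where "u \<in> S" "v \<notin> S" "{a, b} = {u, v}" using e by blast
      then show "a \<in> S \<longleftrightarrow> b \<notin> S" using e(2) by (metis doubleton_eq_iff)
    qed
    finally show ?thesis by simp
  qed
  then show ?thesis unfolding cut_edges_def by auto
qed

text \<open>Toggling one endpoint of \<open>e\<close> exchanges the sets that split \<open>e\<close>
  with those that do not.\<close>

lemma card_splitting_sets:
  assumes "finite A" "e \<subseteq> A" "card e = 2"
  shows "2 * card {S \<in> Pow A. card (e \<inter> S) = 1} = 2 ^ card A"
proof -
  obtain a b where e: "e = {a, b}" "a \<noteq> b" using assms by (auto simp: card_2_iff)
  have iff: "card (e \<inter> S) = 1 \<longleftrightarrow> (a \<in> S \<longleftrightarrow> b \<notin> S)" for S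
  proof -
    have "e \<inter> S = (if a \<in> S then {a} else {}) \<union> (if b \<in> S then {b} else {})" using e by auto
    then show ?thesis using e by simp
  qed
  define tog where "tog S = (if a \<in> S then S - {a} else insert a S)" for S
  have "bij_betw tog {S \<in> Pow A. card (e \<inter> S) = 1} {S \<in> Pow A. \<not> card (e \<inter> S) = 1}"
    unfolding iff
    by (rule bij_betwI[where g = tog]) (use assms e in \<open>auto simp: tog_def split: if_splits\<close>)
  then have "card {S \<in> Pow A. card (e \<inter> S) = 1} = card {S \<in> Pow A. \<not> card (e \<inter> S) = 1}"
    by (rule bij_betw_same_card)
  moreover have "card {S \<in> Pow A. card (e \<inter> S) = 1} + card {S \<in> Pow A. \<not> card (e \<inter> S) = 1}
    = card ({S \<in> Pow A. card (e \<inter> S) = 1} \<union> {S \<in> Pow A. \<not> card (e \<inter> S) = 1})"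
    using assms by (intro card_Un_disjoint[symmetric]) auto
  moreover have "{S \<in> Pow A. card (e \<inter> S) = 1} \<union> {S \<in> Pow A. \<not> card (e \<inter> S) = 1} = Pow A" by auto
  ultimately show ?thesis using card_Pow[OF assms(1)] by simp
qed

text \<open>Averaging over all \<open>S\<close>: each edge is split by exactly half of them, so not
  every cut can be smaller than half of the edges.\<close>

lemma exists_half_cut:
  assumes "E \<subseteq> pairs n"
  obtains S where "S \<subseteq> {1..n}" "card E \<le> 2 * card (cut_edges n E S)"
proof (rule ccontr)
  note half_cut = that
  assume none: "\<not> thesis"
  have less: "2 * card (cut_edges n E S) < card E" if S: "S \<in> Pow {1..n}" for S
  proof (rule ccontr)
    assume "\<not> 2 * card (cut_edges n E S) < card E"
    then have thesis using S by (intro half_cut[of S]) auto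
    then show False using none by simp
  qed
  have fE: "finite E" using assms finite_pairs finite_subset by metis
  have "(\<Sum>S\<in>Pow {1..n}. 2 * card (cut_edges n E S)) < (\<Sum>S\<in>Pow {1..n}. card E)"
    by (rule sum_strict_mono) (use less in auto)
  moreover have "(\<Sum>S\<in>Pow {1..n}. 2 * card (cut_edges n E S))
      = (\<Sum>S\<in>Pow {1..n}. \<Sum>e\<in>E. if card (e \<inter> S) = 1 then 2 else 0)"
  proof (rule sum.cong[OF refl])
    fix S
    show "2 * card (cut_edges n E S) = (\<Sum>e\<in>E. if card (e \<inter> S) = 1 then 2 else 0)"
      unfolding cut_edges_eq[OF assms] using sum.inter_filter[OF fE, of "\<lambda>_. 2::nat" "\<lambda>e. card (e \<inter> S) = 1"]
      by simp
  qed
  moreover have "(\<Sum>S\<in>Pow {1..n}. \<Sum>e\<in>E. if card (e \<inter> S) = 1 then 2 else 0)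
      = (\<Sum>e\<in>E. \<Sum>S\<in>Pow {1..n}. if card (e \<inter> S) = 1 then 2 else (0::nat))"
    by (rule sum.swap)
  moreover have "(\<Sum>e\<in>E. \<Sum>S\<in>Pow {1..n}. if card (e \<inter> S) = 1 then 2 else (0::nat)) = (\<Sum>e\<in>E. 2 ^ n)"
  proof (rule sum.cong[OF refl])
    fix e assume "e \<in> E"
    then have "e \<subseteq> {1..n}" "card e = 2" using assms by (auto simp: pairs_def nsets_def)
    then have "2 * card {S \<in> Pow {1..n}. card (e \<inter> S) = 1} = 2 ^ n"
      using card_splitting_sets[of "{1..n}" e] by simp
    moreover have "(\<Sum>S\<in>Pow {1..n}. if card (e \<inter> S) = 1 then 2 else (0::nat))
       = (\<Sum>S | S \<in> Pow {1..n} \<and> card (e \<inter> S) = 1. 2)"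
      by (rule sum.inter_filter[symmetric]) simp
    ultimately show "(\<Sum>S\<in>Pow {1..n}. if card (e \<inter> S) = 1 then 2 else (0::nat)) = 2 ^ n" by simp
  qed
  ultimately show False by (simp add: card_Pow)
qed

lemma finite_cut_sizes: "finite {card (cut_edges n E S) | S. S \<subseteq> {1..n}}"
proof -
  have "{card (cut_edges n E S) | S. S \<subseteq> {1..n}} = (\<lambda>S. card (cut_edges n E S)) ` Pow {1..n}" by auto
  then show ?thesis by simp
qed

lemma MC_ge_half:
  assumes "E \<subseteq> pairs n" "E \<noteq> {}"
  shows "1 / 2 \<le> MC n E"
proof -
  obtain S where S: "S \<subseteq> {1..n}" "card E \<le> 2 * card (cut_edges n E S)"
    using exists_half_cut[OF assms(1)] by blast
  have "card (cut_edges n E S) \<le> Max {card (cut_edges n E S) | S. S \<subseteq> {1..n}}"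
    using S by (intro Max_ge finite_cut_sizes) auto
  then have "card E \<le> 2 * Max {card (cut_edges n E S) | S. S \<subseteq> {1..n}}" using S by linarith
  moreover have "0 < card E"
    using assms finite_pairs[of n] finite_subset[of E "pairs n"] by (simp add: card_gt_0_iff)
  ultimately show ?thesis using assms(2) unfolding MC_def by (simp add: field_simps)
qed

lemma MC_gt_imp_cut:
  assumes "E \<subseteq> pairs n" "E \<noteq> {}" "x < MC n E"
  obtains S where "S \<subseteq> {1..n}" "x * real (card E) < real (card (cut_edges n E S))"
proof -
  have "Max {card (cut_edges n E S) | S. S \<subseteq> {1..n}} \<in> {card (cut_edges n E S) | S. S \<subseteq> {1..n}}"
    by (intro Max_in finite_cut_sizes) auto
  then obtain S where S: "S \<subseteq> {1..n}"
    "Max {card (cut_edges n E S) | S. S \<subseteq> {1..n}} = card (cut_edges n E S)" by auto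
  have "0 < card E"
    using assms finite_pairs[of n] finite_subset[of E "pairs n"] by (simp add: card_gt_0_iff)
  then have "x * real (card E) < real (card (cut_edges n E S))"
    using assms(2,3) unfolding MC_def S(2) by (simp add: field_simps)
  then show thesis using that S by blast
qed

lemma MC_deviation_imp_split:
  assumes "G \<subseteq> pairs n" "\<delta> < \<bar>MC n G - 1/2\<bar>"
  shows "\<exists>S\<subseteq>{1..n}. (1/2 + \<delta>) * real (card G) \<le> real (card {e \<in> G. card (e \<inter> S) = 1})"
proof (cases "G = {}")
  case False
  then have "1/2 + \<delta> < MC n G" using MC_ge_half[OF assms(1) False] assms(2) by linarith
  then obtain S where "S \<subseteq> {1..n}" "(1/2 + \<delta>) * real (card G) < real (card (cut_edges n G S))"
    using MC_gt_imp_cut[OF assms(1) False] by blast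
  then show ?thesis unfolding cut_edges_eq[OF assms(1)] using less_imp_le by blast
qed auto \<comment> \<open>\<open>MC n {} = 0\<close> deviates from \<open>1/2\<close>, but then any \<open>S\<close> satisfies the inequality\<close>

section \<open>The law of the random graph\<close>

lemma set_pmf_Gnp: "set_pmf (Gnp n p) \<subseteq> Pow (pairs n)"
  unfolding Gnp_def pairs_def by auto

lemma pmf_Gnp:
  assumes "0 < p" "p < 1" "E \<subseteq> pairs n"
  shows "pmf (Gnp n p) E = (1 - p) ^ card (pairs n) * (p / (1 - p)) ^ card E"
proof -
  let ?M = "Pi_pmf (pairs n) False (\<lambda>_. bernoulli_pmf p)"
  let ?h = "\<lambda>f. {e \<in> pairs n. f e}"
  define f where "f = (\<lambda>e. e \<in> E)"
  have fE: "finite E" using assms finite_pairs finite_subset by metis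
  have hf: "?h f = E" using assms by (auto simp: f_def)
  have "pmf ?M f = (\<Prod>e\<in>pairs n. pmf (bernoulli_pmf p) (f e))"
    using assms by (intro pmf_Pi' finite_pairs) (auto simp: f_def)
  also have "\<dots> = (\<Prod>e\<in>pairs n. if e \<in> E then p else 1 - p)"
    using assms by (intro prod.cong) (auto simp: f_def)
  also have "\<dots> = p ^ card E * (1 - p) ^ card (pairs n - E)"
  proof -
    have "pairs n \<inter> {e. e \<in> E} = E" "pairs n \<inter> - {e. e \<in> E} = pairs n - E" using assms by auto
    then show ?thesis using prod.If_cases[OF finite_pairs[of n], of "\<lambda>e. e \<in> E" "\<lambda>_. p" "\<lambda>_. 1 - p"] by simp
  qed
  also have "card (pairs n - E) = card (pairs n) - card E" by (rule card_Diff_subset[OF fE assms(3)])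
  also have "p ^ card E * (1 - p) ^ (card (pairs n) - card E) = (1 - p) ^ card (pairs n) * (p / (1 - p)) ^ card E"
    using assms card_mono[OF finite_pairs assms(3)]
    by (simp add: power_diff power_divide)
  finally have pmf_f: "pmf ?M f = (1 - p) ^ card (pairs n) * (p / (1 - p)) ^ card E" .
  have "pmf (map_pmf ?h ?M) (?h f) = pmf ?M f"
  proof (rule pmf_map_inj)
    \<comment> \<open>Functions in the support are \<open>False\<close> outside
      \<open>pairs n\<close>, so the edge set determines them.\<close>
    show "inj_on ?h (set_pmf ?M)"
    proof (rule inj_onI)
      fix g g' assume g: "g \<in> set_pmf ?M" "g' \<in> set_pmf ?M" "?h g = ?h g'"
      have "g e = g' e" for e
      proof (cases "e \<in> pairs n")
        case True
        then show ?thesis using g(3) by blast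
      next
        case False
        then show ?thesis using g(1,2) set_Pi_pmf_subset[OF finite_pairs[of n], of False "\<lambda>_. bernoulli_pmf p"]
          by blast
      qed
      then show "g = g'" by auto
    qed
    have "pmf ?M f \<noteq> 0" unfolding pmf_f using assms by simp
    then show "f \<in> set_pmf ?M" by (simp add: set_pmf_iff)
  qed
  then show ?thesis unfolding pmf_f hf by (simp add: Gnp_def pairs_def)
qed

text \<open>The power of \<open>1 - p\<close> cancels in conditional probabilities, so afterwards
  only sums of powers of the activity matter.\<close>

lemma measure_Gnp:
  assumes "0 < p" "p < 1"
  shows "measure (measure_pmf (Gnp n p)) {G. P G}
    = (1 - p) ^ card (pairs n) * (\<Sum>G | G \<in> Pow (pairs n) \<and> P G. (p / (1 - p)) ^ card G)"
proof -
  let ?M = "Gnp n p"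
  have "measure ?M {G. P G} = measure ?M ({G \<in> Pow (pairs n). P G} \<inter> set_pmf ?M)"
    using set_pmf_Gnp[of n p] by (subst measure_Int_set_pmf[symmetric]) (auto intro!: arg_cong[where f = "measure ?M"])
  also have "\<dots> = sum (pmf ?M) {G \<in> Pow (pairs n). P G}"
    unfolding measure_Int_set_pmf using finite_pairs by (intro measure_measure_pmf_finite) auto
  also have "\<dots> = (\<Sum>G | G \<in> Pow (pairs n) \<and> P G. (1 - p) ^ card (pairs n) * (p / (1 - p)) ^ card G)"
    using assms pmf_Gnp by (intro sum.cong) auto
  finally show ?thesis by (simp add: sum_distrib_left)
qed

text \<open>At \<open>s = 1\<close> the Gibbs measure is G(n, p) up to normalisation and its
  partition function factorises, so \<open>mean_hyperedges\<close> already computes this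
  expectation.\<close>

lemma expected_triangles_eq:
  assumes "0 < p" "p < 1"
  shows "expected_triangles n p = real (n choose 3) * p ^ 3"
proof -
  define q where "q = p / (1 - p)"
  have q: "0 < q" "1 + q = 1 / (1 - p)" "(1 - p) * q = p" using assms by (auto simp: q_def field_simps)
  interpret gibbs_hypergraph "pairs n" "triangles n" "n - 2" 1 "\<lambda>_. q"
    using q by (intro gibbs_hypergraph_triangles) auto
  have Z1: "Z (triangles n) A = (1 + q) ^ card (pairs n - A)" for A
  proof -
    have "(\<Prod>e\<in>pairs n - A. q + 1) = (\<Sum>G\<in>Pow (pairs n - A). (\<Prod>e\<in>G. q) * (\<Prod>e\<in>(pairs n - A) - G. 1))"
      using finite_pairs by (intro prod_add) auto
    then show ?thesis by (simp add: gibbs_sum_def add.commute)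
  qed
  have "expected_triangles n p = (\<Sum>G\<in>Pow (pairs n). real (triangle_count n G) * pmf (Gnp n p) G)"
    unfolding expected_triangles_def by (rule integral_measure_pmf_real) (use finite_pairs set_pmf_Gnp[of n p] in \<open>simp, blast\<close>)
  also have "\<dots> = (\<Sum>G\<in>Pow (pairs n). (1 - p) ^ card (pairs n) *
      (weight G * real (card {t \<in> triangles n. t \<subseteq> G})))"
    using pmf_Gnp[OF assms, folded q_def] by (intro sum.cong) (auto simp: triangle_count_eq weight_def)
  also have "\<dots> = (1 - p) ^ card (pairs n) * (\<Sum>t\<in>triangles n. q ^ card t * (1 + q) ^ card (pairs n - t))"
    unfolding sum_distrib_left[symmetric] mean_hyperedges Z1 by simp
  also have "\<dots> = (\<Sum>t\<in>triangles n. p ^ 3)"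
    unfolding sum_distrib_left
  proof (rule sum.cong[OF refl])
    fix t assume t: "t \<in> triangles n"
    have "card (pairs n - t) = card (pairs n) - 3"
      using edge_finite[OF t] edge_subset[OF t] edge_card[OF t] by (simp add: card_Diff_subset)
    moreover have "3 \<le> card (pairs n)"
      using card_mono[OF finite_pairs edge_subset[OF t]] edge_card[OF t] by simp
    then obtain m where "card (pairs n) = 3 + m" using le_Suc_ex by blast
    ultimately have "(1 - p) ^ card (pairs n) * (q ^ card t * (1 + q) ^ card (pairs n - t))
      = ((1 - p) * q) ^ 3 * ((1 - p) * (1 + q)) ^ m"
      using edge_card[OF t] by (simp add: power_add power_mult_distrib)
    then show "(1 - p) ^ card (pairs n) * (q ^ card t * (1 + q) ^ card (pairs n - t)) = p ^ 3"
      using q assms by simp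
  qed
  finally show ?thesis by (simp add: card_triangles)
qed

section \<open>Large deviations in the sparse regime\<close>

lemma card_split_pairs_le:
  assumes "S \<subseteq> {1..n}"
  shows "real (card {e \<in> pairs n. card (e \<inter> S) = 1}) \<le> (real n)\<^sup>2 / 4"
proof -
  have fS: "finite S" using assms finite_subset by auto
  have "{e \<in> pairs n. card (e \<inter> S) = 1} = cut_edges n (pairs n) S"
    using cut_edges_eq[of "pairs n" n S] by simp
  also have "\<dots> \<subseteq> (\<lambda>(u, v). {u, v}) ` (S \<times> ({1..n} - S))" unfolding cut_edges_def by auto
  finally have "card {e \<in> pairs n. card (e \<inter> S) = 1} \<le> card (S \<times> ({1..n} - S))"
    using fS by (intro surj_card_le) auto
  also have "\<dots> = card S * (n - card S)"
    using fS assms by (simp add: card_cartesian_product card_Diff_subset)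
  finally have "real (card {e \<in> pairs n. card (e \<inter> S) = 1}) \<le> real (card S * (n - card S))"
    by (rule of_nat_mono)
  also have "\<dots> = real (card S) * (real n - real (card S))"
    using card_mono[OF _ assms] by (simp add: of_nat_diff)
  also have "\<dots> \<le> (real n)\<^sup>2 / 4"
    using zero_le_power2[of "real n - 2 * real (card S)"] by (simp add: power2_eq_square algebra_simps)
  finally show ?thesis .
qed

locale sparse_regime =
  fixes c :: real and q :: "nat \<Rightarrow> real"
  assumes c_pos: "0 < c" and q_lim: "(\<lambda>n. q n * sqrt n) \<longlonglongrightarrow> c"
begin

definition wt :: "nat \<Rightarrow> real \<Rightarrow> edge_set \<Rightarrow> real" where
  "wt n s G = q n ^ card G * s ^ triangle_count n G"

definition ZZ :: "nat \<Rightarrow> real \<Rightarrow> real" where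
  "ZZ n s = (\<Sum>G\<in>Pow (pairs n). wt n s G)"

text \<open>n^(3/2) is the order of both the edge count and the triangle count at density c / sqrt
  n, and the speed of every large deviation below.\<close>

definition vol :: "nat \<Rightarrow> real" where
  "vol n = real n * sqrt n"

text \<open>\<open>y\<close> is the limiting normalised pair density at tilt \<open>s\<close>; the
  last conjunct makes the recursion contract, which identifies \<open>y\<close> as that
  limit.\<close>

definition replica :: "real \<Rightarrow> real \<Rightarrow> bool" where
  "replica s y \<longleftrightarrow> 0 \<le> s \<and> s \<le> 1 \<and> 0 < y \<and> y \<le> 1 \<and>
    y = exp (- ((1 - s) * c\<^sup>2 * y\<^sup>2)) \<and> 2 * ((1 - s) * c\<^sup>2) < 1"

lemma q_bounds:
  assumes "0 < \<epsilon>"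
  shows "\<forall>\<^sub>F n in sequentially. (1 - \<epsilon>) * c / sqrt n \<le> q n \<and> q n \<le> (1 + \<epsilon>) * c / sqrt n"
proof -
  have "(1 - \<epsilon>) * c < c" "c < (1 + \<epsilon>) * c" using assms c_pos by auto
  then have "\<forall>\<^sub>F n in sequentially. (1 - \<epsilon>) * c < q n * sqrt n"
    "\<forall>\<^sub>F n in sequentially. q n * sqrt n < (1 + \<epsilon>) * c"
    using q_lim by (auto dest: order_tendstoD)
  then show ?thesis using eventually_gt_at_top[of 0]
    by eventually_elim (simp add: field_simps)
qed

lemma q_pos: "\<forall>\<^sub>F n in sequentially. 0 < q n"
proof -
  have "\<forall>\<^sub>F n in sequentially. 0 < q n * sqrt n" using q_lim c_pos by (intro order_tendstoD)
  then show ?thesis by eventually_elim (auto simp: zero_less_mult_iff)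
qed

lemma vol_at_top: "filterlim vol at_top sequentially"
  unfolding vol_def by real_asymp

lemma split_deviation:
  assumes "replica s y" "0 < \<delta>" "\<delta> \<le> 1/2"
  obtains \<rho> where "0 < \<rho>" "\<forall>\<^sub>F n in sequentially. \<forall>S\<subseteq>{1..n}.
    (\<Sum>G | G \<in> Pow (pairs n) \<and> (1/2 + \<delta>) * real (card G) \<le> real (card {e \<in> G. card (e \<inter> S) = 1}). wt n s G)
      \<le> exp (- (\<rho> * vol n)) * ZZ n s"
proof -
  have s: "0 \<le> s" "s \<le> 1" and y: "0 < y" "y \<le> 1" and fp: "y = exp (- ((1 - s) * c\<^sup>2 * y\<^sup>2))"
    and contr: "2 * ((1 - s) * c\<^sup>2) < 1" using assms(1) unfolding replica_def by iprover+
  define \<kappa> where "\<kappa> = y * \<delta> / 8"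
  have "0 < \<kappa>" using y assms by (simp add: \<kappa>_def)
  then obtain \<epsilon> where \<epsilon>: "0 < \<epsilon>" "\<epsilon> < 1"
    and Qb: "\<forall>\<^sub>F n in sequentially. \<forall>l T A e.
      (\<forall>f\<in>pairs n. (1 - \<epsilon>) * c / sqrt n \<le> l f \<and> l f \<le> (1 + \<epsilon>) * c / sqrt n) \<longrightarrow>
      linear_hypergraph.admissible (pairs n) (triangles n) T A \<longrightarrow> e \<in> pairs n - A \<longrightarrow>
      contains_none T (insert e A) \<longrightarrow> card A \<le> 2 \<longrightarrow>
      \<bar>gibbs_hypergraph.Q (pairs n) s l T A e - y\<bar> \<le> \<kappa>"
    by (rule Q_asymptotic[OF s c_pos y fp contr])
  \<comment> \<open>Choice of the tilt strength: the tilted activities must stay in the window of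
    \<open>Q_asymptotic\<close>, half of which is reserved for \<open>q n\<close>, and tilt and
    density error together may change \<open>q n * y\<close> by at most a relative \<delta> /
    4.\<close>
  have "((\<lambda>t. exp t * (1 + \<epsilon>/2)) \<longlongrightarrow> exp 0 * (1 + \<epsilon>/2)) (at_right 0)"
    "((\<lambda>t. exp (- t) * (1 - \<epsilon>/2)) \<longlongrightarrow> exp (- 0) * (1 - \<epsilon>/2)) (at_right (0::real))"
    "((\<lambda>t. exp t * (1 + \<delta>/8)) \<longlongrightarrow> exp 0 * (1 + \<delta>/8)) (at_right 0)"
    "((\<lambda>t. exp (- t) * (1 - \<delta>/8)) \<longlongrightarrow> exp (- 0) * (1 - \<delta>/8)) (at_right (0::real))"
    by (intro tendsto_intros)+
  then have "\<forall>\<^sub>F t in at_right 0. exp t * (1 + \<epsilon>/2) < 1 + \<epsilon>"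
    "\<forall>\<^sub>F t in at_right (0::real). 1 - \<epsilon> < exp (- t) * (1 - \<epsilon>/2)"
    "\<forall>\<^sub>F t in at_right 0. exp t * (1 + \<delta>/8) < 1 + \<delta>/4"
    "\<forall>\<^sub>F t in at_right (0::real). 1 - \<delta>/4 < exp (- t) * (1 - \<delta>/8)"
    using \<epsilon> assms by (auto elim!: order_tendstoD)
  then have "\<forall>\<^sub>F t in at_right (0::real). exp t * (1 + \<epsilon>/2) < 1 + \<epsilon> \<and> 1 - \<epsilon> < exp (- t) * (1 - \<epsilon>/2) \<and>
     exp t * (1 + \<delta>/8) < 1 + \<delta>/4 \<and> 1 - \<delta>/4 < exp (- t) * (1 - \<delta>/8) \<and> 0 < t"
    using eventually_at_right_less[of "0::real"] by eventually_elim auto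
  then obtain t where t: "exp t * (1 + \<epsilon>/2) < 1 + \<epsilon>" "1 - \<epsilon> < exp (- t) * (1 - \<epsilon>/2)"
     "exp t * (1 + \<delta>/8) < 1 + \<delta>/4" "1 - \<delta>/4 < exp (- t) * (1 - \<delta>/8)" "0 < t"
    using eventually_happens'[OF trivial_limit_at_right_real] by blast
  \<comment> \<open>Upper bound for the tilted mean of \<open>sum \<omega> G\<close>. The term
    \<open>real n / 4\<close> is the excess of n^2 / 4, the largest number of split pairs, over half
    of all pairs; of the gap \<delta>, one quarter is given up to the errors.\<close>
  define m where "m n = q n * y * (real n / 4 - 3/4 * \<delta> * real (n choose 2))" for n
  \<comment> \<open>\<open>m n / vol n\<close> tends to -(3/8) * c * y * \<delta>; the weaker
    constant 1/4 leaves room for a strict inequality.\<close>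
  define \<rho> where "\<rho> = t * (c * y * \<delta> / 4)"
  have \<rho>: "0 < \<rho>" using t c_pos y assms by (simp add: \<rho>_def)
  have "(\<lambda>n. (q n * sqrt n) * (y * ((real n / 4 - 3/4 * \<delta> * (real n * (real n - 1) / 2)) / (real n)\<^sup>2)))
      \<longlonglongrightarrow> c * (y * (- 3/8 * \<delta>))"
    by (intro tendsto_mult q_lim tendsto_const) real_asymp
  moreover have "c * (y * (- 3/8 * \<delta>)) < - (c * y * \<delta> / 4)" using c_pos y assms by simp
  ultimately have "\<forall>\<^sub>F n in sequentially.
      (q n * sqrt n) * (y * ((real n / 4 - 3/4 * \<delta> * (real n * (real n - 1) / 2)) / (real n)\<^sup>2))
        < - (c * y * \<delta> / 4)"
    by (rule order_tendstoD)
  then have mb: "\<forall>\<^sub>F n in sequentially. t * m n \<le> - (\<rho> * vol n)"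
    using eventually_gt_at_top[of 0]
  proof eventually_elim
    case (elim n)
    have nc: "real (n choose 2) = real n * (real n - 1) / 2"
      using elim(2) by (simp add: choose_two real_of_nat_div of_nat_diff)
    have "(q n * sqrt n) * (y * (A / (real n)\<^sup>2)) * vol n = q n * y * A" for A
    proof -
      have "(q n * sqrt n) * (y * (A / (real n)\<^sup>2)) * vol n
          = q n * y * A * ((sqrt n * sqrt n) * real n / (real n)\<^sup>2)"
        by (simp add: vol_def)
      then show ?thesis using elim(2) by (simp add: power2_eq_square)
    qed
    then have "m n = (q n * sqrt n) * (y * ((real n / 4 - 3/4 * \<delta> * (real n * (real n - 1) / 2)) / (real n)\<^sup>2)) * vol n"
      unfolding m_def nc by simp
    also have "\<dots> \<le> - (c * y * \<delta> / 4) * vol n"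
      using elim by (intro mult_right_mono) (auto simp: vol_def)
    finally have "t * m n \<le> t * (- (c * y * \<delta> / 4) * vol n)" using t by (intro mult_left_mono) auto
    then show ?case by (simp add: \<rho>_def)
  qed
  have qb: "\<forall>\<^sub>F n in sequentially. (1 - \<epsilon>/2) * c / sqrt n \<le> q n \<and> q n \<le> (1 + \<epsilon>/2) * c / sqrt n"
    using \<epsilon> by (intro q_bounds) auto
  have "\<forall>\<^sub>F n in sequentially. \<forall>S\<subseteq>{1..n}.
    (\<Sum>G | G \<in> Pow (pairs n) \<and> (1/2 + \<delta>) * real (card G) \<le> real (card {e \<in> G. card (e \<inter> S) = 1}). wt n s G)
      \<le> exp (- (\<rho> * vol n)) * ZZ n s"
    using mb Qb qb q_pos eventually_gt_at_top[of 0]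
  proof eventually_elim
    case (elim n)
    note mb = elim(1) and Qb = elim(2) and q0 = elim(4) and n0 = elim(5)
    show ?case
    proof (intro allI impI)
      fix S assume S: "S \<subseteq> {1..n}"
      \<comment> \<open>Centred so that the event in question becomes
        \<open>0 \<le> sum \<omega> G\<close>; \<open>\<delta> \<le> 1/2\<close> keeps the absolute
        values at most 1.\<close>
      define \<omega> where "\<omega> e = (if card (e \<inter> S) = 1 then 1 else 0) - (1/2 + \<delta>)" for e :: "nat set"
      define l where "l e = q n * exp (t * \<omega> e)" for e
      have \<omega>: "\<bar>\<omega> e\<bar> \<le> 1" for e using assms by (auto simp: \<omega>_def)
      have tw: "exp (- t) \<le> exp (t * \<omega> e)" "exp (t * \<omega> e) \<le> exp t" for e
        using \<omega>[of e] t(5) mult_left_mono[of "\<omega> e" 1 t] mult_left_mono[of "-1" "\<omega> e" t] by auto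
      have lb: "(1 - \<epsilon>) * c / sqrt n \<le> l e" "l e \<le> (1 + \<epsilon>) * c / sqrt n" for e
      proof -
        have cn: "0 \<le> c / sqrt n" using c_pos n0 by simp
        have "(1 - \<epsilon>) * (c / sqrt n) \<le> exp (- t) * (1 - \<epsilon>/2) * (c / sqrt n)"
          using t cn by (intro mult_right_mono) auto
        also have "\<dots> = ((1 - \<epsilon>/2) * c / sqrt n) * exp (- t)" by simp
        also have "\<dots> \<le> q n * exp (t * \<omega> e)"
          using elim(3) tw q0 by (intro mult_mono) auto
        finally show "(1 - \<epsilon>) * c / sqrt n \<le> l e" by (simp add: l_def)
        have "q n * exp (t * \<omega> e) \<le> ((1 + \<epsilon>/2) * c / sqrt n) * exp t"
          using elim(3) tw q0 by (intro mult_mono) auto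
        also have "\<dots> = exp t * (1 + \<epsilon>/2) * (c / sqrt n)" by simp
        also have "\<dots> \<le> (1 + \<epsilon>) * (c / sqrt n)" using t cn by (intro mult_right_mono) auto
        finally show "l e \<le> (1 + \<epsilon>) * c / sqrt n" by (simp add: l_def)
      qed
      interpret gibbs_hypergraph "pairs n" "triangles n" "n - 2" s l
        using s q0 by (intro gibbs_hypergraph_triangles) (auto simp: l_def)
      have term_le: "\<omega> e * (l e * Q (triangles n) {} e) \<le> q n * y * (\<omega> e + \<delta>/4)" if e: "e \<in> pairs n" for e
      proof -
        have "contains_none (triangles n) {e}" by (intro contains_none_small) auto
        then have "\<bar>Q (triangles n) {} e - y\<bar> \<le> \<kappa>"
          using Qb lb admissible_empty e by auto
        then have Qe: "y * (1 - \<delta>/8) \<le> Q (triangles n) {} e" "Q (triangles n) {} e \<le> y * (1 + \<delta>/8)"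
          unfolding abs_le_iff by (simp_all add: \<kappa>_def right_diff_distrib distrib_left)
        define r where "r = exp (t * \<omega> e) * (Q (triangles n) {} e / y)"
        have Qy: "1 - \<delta>/8 \<le> Q (triangles n) {} e / y" "Q (triangles n) {} e / y \<le> 1 + \<delta>/8"
          using Qe y by (auto simp: field_simps)
        have "exp (- t) * (1 - \<delta>/8) \<le> r" unfolding r_def using tw Qy assms(2,3) by (intro mult_mono) auto
        moreover have "r \<le> exp t * (1 + \<delta>/8)" unfolding r_def using tw Qy Q_nonneg y by (intro mult_mono) auto
        ultimately have r: "\<bar>r - 1\<bar> \<le> \<delta>/4" using t(3,4) unfolding abs_le_iff by linarith
        have "\<omega> e * (r - 1) \<le> \<bar>\<omega> e\<bar> * \<bar>r - 1\<bar>" by (metis abs_ge_self abs_mult)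
        also have "\<dots> \<le> 1 * (\<delta>/4)" using \<omega> r by (intro mult_mono) auto
        finally have "\<omega> e * r \<le> \<omega> e + \<delta>/4" by (simp add: algebra_simps)
        then have "q n * y * (\<omega> e * r) \<le> q n * y * (\<omega> e + \<delta>/4)" using q0 y by (intro mult_left_mono) auto
        moreover have "q n * y * (\<omega> e * r) = \<omega> e * (l e * Q (triangles n) {} e)"
          unfolding r_def l_def using y by simp
        ultimately show ?thesis by simp
      qed
      have sum\<omega>: "sum \<omega> G = real (card {e \<in> G. card (e \<inter> S) = 1}) - (1/2 + \<delta>) * real (card G)" if "finite G" for G
        unfolding \<omega>_def sum_subtractf using sum.inter_filter[OF that, of "\<lambda>_. 1::real" "\<lambda>e. card (e \<inter> S) = 1"]
        by simp
      have "(\<Sum>e\<in>pairs n. \<omega> e * (l e * Q (triangles n) {} e)) \<le> (\<Sum>e\<in>pairs n. q n * y * (\<omega> e + \<delta>/4))"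
        using term_le by (intro sum_mono)
      also have "\<dots> = q n * y * (sum \<omega> (pairs n) + \<delta>/4 * real (n choose 2))"
        by (simp add: sum_distrib_left[symmetric] sum.distrib card_pairs)
      also have "\<dots> \<le> m n"
      proof -
        have "sum \<omega> (pairs n) \<le> (real n)\<^sup>2 / 4 - (1/2 + \<delta>) * real (n choose 2)"
          using card_split_pairs_le[OF S] sum\<omega>[OF finite_pairs] by (simp add: card_pairs)
        moreover have "real (n choose 2) = ((real n)\<^sup>2 - real n) / 2"
          using n0 by (simp add: choose_two real_of_nat_div of_nat_diff power2_eq_square algebra_simps)
        moreover have "x + \<delta>/4 * N \<le> b / 4 - 3/4 * \<delta> * N"
          if x: "x \<le> a / 4 - (1/2 + \<delta>) * N" "N = (a - b) / 2" for x a b N :: real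
        proof -
          have a: "a = 2 * N + b" using x(2) by simp
          show ?thesis using x(1) unfolding a by (simp add: algebra_simps add_divide_distrib)
        qed
        ultimately have "sum \<omega> (pairs n) + \<delta>/4 * real (n choose 2) \<le> real n / 4 - 3/4 * \<delta> * real (n choose 2)"
          by blast
        then show ?thesis unfolding m_def using q0 y by (intro mult_left_mono) auto
      qed
      finally have "Z (triangles n) {} * (\<Sum>e\<in>pairs n. \<omega> e * (l e * Q (triangles n) {} e)) \<le> Z (triangles n) {} * m n"
        using Z_empty_pos by (intro mult_left_mono) auto
      then have mean: "(\<Sum>G\<in>Pow (pairs n). weight G * sum \<omega> G) \<le> m n * (\<Sum>G\<in>Pow (pairs n). weight G)"
        unfolding mean_edges sum_weight by (simp add: mult.commute)
      have W: "wt n s G * exp (t * sum \<omega> G) = weight G" if "G \<in> Pow (pairs n)" for G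
      proof -
        have "finite G" using that finite_pairs finite_subset by auto
        then have "prod l G = q n ^ card G * exp (t * sum \<omega> G)"
          unfolding l_def by (simp add: prod.distrib exp_sum sum_distrib_left)
        then show ?thesis unfolding wt_def weight_def triangle_count_eq by simp
      qed
      have "(\<Sum>G | G \<in> Pow (pairs n) \<and> 0 \<le> sum \<omega> G. wt n s G) \<le> exp (t * m n) * sum (wt n s) (Pow (pairs n))"
      proof (rule chernoff_bound)
        show "finite (Pow (pairs n))" using finite_pairs by simp
        show "0 \<le> wt n s G" if "G \<in> Pow (pairs n)" for G using q0 s by (simp add: wt_def)
        show "0 \<le> t" using t by simp
        show "(\<Sum>G\<in>Pow (pairs n). wt n s G * exp (t * sum \<omega> G) * sum \<omega> G)
            \<le> m n * (\<Sum>G\<in>Pow (pairs n). wt n s G * exp (t * sum \<omega> G))"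
        proof -
          have "(\<Sum>G\<in>Pow (pairs n). wt n s G * exp (t * sum \<omega> G) * sum \<omega> G) = (\<Sum>G\<in>Pow (pairs n). weight G * sum \<omega> G)"
            "(\<Sum>G\<in>Pow (pairs n). wt n s G * exp (t * sum \<omega> G)) = (\<Sum>G\<in>Pow (pairs n). weight G)"
            by (intro sum.cong refl; simp only: W)+
          then show ?thesis using mean by simp
        qed
      qed
      also have "\<dots> \<le> exp (- (\<rho> * vol n)) * ZZ n s"
        unfolding ZZ_def using mb q0 s by (intro mult_right_mono sum_nonneg) (auto simp: wt_def)
      also have "{G. G \<in> Pow (pairs n) \<and> 0 \<le> sum \<omega> G} = {G. G \<in> Pow (pairs n) \<and>
          (1/2 + \<delta>) * real (card G) \<le> real (card {e \<in> G. card (e \<inter> S) = 1})}"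
      proof (intro Collect_cong conj_cong refl)
        fix G assume "G \<in> Pow (pairs n)"
        then have "finite G" using finite_pairs finite_subset by auto
        then show "0 \<le> sum \<omega> G \<longleftrightarrow> (1/2 + \<delta>) * real (card G) \<le> real (card {e \<in> G. card (e \<inter> S) = 1})"
          using sum\<omega> by simp
      qed
      finally show "(\<Sum>G | G \<in> Pow (pairs n) \<and> (1/2 + \<delta>) * real (card G) \<le> real (card {e \<in> G. card (e \<inter> S) = 1}). wt n s G)
        \<le> exp (- (\<rho> * vol n)) * ZZ n s" .
    qed
  qed
  then show thesis using that \<rho> by blast
qed

lemma MC_deviation:
  assumes "replica s y" "0 < \<delta>" "\<delta> \<le> 1/2"
  obtains \<rho> where "0 < \<rho>" "\<forall>\<^sub>F n in sequentially.
    (\<Sum>G | G \<in> Pow (pairs n) \<and> \<delta> < \<bar>MC n G - 1/2\<bar>. wt n s G) \<le> exp (- (\<rho> * vol n)) * ZZ n s"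
proof -
  obtain \<rho> where \<rho>: "0 < \<rho>" and dev: "\<forall>\<^sub>F n in sequentially. \<forall>S\<subseteq>{1..n}.
    (\<Sum>G | G \<in> Pow (pairs n) \<and> (1/2 + \<delta>) * real (card G) \<le> real (card {e \<in> G. card (e \<inter> S) = 1}). wt n s G)
      \<le> exp (- (\<rho> * vol n)) * ZZ n s"
    using split_deviation[OF assms] by blast
  have s0: "0 \<le> s" using assms(1) unfolding replica_def by iprover
  have "filterlim (\<lambda>n::nat. sqrt (real n)) at_top sequentially" by real_asymp
  \<comment> \<open>From here on the entropy \<open>real n * ln 2\<close> of the cuts is at most
    half of \<open>\<rho> * vol n\<close>.\<close>
  then have "\<forall>\<^sub>F n::nat in sequentially. ln 2 / (\<rho>/2) \<le> sqrt (real n)"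
    by (simp add: filterlim_at_top)
  then have "\<forall>\<^sub>F n in sequentially.
    (\<Sum>G | G \<in> Pow (pairs n) \<and> \<delta> < \<bar>MC n G - 1/2\<bar>. wt n s G) \<le> exp (- (\<rho>/2 * vol n)) * ZZ n s"
    using dev q_pos
  proof eventually_elim
    case (elim n)
    define B where "B S G \<longleftrightarrow> (1/2 + \<delta>) * real (card G) \<le> real (card {e \<in> G. card (e \<inter> S) = 1})" for S and G :: edge_set
    have w0: "0 \<le> wt n s G" for G using elim(3) s0 by (simp add: wt_def)
    have "(\<Sum>G | G \<in> Pow (pairs n) \<and> \<delta> < \<bar>MC n G - 1/2\<bar>. wt n s G)
      \<le> (\<Sum>G | G \<in> Pow (pairs n) \<and> \<delta> < \<bar>MC n G - 1/2\<bar>. \<Sum>S\<in>Pow {1..n}. if B S G then wt n s G else 0)"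
    proof (rule sum_mono)
      fix G assume "G \<in> {G. G \<in> Pow (pairs n) \<and> \<delta> < \<bar>MC n G - 1/2\<bar>}"
      then obtain S where S: "S \<in> Pow {1..n}" "B S G"
        using MC_deviation_imp_split[of G n \<delta>] unfolding B_def by blast
      have "(if B S G then wt n s G else 0) \<le> (\<Sum>S\<in>Pow {1..n}. if B S G then wt n s G else 0)"
        by (rule member_le_sum) (use S w0 in auto)
      then show "wt n s G \<le> (\<Sum>S\<in>Pow {1..n}. if B S G then wt n s G else 0)" using S by simp
    qed
    also have "\<dots> \<le> (\<Sum>G\<in>Pow (pairs n). \<Sum>S\<in>Pow {1..n}. if B S G then wt n s G else 0)"
      using w0 finite_pairs by (intro sum_mono2) (auto intro!: sum_nonneg)
    also have "\<dots> = (\<Sum>S\<in>Pow {1..n}. \<Sum>G\<in>Pow (pairs n). if B S G then wt n s G else 0)"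
      by (rule sum.swap)
    also have "\<dots> \<le> (\<Sum>S\<in>Pow {1..n}. exp (- (\<rho> * vol n)) * ZZ n s)"
    proof (rule sum_mono)
      fix S assume "S \<in> Pow {1..n}"
      then have "(\<Sum>G | G \<in> Pow (pairs n) \<and> B S G. wt n s G) \<le> exp (- (\<rho> * vol n)) * ZZ n s"
        using elim(2) unfolding B_def by blast
      then show "(\<Sum>G\<in>Pow (pairs n). if B S G then wt n s G else 0) \<le> exp (- (\<rho> * vol n)) * ZZ n s"
        using sum.inter_filter[of "Pow (pairs n)" "wt n s" "B S"] finite_pairs by simp
    qed
    also have "\<dots> = exp (real n * ln 2) * (exp (- (\<rho> * vol n)) * ZZ n s)"
      by (simp add: card_Pow exp_of_nat_mult)
    also have "\<dots> = exp (real n * ln 2 - \<rho> * vol n) * ZZ n s"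
      by (simp add: exp_diff exp_minus field_simps)
    also have "\<dots> \<le> exp (- (\<rho>/2 * vol n)) * ZZ n s"
    proof (rule mult_right_mono)
      have "ln 2 \<le> \<rho>/2 * sqrt n" using elim(1) \<rho> by (simp add: field_simps)
      then have "real n * ln 2 \<le> real n * (\<rho>/2 * sqrt n)" by (rule mult_left_mono) simp
      then show "exp (real n * ln 2 - \<rho> * vol n) \<le> exp (- (\<rho>/2 * vol n))"
        by (simp add: vol_def algebra_simps)
      show "0 \<le> ZZ n s" unfolding ZZ_def using w0 by (intro sum_nonneg) auto
    qed
    finally show ?case .
  qed
  then show thesis using that[of "\<rho>/2"] \<rho> by simp
qed

section \<open>Triangle counts under the tilts\<close>

definition mean_X :: "nat \<Rightarrow> real \<Rightarrow> real" where
  "mean_X n s = (\<Sum>G\<in>Pow (pairs n). wt n s G * real (triangle_count n G)) / ZZ n s"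

lemma ZZ_pos: "0 \<le> s \<Longrightarrow> 0 < q n \<Longrightarrow> 0 < ZZ n s"
  unfolding ZZ_def
proof (rule sum_pos2[of _ "{}"])
  show "0 < wt n s {}" by (simp add: wt_def triangle_count_empty)
qed (auto simp: finite_pairs wt_def)

lemma q_cubed_lim: "(\<lambda>n. q n ^ 3 * real (n choose 3) / vol n) \<longlonglongrightarrow> c ^ 3 / 6"
proof -
  have "(\<lambda>n. (q n * sqrt n) ^ 3 * (real n * (real n - 1) * (real n - 2) / 6 / real n ^ 3)) \<longlonglongrightarrow> c ^ 3 * (1/6)"
    by (intro tendsto_mult tendsto_power q_lim) real_asymp
  then have "(\<lambda>n. (q n * sqrt n) ^ 3 * (real n * (real n - 1) * (real n - 2) / 6 / real n ^ 3)) \<longlonglongrightarrow> c ^ 3 / 6"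
    by simp
  moreover have "\<forall>\<^sub>F n in sequentially. (q n * sqrt n) ^ 3 * (real n * (real n - 1) * (real n - 2) / 6 / real n ^ 3)
      = q n ^ 3 * real (n choose 3) / vol n"
    using eventually_gt_at_top[of 2]
  proof eventually_elim
    case (elim n)
    have cc: "real (n choose 3) = real n * (real n - 1) * (real n - 2) / 6"
      using elim by (simp add: binomial_gbinomial gbinomial_prod_rev numeral_3_eq_3 fact_numeral
          atLeast0_lessThan_Suc algebra_simps)
    have v: "sqrt n ^ 3 = vol n" "0 < vol n" "real n ^ 3 = vol n * vol n"
      using elim by (simp_all add: vol_def power3_eq_cube mult.assoc mult.left_commute)
    have *: "(q n * sqrt n) ^ 3 * (x / real n ^ 3) = q n ^ 3 * x / vol n" for x
      unfolding power_mult_distrib v(1,3) using v(2) by simp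
    show ?case by (simp only: * cc)
  qed
  ultimately show ?thesis by (rule Lim_transform_eventually)
qed

text \<open>A given triangle has probability about \<open>q n ^ 3 * (s * y ^ 3)\<close>: the
  densities of its three pairs, times \<open>s\<close> for being completed. The error is uniform
  over triangles, so it can be summed.\<close>

lemma mean_X_lim:
  assumes "replica s y"
  shows "(\<lambda>n. mean_X n s / vol n) \<longlonglongrightarrow> s * y ^ 3 * (c ^ 3 / 6)"
proof -
  have s: "0 \<le> s" "s \<le> 1" and y: "0 < y" "y \<le> 1" and fp: "y = exp (- ((1 - s) * c\<^sup>2 * y\<^sup>2))"
    and contr: "2 * ((1 - s) * c\<^sup>2) < 1" using assms(1) unfolding replica_def by iprover+
  define A where "A n = q n ^ 3 * real (n choose 3) / vol n" for n
  have key: "\<forall>\<^sub>F n in sequentially. \<bar>mean_X n s / vol n - A n * (s * y ^ 3)\<bar> \<le> \<kappa> * A n" if \<kappa>: "0 < \<kappa>" for \<kappa>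
  proof -
    have "0 < \<kappa> / 6" using \<kappa> by simp
    then obtain \<epsilon> where \<epsilon>: "0 < \<epsilon>" "\<epsilon> < 1"
      and Qb: "\<forall>\<^sub>F n in sequentially. \<forall>l T A e.
      (\<forall>f\<in>pairs n. (1 - \<epsilon>) * c / sqrt n \<le> l f \<and> l f \<le> (1 + \<epsilon>) * c / sqrt n) \<longrightarrow>
      linear_hypergraph.admissible (pairs n) (triangles n) T A \<longrightarrow> e \<in> pairs n - A \<longrightarrow>
      contains_none T (insert e A) \<longrightarrow> card A \<le> 2 \<longrightarrow>
      \<bar>gibbs_hypergraph.Q (pairs n) s l T A e - y\<bar> \<le> \<kappa> / 6"
      by (rule Q_asymptotic[OF s c_pos y fp contr])
    have "(\<lambda>n::nat. (1 + \<epsilon>) * c / sqrt n) \<longlonglongrightarrow> 0" by real_asymp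
    then have "\<forall>\<^sub>F n::nat in sequentially. (1 + \<epsilon>) * c / sqrt n < min (1/2) (\<kappa>/4)"
      using \<kappa> by (intro order_tendstoD) auto
    then show ?thesis using Qb q_bounds[OF \<epsilon>(1)] q_pos eventually_gt_at_top[of 0]
    proof eventually_elim
      case (elim n)
      note Qb = elim(2) and qb = elim(3) and q0 = elim(4)
      have small: "q n < 1/2" "q n < \<kappa>/4" using elim(1,3) by linarith+
      interpret gibbs_hypergraph "pairs n" "triangles n" "n - 2" s "\<lambda>_. q n"
        using s q0 by (intro gibbs_hypergraph_triangles) auto
      have W: "wt n s = weight" unfolding wt_def weight_def triangle_count_eq by auto
      have R: "\<bar>Z (triangles n) t / Z (triangles n) {} - s * y ^ 3\<bar> \<le> \<kappa>" if t: "t \<in> triangles n" for t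
      proof -
        have "\<bar>Z (triangles n) t / Z (triangles n) {} - s * y ^ 3\<bar> \<le> 3 * (\<kappa>/6) + 2 * q n"
        proof (rule hyperedge_ratio[OF t])
          show "q n \<le> 1/2" using small by simp
        qed (use y Qb qb in auto)
        then show ?thesis using small by linarith
      qed
      have "mean_X n s = (\<Sum>t\<in>triangles n. q n ^ 3 * (Z (triangles n) t / Z (triangles n) {}))"
        unfolding mean_X_def ZZ_def W triangle_count_eq mean_hyperedges sum_weight sum_divide_distrib
        using edge_card by (intro sum.cong) auto
      then have "mean_X n s - q n ^ 3 * real (n choose 3) * (s * y ^ 3)
        = q n ^ 3 * (\<Sum>t\<in>triangles n. Z (triangles n) t / Z (triangles n) {} - s * y ^ 3)"
        by (simp add: sum_subtractf sum_distrib_left card_triangles algebra_simps)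
      also have "\<bar>\<dots>\<bar> \<le> q n ^ 3 * (\<Sum>t\<in>triangles n. \<kappa>)"
        unfolding abs_mult using q0 R by (intro mult_mono order_trans[OF sum_abs] sum_mono) auto
      also have "\<dots> = \<kappa> * (q n ^ 3 * real (n choose 3))" by (simp add: card_triangles)
      finally have "\<bar>mean_X n s - q n ^ 3 * real (n choose 3) * (s * y ^ 3)\<bar> / vol n
        \<le> \<kappa> * (q n ^ 3 * real (n choose 3)) / vol n"
        using elim(5) by (intro divide_right_mono) (auto simp: vol_def)
      moreover have "\<bar>mean_X n s / vol n - A n * (s * y ^ 3)\<bar>
        = \<bar>mean_X n s - q n ^ 3 * real (n choose 3) * (s * y ^ 3)\<bar> / vol n"
      proof -
        have "0 < vol n" using elim(5) by (simp add: vol_def)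
        moreover have "mean_X n s / vol n - A n * (s * y ^ 3)
          = (mean_X n s - q n ^ 3 * real (n choose 3) * (s * y ^ 3)) / vol n"
          by (simp add: A_def diff_divide_distrib)
        ultimately show ?thesis by simp
      qed
      ultimately show ?case by (simp add: A_def)
    qed
  qed
  have A: "A \<longlonglongrightarrow> c ^ 3 / 6" unfolding A_def by (rule q_cubed_lim)
  have "(\<lambda>n. mean_X n s / vol n - A n * (s * y ^ 3)) \<longlonglongrightarrow> 0"
  proof (rule tendstoI)
    fix r :: real assume r: "0 < r"
    define M where "M = c ^ 3 / 6 + 1"
    have M: "0 < M" using c_pos by (simp add: M_def add_pos_pos)
    have "\<forall>\<^sub>F n in sequentially. A n < M" using A by (rule order_tendstoD) (simp add: M_def)
    moreover have "\<forall>\<^sub>F n in sequentially. \<bar>mean_X n s / vol n - A n * (s * y ^ 3)\<bar> \<le> r / (2 * M) * A n"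
      using r M by (intro key) simp
    ultimately show "\<forall>\<^sub>F n in sequentially. dist (mean_X n s / vol n - A n * (s * y ^ 3)) 0 < r"
    proof eventually_elim
      case (elim n)
      have "r / (2 * M) * A n \<le> r / (2 * M) * M" using elim r M by (intro mult_left_mono) auto
      also have "\<dots> < r" using r M by simp
      finally show ?case using elim by simp
    qed
  qed
  from tendsto_add[OF this tendsto_mult[OF A tendsto_const[of "s * y ^ 3"]]] show ?thesis
    by (simp add: mult.commute)
qed

lemma wt_tilt:
  assumes "0 < s1" "0 < s2"
  shows "wt n s1 G * exp (ln (s2 / s1) * real (triangle_count n G)) = wt n s2 G"
proof -
  have "exp (ln (s2 / s1) * real (triangle_count n G)) = (s2 / s1) ^ triangle_count n G"
    using assms by (simp add: exp_of_nat2_mult)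
  then show ?thesis using assms unfolding wt_def by (simp add: power_divide)
qed

lemma sum_wt_triangles:
  assumes "0 \<le> s" "0 < q n"
  shows "(\<Sum>G\<in>Pow (pairs n). wt n s G * real (triangle_count n G)) = mean_X n s * ZZ n s"
  using ZZ_pos[OF assms] by (simp add: mean_X_def)

text \<open>Tangent inequality for \<open>ln (ZZ n s)\<close>, which is convex in
  \<open>ln s\<close>, at the point \<open>s2\<close>; the slope there is
  \<open>mean_X n s2\<close>.\<close>

lemma ZZ_ratio:
  assumes "0 < s1" "0 < s2" "0 < q n"
  shows "ZZ n s2 \<le> exp (ln (s2 / s1) * mean_X n s2) * ZZ n s1"
proof -
  define f where "f G = ln (s2 / s1) * real (triangle_count n G)" for G
  have "(\<Sum>G\<in>Pow (pairs n). wt n s1 G * exp (1 * f G))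
    \<le> exp (1 * (ln (s2 / s1) * mean_X n s2)) * sum (wt n s1) (Pow (pairs n))"
  proof (rule chernoff_tilt)
    show "(\<Sum>G\<in>Pow (pairs n). wt n s1 G * exp (1 * f G) * f G)
      \<le> ln (s2 / s1) * mean_X n s2 * (\<Sum>G\<in>Pow (pairs n). wt n s1 G * exp (1 * f G))"
    proof -
      have "(\<Sum>G\<in>Pow (pairs n). wt n s2 G * (ln (s2 / s1) * real (triangle_count n G)))
        = ln (s2 / s1) * (mean_X n s2 * ZZ n s2)"
        using sum_wt_triangles[of s2 n] assms by (simp add: sum_distrib_left[symmetric] mult.left_commute)
      then show ?thesis unfolding f_def mult_1 wt_tilt[OF assms(1,2)] ZZ_def[symmetric] by simp
    qed
  qed (use finite_pairs assms in \<open>auto simp: wt_def\<close>)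
  then show ?thesis unfolding f_def mult_1 wt_tilt[OF assms(1,2)] ZZ_def .
qed

text \<open>Both tails at once: the sign of \<open>ln (s2 / s1)\<close> decides between them. For
  \<open>s2 > s1\<close> it is the upper tail, unlikely under \<open>s1\<close> because even the
  larger tilt \<open>s2\<close> has its mean below \<open>b * vol n\<close>. The value 1/4 lets two
  tails leave half of the mass.\<close>

lemma triangle_count_tail:
  assumes "replica s2 y2" "0 < s1" "0 < s2"
    and neg: "ln (s2 / s1) * (s2 * y2 ^ 3 * (c ^ 3 / 6) - b) < 0"
  shows "\<forall>\<^sub>F n in sequentially. (\<Sum>G | G \<in> Pow (pairs n) \<and>
     0 \<le> ln (s2 / s1) * (real (triangle_count n G) - b * vol n). wt n s1 G) \<le> ZZ n s1 / 4"
proof -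
  define \<sigma> where "\<sigma> = ln (s2 / s1)"
  have "(\<lambda>n. \<sigma> * (mean_X n s2 / vol n - b)) \<longlonglongrightarrow> \<sigma> * (s2 * y2 ^ 3 * (c ^ 3 / 6) - b)"
    by (intro tendsto_intros mean_X_lim assms)
  moreover obtain r where r: "\<sigma> * (s2 * y2 ^ 3 * (c ^ 3 / 6) - b) < - r" "0 < r"
    using neg unfolding \<sigma>_def by (metis dense neg_0_less_iff_less minus_minus)
  ultimately have "\<forall>\<^sub>F n in sequentially. \<sigma> * (mean_X n s2 / vol n - b) < - r"
    by (blast dest: order_tendstoD)
  moreover have "\<forall>\<^sub>F n in sequentially. ln 4 / r \<le> vol n"
    using vol_at_top by (simp add: filterlim_at_top)
  ultimately show ?thesis using q_pos eventually_gt_at_top[of 0]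
  proof eventually_elim
    case (elim n)
    define f where "f G = \<sigma> * (real (triangle_count n G) - b * vol n)" for G
    define m where "m = \<sigma> * (mean_X n s2 - b * vol n)"
    have vol: "0 < vol n" using elim by (simp add: vol_def)
    have tilt: "wt n s1 G * exp (1 * f G) = exp (- (\<sigma> * b * vol n)) * wt n s2 G" for G
    proof -
      have "exp (1 * f G) = exp (\<sigma> * real (triangle_count n G)) * exp (- (\<sigma> * b * vol n))"
        by (simp add: f_def exp_add[symmetric] algebra_simps)
      then show ?thesis using wt_tilt[OF assms(2,3), of n G] unfolding \<sigma>_def by (simp add: algebra_simps)
    qed
    have "(\<Sum>G\<in>Pow (pairs n). wt n s2 G * f G) = m * ZZ n s2"
    proof -
      have "wt n s2 G * f G = \<sigma> * (wt n s2 G * real (triangle_count n G)) - \<sigma> * b * vol n * wt n s2 G" for G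
        by (simp add: f_def algebra_simps)
      then have "(\<Sum>G\<in>Pow (pairs n). wt n s2 G * f G)
        = \<sigma> * (\<Sum>G\<in>Pow (pairs n). wt n s2 G * real (triangle_count n G)) - \<sigma> * b * vol n * ZZ n s2"
        unfolding ZZ_def by (simp only: sum_subtractf sum_distrib_left)
      also have "(\<Sum>G\<in>Pow (pairs n). wt n s2 G * real (triangle_count n G)) = mean_X n s2 * ZZ n s2"
        using assms elim by (intro sum_wt_triangles) auto
      finally show ?thesis by (simp add: m_def algebra_simps)
    qed
    then have mean: "(\<Sum>G\<in>Pow (pairs n). wt n s1 G * exp (1 * f G) * f G)
      = m * (\<Sum>G\<in>Pow (pairs n). wt n s1 G * exp (1 * f G))"
      unfolding tilt ZZ_def mult.assoc sum_distrib_left[symmetric] by simp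
    have "(\<Sum>G | G \<in> Pow (pairs n) \<and> 0 \<le> f G. wt n s1 G) \<le> exp (1 * m) * sum (wt n s1) (Pow (pairs n))"
      using elim(3) assms(2) finite_pairs mean by (intro chernoff_bound) (simp_all add: wt_def)
    also have "\<dots> \<le> (1/4) * sum (wt n s1) (Pow (pairs n))"
    proof (rule mult_right_mono)
      have "m = \<sigma> * (mean_X n s2 / vol n - b) * vol n" using vol by (simp add: m_def field_simps)
      also have "\<dots> \<le> - r * vol n" using elim vol by (intro mult_right_mono) auto
      also have "\<dots> \<le> - ln 4" using elim r by (simp add: field_simps)
      finally have "exp (1 * m) \<le> exp (- ln 4)" by simp
      then show "exp (1 * m) \<le> 1/4" by (simp add: exp_minus)
      show "0 \<le> sum (wt n s1) (Pow (pairs n))" using elim assms by (intro sum_nonneg) (auto simp: wt_def)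
    qed
    finally show ?case unfolding f_def \<sigma>_def ZZ_def by simp
  qed
qed

end

text \<open>Turns convergence at every fixed tolerance into a tolerance that tends to 0:
  \<open>\<kappa> n\<close> is the largest index \<open>k \<le> n\<close> whose threshold
  \<open>N k\<close> has been passed. Inserting 0 keeps the set nonempty for small
  \<open>n\<close>.\<close>

lemma diagonal_sequence:
  fixes F :: "nat \<Rightarrow> nat \<Rightarrow> real"
  assumes lim: "\<And>k. F k \<longlonglongrightarrow> 1" and le: "\<And>k n. F k n \<le> 1"
  obtains \<kappa> :: "nat \<Rightarrow> nat" where "filterlim \<kappa> at_top sequentially" "(\<lambda>n. F (\<kappa> n) n) \<longlonglongrightarrow> 1"
proof -
  have "\<exists>N. \<forall>n\<ge>N. 1 - 1 / real (Suc k) < F k n" for k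
    using order_tendstoD(1)[OF lim[of k], of "1 - 1 / real (Suc k)"] by (simp add: eventually_sequentially)
  then obtain N where N: "\<And>k n. N k \<le> n \<Longrightarrow> 1 - 1 / real (Suc k) < F k n" by metis
  define \<kappa> where "\<kappa> n = Max (insert 0 {k. k \<le> n \<and> N k \<le> n})" for n
  have fin: "finite (insert 0 {k. k \<le> n \<and> N k \<le> n})" for n by simp
  have ge: "K \<le> \<kappa> n" if "max K (N K) \<le> n" for K n
    unfolding \<kappa>_def using that by (intro Max_ge[OF fin]) auto
  then have top: "filterlim \<kappa> at_top sequentially"
    unfolding filterlim_at_top eventually_sequentially by blast
  have good: "N (\<kappa> n) \<le> n" if "N 0 \<le> n" for n
    using Max_in[OF fin[of n]] that unfolding \<kappa>_def[symmetric] by auto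
  have "(\<lambda>n. 1 - 1 / real (Suc (\<kappa> n))) \<longlonglongrightarrow> 1"
    using filterlim_compose[OF _ top, of "\<lambda>k. 1 - 1 / real (Suc k)" "nhds 1"]
    by (simp add: LIMSEQ_inverse_real_of_nat_add_minus[of 1, unfolded inverse_eq_divide, simplified])
  then have "(\<lambda>n. F (\<kappa> n) n) \<longlonglongrightarrow> 1"
  proof (rule tendsto_sandwich[rotated 2])
    show "\<forall>\<^sub>F n in sequentially. 1 - 1 / real (Suc (\<kappa> n)) \<le> F (\<kappa> n) n"
      using eventually_ge_at_top[of "N 0"] by eventually_elim (use good N less_imp_le in blast)
  qed (use le in auto)
  then show thesis using that top by blast
qed

section \<open>The replica-symmetric point\<close>

lemma lambert_W_eq:
  assumes "0 \<le> x"
  shows "0 \<le> lambert_W x" "lambert_W x * exp (lambert_W x) = x"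
proof -
  let ?f = "\<lambda>x::real. x * exp x"
  have mono: "?f x < ?f y" if "0 \<le> x" "x < y" for x y
    using that by (intro mult_strict_mono) auto
  have inj: "inj_on ?f {0..}"
    by (rule linorder_inj_onI') (use mono in \<open>auto simp: less_le\<close>)
  have "1 \<le> exp x" using assms by simp
  then have "x * 1 \<le> ?f x" using assms by (intro mult_left_mono) auto
  then have "\<exists>w\<ge>0. w \<le> x \<and> ?f w = x"
    using assms by (intro IVT') (auto intro!: continuous_intros)
  then have im: "x \<in> ?f ` {0..}" by force
  show "0 \<le> lambert_W x" "lambert_W x * exp (lambert_W x) = x"
    using the_inv_into_into[OF inj im order_refl] f_the_inv_into_f[OF inj im]
    by (auto simp: lambert_W_def)
qed

context sparse_regime
begin

text \<open>The tilt for which \<open>z = exp (- ((1 - s) * c\<^sup>2 * z\<^sup>2))\<close>. Parametrising by the density \<open>z\<close> instead of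
  the tilt \<open>s\<close> avoids inverting this equation.\<close>

definition s_of :: "real \<Rightarrow> real" where
  "s_of z = 1 + ln z / (c\<^sup>2 * z\<^sup>2)"

text \<open>Along this curve \<open>(1 - s_of z) * c\<^sup>2\<close> equals
  \<open>- ln z / z\<^sup>2\<close>, so the contraction condition depends on \<open>z\<close>
  alone.\<close>

lemma replica_s_of:
  assumes "0 < z" "z \<le> 1" "0 \<le> s_of z" "- 2 * ln z / z\<^sup>2 < 1"
  shows "replica (s_of z) z"
proof -
  have e: "(1 - s_of z) * c\<^sup>2 = - ln z / z\<^sup>2" using c_pos assms by (simp add: s_of_def)
  have "(1 - s_of z) * c\<^sup>2 * z\<^sup>2 = - ln z" unfolding e using assms by simp
  then have "z = exp (- ((1 - s_of z) * c\<^sup>2 * z\<^sup>2))" using assms by simp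
  moreover have "s_of z \<le> 1" using assms c_pos by (simp add: s_of_def divide_nonpos_nonneg)
  moreover have "2 * ((1 - s_of z) * c\<^sup>2) < 1" unfolding e using assms by simp
  ultimately show ?thesis using assms unfolding replica_def by iprover
qed

lemma neg_ln_div_sq_less:
  fixes z1 z2 :: real
  assumes "0 < z1" "z1 < z2" "z2 \<le> 1"
  shows "- ln z2 / z2\<^sup>2 < - ln z1 / z1\<^sup>2"
proof -
  have "z1\<^sup>2 < z2\<^sup>2" using assms by (intro power_strict_mono) auto
  then have "- ln z2 / z2\<^sup>2 \<le> - ln z2 / z1\<^sup>2" using assms by (intro divide_left_mono) auto
  also have "\<dots> < - ln z1 / z1\<^sup>2" using assms by (intro divide_strict_right_mono) auto
  finally show ?thesis .
qed

lemma s_of_less: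
  assumes "0 < z1" "z1 < z2" "z2 \<le> 1"
  shows "s_of z1 < s_of z2"
proof -
  have e: "s_of z = 1 - (- ln z / z\<^sup>2) / c\<^sup>2" for z by (simp add: s_of_def mult.commute)
  have "(- ln z2 / z2\<^sup>2) / c\<^sup>2 < (- ln z1 / z1\<^sup>2) / c\<^sup>2"
    using neg_ln_div_sq_less[OF assms] c_pos by (intro divide_strict_right_mono) auto
  then show ?thesis unfolding e by simp
qed

lemma continuous_s_of: "0 < z \<Longrightarrow> isCont s_of z"
  unfolding s_of_def using c_pos by (intro continuous_intros) auto

text \<open>With \<open>y0 = exp (- w / 2)\<close> for \<open>w = lambert_W (2 / exp 1)\<close> one has \<open>y0 ^ 3 = eta_star\<close> and
  \<open>- ln y0 / y0\<^sup>2 = 1 / exp 1\<close>, so \<open>s_of y0 * y0 ^ 3 < \<eta>\<close> is what \<open>c < c_bar \<eta>\<close> expresses.\<close>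

lemma exists_replica_point:
  assumes "0 \<le> \<eta>" "\<eta> < 1" "ereal c < c_bar \<eta>"
  obtains y0 y where "0 < y0" "y0 < y" "y < 1" "s_of y * y ^ 3 = \<eta>"
    "\<And>z. y0 < z \<Longrightarrow> z \<le> 1 \<Longrightarrow> - 2 * ln z / z\<^sup>2 < 1"
proof -
  define w where "w = lambert_W (2 / exp 1)"
  have w: "0 \<le> w" "w * exp w = 2 / exp 1" using lambert_W_eq[of "2 / exp 1"] by (auto simp: w_def)
  then have w0: "0 < w" by (cases "w = 0") auto
  define y0 where "y0 = exp (- w / 2)"
  have y0: "0 < y0" "y0 < 1" using w0 by (auto simp: y0_def)
  have y0sq: "y0\<^sup>2 = exp (- w)" by (simp add: y0_def exp_double[symmetric])
  have ln_y0: "- ln y0 / y0\<^sup>2 = 1 / exp 1"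
  proof -
    have "ln y0 = - w / 2" by (simp add: y0_def)
    then have "- ln y0 / y0\<^sup>2 = (w * exp w) / 2" unfolding y0sq by (simp add: exp_minus field_simps)
    then show ?thesis unfolding w(2) by simp
  qed
  have estar: "eta_star = y0 ^ 3"
  proof -
    have "w / (2 / exp 1) = exp (- w)"
      unfolding w(2)[symmetric] using w0 by (simp add: exp_minus field_simps)
    then have "eta_star = exp (- w) powr (3/2)" by (simp add: eta_star_def w_def)
    also have "\<dots> = y0 ^ 3" by (simp add: y0_def powr_def exp_of_nat_mult[symmetric])
    finally show ?thesis .
  qed
  have est0: "0 < eta_star" using y0 by (simp add: estar)
  have s0: "s_of y0 = 1 - 1 / (exp 1 * c\<^sup>2)"
  proof -
    have "s_of y0 = 1 - (- ln y0 / y0\<^sup>2) / c\<^sup>2" by (simp add: s_of_def mult.commute)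
    then show ?thesis unfolding ln_y0 by simp
  qed
  have low: "s_of y0 * y0 ^ 3 < \<eta>"
  proof (cases "\<eta> < eta_star")
    case True
    define u where "u = exp 1 * (1 - \<eta> / eta_star)"
    have u: "0 < u" using True est0 by (simp add: u_def)
    have "c < 1 / sqrt u" using assms True by (simp add: c_bar_def u_def)
    then have "c\<^sup>2 < (1 / sqrt u)\<^sup>2" using c_pos by (intro power_strict_mono) auto
    then have "c\<^sup>2 * u < 1" using u by (simp add: power_divide field_simps)
    then have "1 - \<eta> / eta_star < 1 / (exp 1 * c\<^sup>2)" using c_pos by (simp add: u_def field_simps)
    then have "s_of y0 < \<eta> / eta_star" using s0 by simp
    then show ?thesis using est0 unfolding estar[symmetric] by (simp add: field_simps)
  next
    case False
    \<comment> \<open>No upper bound on \<open>c\<close> is available in this case, but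
      \<open>s_of y0 < 1\<close> for every \<open>c\<close>, and \<eta> is at least
      \<open>y0 ^ 3\<close>.\<close>
    have "s_of y0 < 1" using s0 c_pos by simp
    then have "s_of y0 * eta_star < 1 * eta_star" using est0 by (intro mult_strict_right_mono)
    then show ?thesis using False unfolding estar[symmetric] by simp
  qed
  \<comment> \<open>The value is below \<eta> at \<open>y0\<close>, and at 1 it is
    \<open>s_of 1 = 1\<close>, above \<eta>.\<close>
  have "\<exists>y\<ge>y0. y \<le> 1 \<and> s_of y * y ^ 3 = \<eta>"
  proof (rule IVT')
    show "continuous_on {y0..1} (\<lambda>y. s_of y * y ^ 3)"
      unfolding s_of_def using y0 c_pos by (intro continuous_intros) auto
  qed (use low y0 assms in \<open>auto simp: s_of_def\<close>)
  then obtain y where y: "y0 \<le> y" "y \<le> 1" "s_of y * y ^ 3 = \<eta>" by blast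
  have "y \<noteq> y0" using y low by auto
  moreover have "y \<noteq> 1" using y assms by (auto simp: s_of_def)
  \<comment> \<open>Shown on the whole interval because the comparison of measures also uses
    densities close to \<open>y\<close>.\<close>
  moreover have "- 2 * ln z / z\<^sup>2 < 1" if "y0 < z" "z \<le> 1" for z
  proof -
    have "- ln z / z\<^sup>2 < 1 / exp 1" using neg_ln_div_sq_less[of y0 z] y0 that ln_y0 by simp
    moreover have "2 * (1 / exp 1) \<le> (1::real)" using exp_ge_add_one_self[of 1] by (simp add: divide_le_eq)
    ultimately show ?thesis by linarith
  qed
  ultimately show thesis using that[of y0 y] y y0 by auto
qed

section \<open>Conditioning on few triangles\<close>

definition edge_sum :: "nat \<Rightarrow> (edge_set \<Rightarrow> bool) \<Rightarrow> real" where
  "edge_sum n P = (\<Sum>G | G \<in> Pow (pairs n) \<and> P G. q n ^ card G)"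

text \<open>At \<open>s = 0\<close> the factor \<open>0 ^ triangle_count n G\<close> is the
  indicator of being triangle-free, as \<open>0 ^ 0 = 1\<close>. The tilted measure is then the
  conditioned measure itself, and \<open>MC_deviation\<close> applies without any
  comparison.\<close>

lemma MC_conditional_zero:
  assumes "replica 0 y" "0 < \<delta>" "\<delta> \<le> 1/2"
  shows "(\<lambda>n. edge_sum n (\<lambda>G. \<delta> < \<bar>MC n G - 1/2\<bar> \<and> triangle_count n G = 0)
    / edge_sum n (\<lambda>G. triangle_count n G = 0)) \<longlonglongrightarrow> 0"
proof -
  obtain \<rho> where \<rho>: "0 < \<rho>" and dev: "\<forall>\<^sub>F n in sequentially.
    (\<Sum>G | G \<in> Pow (pairs n) \<and> \<delta> < \<bar>MC n G - 1/2\<bar>. wt n 0 G) \<le> exp (- (\<rho> * vol n)) * ZZ n 0"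
    using MC_deviation[OF assms] by blast
  have es: "edge_sum n (\<lambda>G. P G \<and> triangle_count n G = 0) = (\<Sum>G | G \<in> Pow (pairs n) \<and> P G. wt n 0 G)" for n P
    unfolding edge_sum_def using finite_pairs
    by (intro sum.mono_neutral_cong_left) (auto simp: wt_def)
  have "(\<lambda>n. exp (- (\<rho> * vol n))) \<longlonglongrightarrow> 0"
    using \<rho> unfolding vol_def by real_asymp
  then show ?thesis
  proof (rule tendsto_sandwich[rotated 3])
    show "\<forall>\<^sub>F n in sequentially. edge_sum n (\<lambda>G. \<delta> < \<bar>MC n G - 1/2\<bar> \<and> triangle_count n G = 0)
      / edge_sum n (\<lambda>G. triangle_count n G = 0) \<le> exp (- (\<rho> * vol n))"
      using dev q_pos
    proof eventually_elim
      case (elim n)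
      have "edge_sum n (\<lambda>G. triangle_count n G = 0) = ZZ n 0"
        using es[of n "\<lambda>_. True"] by (simp add: ZZ_def Pow_def)
      moreover have "0 < ZZ n 0" using elim by (intro ZZ_pos) auto
      ultimately show ?case using elim by (simp add: es divide_le_eq)
    qed
    show "\<forall>\<^sub>F n in sequentially. 0 \<le> edge_sum n (\<lambda>G. \<delta> < \<bar>MC n G - 1/2\<bar> \<and> triangle_count n G = 0)
      / edge_sum n (\<lambda>G. triangle_count n G = 0)"
      using q_pos by eventually_elim (auto simp: edge_sum_def intro!: divide_nonneg_nonneg sum_nonneg)
  qed auto
qed

text \<open>Budget for the rate \<rho> of \<open>MC_deviation\<close>: one quarter pays for the
  width of the window of triangle counts used in the denominator, one quarter for replacing
  \<open>ZZ n s\<close> by \<open>ZZ n s2\<close>, and half remains.\<close>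

lemma MC_conditional_pos:
  assumes y: "0 < y0" "y0 < y" "y < 1" and \<eta>: "s_of y * y ^ 3 = \<eta>" "0 < \<eta>" "\<eta> < 1"
    and contr: "\<And>z. y0 < z \<Longrightarrow> z \<le> 1 \<Longrightarrow> - 2 * ln z / z\<^sup>2 < 1"
    and \<delta>: "0 < \<delta>" "\<delta> \<le> 1/2"
    and ex: "(\<lambda>n. ex n / vol n) \<longlonglongrightarrow> c ^ 3 / 6"
  shows "(\<lambda>n. edge_sum n (\<lambda>G. \<delta> < \<bar>MC n G - 1/2\<bar> \<and> real (triangle_count n G) \<le> \<eta> * ex n)
    / edge_sum n (\<lambda>G. real (triangle_count n G) \<le> \<eta> * ex n)) \<longlonglongrightarrow> 0"
proof -
  define s where "s = s_of y"
  define \<beta> where "\<beta> = c ^ 3 / 6"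
  have \<beta>: "0 < \<beta>" using c_pos by (simp add: \<beta>_def)
  have y3: "0 < y ^ 3" using y by simp
  have s0: "0 < s" using \<eta> y3 unfolding s_def by (metis zero_less_mult_pos2)
  have s1: "s < 1" using y c_pos unfolding s_def s_of_def by (simp add: divide_neg_pos)
  have rep: "replica s y" unfolding s_def using y s0 contr by (intro replica_s_of) (auto simp: s_def)
  obtain \<rho> where \<rho>: "0 < \<rho>" and dev: "\<forall>\<^sub>F n in sequentially.
    (\<Sum>G | G \<in> Pow (pairs n) \<and> \<delta> < \<bar>MC n G - 1/2\<bar>. wt n s G) \<le> exp (- (\<rho> * vol n)) * ZZ n s"
    using MC_deviation[OF rep \<delta>] by blast
  define L where "L = ln (1 / s)"
  have L: "0 < L" using s0 s1 by (simp add: L_def)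
  \<comment> \<open>The window has width \<open>2 * \<epsilon> * \<beta>\<close> in units of
    \<open>vol n\<close>, and undoing the tilt costs \<open>L\<close> per triangle.\<close>
  define \<epsilon> where "\<epsilon> = \<rho> / (8 * \<beta> * L)"
  have \<epsilon>: "0 < \<epsilon>" "L * (2 * \<epsilon> * \<beta>) = \<rho> / 4" using \<rho> \<beta> L by (auto simp: \<epsilon>_def)
  have cont: "(s_of \<longlongrightarrow> s) (at_left y)"
    using continuous_s_of[of y] y unfolding s_def isCont_def by (auto intro: filterlim_mono at_le)
  have ev1: "\<forall>\<^sub>F z in at_left y. y0 < z" using y by (intro eventually_at_left_field[THEN iffD2]) auto
  have ev2: "\<forall>\<^sub>F z in at_left y. 0 < s_of z" using cont s0 by (rule order_tendstoD)
  have "((\<lambda>z. s_of z * z ^ 3) \<longlongrightarrow> s * y ^ 3) (at_left y)" by (intro tendsto_intros cont)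
  then have ev3: "\<forall>\<^sub>F z in at_left y. \<eta> - \<epsilon> < s_of z * z ^ 3"
    by (rule order_tendstoD) (use \<eta> \<epsilon> in \<open>simp add: s_def\<close>)
  \<comment> \<open>Prepares \<open>ZZ_ratio\<close> between \<open>s\<close> and \<open>s2\<close>,
    with \<open>c ^ 3 * vol n\<close> as a generous bound for the mean.\<close>
  have "((\<lambda>z. ln (s / s_of z) * c ^ 3) \<longlongrightarrow> ln (s / s) * c ^ 3) (at_left y)"
    using s0 by (intro tendsto_intros cont) auto
  then have ev4: "\<forall>\<^sub>F z in at_left y. ln (s / s_of z) * c ^ 3 < \<rho> / 4"
    by (rule order_tendstoD) (use s0 \<rho> in simp)
  from ev1 ev2 ev3 ev4 have "\<forall>\<^sub>F z in at_left y. y0 < z \<and> 0 < s_of z \<and> \<eta> - \<epsilon> < s_of z * z ^ 3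
      \<and> ln (s / s_of z) * c ^ 3 < \<rho> / 4" by eventually_elim auto
  then obtain b where b: "b < y" and bz: "\<And>z. b < z \<Longrightarrow> z < y \<Longrightarrow> y0 < z \<and> 0 < s_of z \<and> \<eta> - \<epsilon> < s_of z * z ^ 3
      \<and> ln (s / s_of z) * c ^ 3 < \<rho> / 4"
    unfolding eventually_at_left_field by blast
  \<comment> \<open>The conditioning event is bounded below through the measure with tilt \<open>s2\<close> slightly below \<open>s\<close>,
    under which \<open>X\<close> concentrates just below \<open>\<eta> * ex n\<close>; \<open>s1\<close> and \<open>s3\<close> serve its two tail bounds.\<close>
  obtain y3 where y3: "b < y3" "y3 < y" using dense[OF b] by blast
  obtain y2 where y2: "b < y2" "y2 < y3" using dense[OF y3(1)] by blast
  obtain y1 where y1: "b < y1" "y1 < y2" using dense[OF y2(1)] by blast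
  define s1 where "s1 = s_of y1"
  define s2 where "s2 = s_of y2"
  define s3 where "s3 = s_of y3"
  have z: "y0 < y1" "y0 < y2" "y0 < y3" "0 < s1" "0 < s2" "0 < s3"
    and h1: "\<eta> - \<epsilon> < s1 * y1 ^ 3" and lns: "ln (s / s2) * c ^ 3 < \<rho> / 4"
    using bz[of y1] bz[of y2] bz[of y3] y1 y2 y3 unfolding s1_def s2_def s3_def by auto
  have ss: "s1 < s2" "s2 < s3" "s3 < s"
    unfolding s1_def s2_def s3_def s_def using y y1 y2 y3 z by (auto intro!: s_of_less)
  have r1: "replica s1 y1" and r3: "replica s3 y3"
    unfolding s1_def s3_def using y y1 y2 y3 z contr by (auto intro!: replica_s_of simp: s1_def s3_def less_imp_le)
  have h3: "s3 * y3 ^ 3 < \<eta>"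
  proof -
    have "s3 * y3 ^ 3 < s * y ^ 3"
      using ss z y y3 by (intro mult_strict_mono power_strict_mono) auto
    then show ?thesis using \<eta> by (simp add: s_def)
  qed
  define b1 where "b1 = (\<eta> - \<epsilon>) * \<beta>"
  \<comment> \<open>The strict gap between \<open>e\<close> and \<eta> absorbs the error of
    \<open>ex n\<close> against its limit, so that \<open>b2 * vol n \<le> \<eta> * ex n\<close>
    eventually.\<close>
  obtain e where e: "s3 * y3 ^ 3 < e" "e < \<eta>" using dense[OF h3] by blast
  define b2 where "b2 = e * \<beta>"
  have \<sigma>1: "ln (s1 / s2) < 0" and \<sigma>3: "0 < ln (s3 / s2)" using ss z by (auto simp: ln_div)
  have t1: "\<forall>\<^sub>F n in sequentially. (\<Sum>G | G \<in> Pow (pairs n) \<and>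
     0 \<le> ln (s1 / s2) * (real (triangle_count n G) - b1 * vol n). wt n s2 G) \<le> ZZ n s2 / 4"
  proof (rule triangle_count_tail[OF r1])
    have "0 < (s1 * y1 ^ 3 - (\<eta> - \<epsilon>)) * \<beta>" using h1 \<beta> by simp
    then show "ln (s1 / s2) * (s1 * y1 ^ 3 * (c ^ 3 / 6) - b1) < 0"
      using \<sigma>1 by (intro mult_neg_pos) (auto simp: b1_def \<beta>_def algebra_simps)
  qed (use z in auto)
  have t3: "\<forall>\<^sub>F n in sequentially. (\<Sum>G | G \<in> Pow (pairs n) \<and>
     0 \<le> ln (s3 / s2) * (real (triangle_count n G) - b2 * vol n). wt n s2 G) \<le> ZZ n s2 / 4"
  proof (rule triangle_count_tail[OF r3])
    have "(s3 * y3 ^ 3 - e) * \<beta> < 0" using e \<beta> by (simp add: mult_neg_pos)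
    then show "ln (s3 / s2) * (s3 * y3 ^ 3 * (c ^ 3 / 6) - b2) < 0"
      using \<sigma>3 by (intro mult_pos_neg) (auto simp: b2_def \<beta>_def algebra_simps)
  qed (use z in auto)
  have "s * y ^ 3 * (c ^ 3 / 6) < c ^ 3" using \<eta> c_pos by (simp add: s_def)
  then have mX: "\<forall>\<^sub>F n in sequentially. mean_X n s / vol n < c ^ 3"
    by (rule order_tendstoD(2)[OF mean_X_lim[OF rep]])
  have "(\<lambda>n. \<eta> * (ex n / vol n)) \<longlonglongrightarrow> \<eta> * \<beta>" unfolding \<beta>_def by (intro tendsto_intros ex)
  moreover have "b2 < \<eta> * \<beta>" "\<eta> * \<beta> < (\<eta> + \<epsilon>) * \<beta>" using e \<beta> \<epsilon> by (auto simp: b2_def)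
  ultimately have ex1: "\<forall>\<^sub>F n in sequentially. b2 < \<eta> * (ex n / vol n)"
    and ex2: "\<forall>\<^sub>F n in sequentially. \<eta> * (ex n / vol n) < (\<eta> + \<epsilon>) * \<beta>" by (auto dest: order_tendstoD)
  have "(\<lambda>n. 2 * exp (- (\<rho>/2 * vol n))) \<longlonglongrightarrow> 0" using \<rho> unfolding vol_def by real_asymp
  then show ?thesis
  proof (rule tendsto_sandwich[rotated 3])
    show "\<forall>\<^sub>F n in sequentially. 0 \<le> edge_sum n (\<lambda>G. \<delta> < \<bar>MC n G - 1/2\<bar> \<and> real (triangle_count n G) \<le> \<eta> * ex n)
      / edge_sum n (\<lambda>G. real (triangle_count n G) \<le> \<eta> * ex n)"
      using q_pos by eventually_elim (auto simp: edge_sum_def intro!: divide_nonneg_nonneg sum_nonneg)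
    show "\<forall>\<^sub>F n in sequentially. edge_sum n (\<lambda>G. \<delta> < \<bar>MC n G - 1/2\<bar> \<and> real (triangle_count n G) \<le> \<eta> * ex n)
      / edge_sum n (\<lambda>G. real (triangle_count n G) \<le> \<eta> * ex n) \<le> 2 * exp (- (\<rho>/2 * vol n))"
      using dev t1 t3 mX ex1 ex2 q_pos eventually_gt_at_top[of 0]
    proof eventually_elim
      case (elim n)
      note dev = elim(1) and t1 = elim(2) and t3 = elim(3) and q0 = elim(7)
      let ?X = "\<lambda>G. real (triangle_count n G)"
      have vol: "0 < vol n" using elim(8) by (simp add: vol_def)
      have mX: "mean_X n s \<le> c ^ 3 * vol n" and ex1: "b2 * vol n \<le> \<eta> * ex n"
        and ex2: "\<eta> * ex n \<le> (\<eta> + \<epsilon>) * \<beta> * vol n"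
        using elim(4-6) vol by (auto simp: field_simps)
      have w0: "0 \<le> wt n s G" "0 \<le> wt n s2 G" for G using q0 s0 z by (auto simp: wt_def)
      have Zs: "0 < ZZ n s" "0 < ZZ n s2" using ZZ_pos q0 s0 z by auto
      have qs: "q n ^ card G = wt n r G * exp (ln (1 / r) * ?X G)" if "0 < r" for r G
        using wt_tilt[of r 1 n G] that by (simp add: wt_def)
      have num: "edge_sum n (\<lambda>G. \<delta> < \<bar>MC n G - 1/2\<bar> \<and> ?X G \<le> \<eta> * ex n)
        \<le> exp (L * ((\<eta> + \<epsilon>) * \<beta> * vol n)) * (exp (- (\<rho> * vol n)) * ZZ n s)"
      proof -
        have "edge_sum n (\<lambda>G. \<delta> < \<bar>MC n G - 1/2\<bar> \<and> ?X G \<le> \<eta> * ex n)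
          \<le> (\<Sum>G | G \<in> Pow (pairs n) \<and> \<delta> < \<bar>MC n G - 1/2\<bar> \<and> ?X G \<le> \<eta> * ex n.
               exp (L * ((\<eta> + \<epsilon>) * \<beta> * vol n)) * wt n s G)"
          unfolding edge_sum_def
        proof (rule sum_mono)
          fix G assume "G \<in> {G. G \<in> Pow (pairs n) \<and> \<delta> < \<bar>MC n G - 1/2\<bar> \<and> ?X G \<le> \<eta> * ex n}"
          then have "L * ?X G \<le> L * ((\<eta> + \<epsilon>) * \<beta> * vol n)" using ex2 L by (intro mult_left_mono) auto
          then have "wt n s G * exp (L * ?X G) \<le> wt n s G * exp (L * ((\<eta> + \<epsilon>) * \<beta> * vol n))"
            using w0 by (intro mult_left_mono) auto
          then show "q n ^ card G \<le> exp (L * ((\<eta> + \<epsilon>) * \<beta> * vol n)) * wt n s G"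
            unfolding qs[OF s0] L_def[symmetric] by (simp add: mult.commute)
        qed
        also have "\<dots> \<le> (\<Sum>G | G \<in> Pow (pairs n) \<and> \<delta> < \<bar>MC n G - 1/2\<bar>.
               exp (L * ((\<eta> + \<epsilon>) * \<beta> * vol n)) * wt n s G)"
          using finite_pairs w0 by (intro sum_mono2) auto
        also have "\<dots> = exp (L * ((\<eta> + \<epsilon>) * \<beta> * vol n)) * (\<Sum>G | G \<in> Pow (pairs n) \<and> \<delta> < \<bar>MC n G - 1/2\<bar>. wt n s G)"
          by (simp only: sum_distrib_left)
        also have "\<dots> \<le> exp (L * ((\<eta> + \<epsilon>) * \<beta> * vol n)) * (exp (- (\<rho> * vol n)) * ZZ n s)"
          using dev by (intro mult_left_mono) auto
        finally show ?thesis .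
      qed
      define T1 where "T1 = {G. G \<in> Pow (pairs n) \<and> 0 \<le> ln (s1 / s2) * (?X G - b1 * vol n)}"
      define T3 where "T3 = {G. G \<in> Pow (pairs n) \<and> 0 \<le> ln (s3 / s2) * (?X G - b2 * vol n)}"
      define Wn where "Wn = Pow (pairs n) - (T1 \<union> T3)"
      have fin: "finite T1" "finite T3" "finite Wn" using finite_pairs by (auto simp: T1_def T3_def Wn_def)
      have window: "b1 * vol n \<le> ?X G" "?X G \<le> \<eta> * ex n" if "G \<in> Wn" for G
      proof -
        have "ln (s1 / s2) * (?X G - b1 * vol n) < 0" "ln (s3 / s2) * (?X G - b2 * vol n) < 0"
          using that by (auto simp: Wn_def T1_def T3_def)
        then have "b1 * vol n < ?X G" "?X G < b2 * vol n"
          using \<sigma>1 \<sigma>3 by (auto simp: mult_less_0_iff)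
        then show "b1 * vol n \<le> ?X G" "?X G \<le> \<eta> * ex n" using ex1 by auto
      qed
      have half: "ZZ n s2 / 2 \<le> sum (wt n s2) Wn"
      proof -
        have "ZZ n s2 = sum (wt n s2) (Wn \<union> (T1 \<union> T3))"
          unfolding ZZ_def by (intro sum.cong) (auto simp: Wn_def T1_def T3_def)
        also have "\<dots> = sum (wt n s2) Wn + sum (wt n s2) (T1 \<union> T3)"
          using fin by (intro sum.union_disjoint) (auto simp: Wn_def)
        also have "sum (wt n s2) (T1 \<union> T3) \<le> sum (wt n s2) T1 + sum (wt n s2) T3"
          using fin w0 by (simp add: sum_Un sum_nonneg)
        finally show ?thesis using t1 t3 unfolding T1_def T3_def by simp
      qed
      have den: "exp (L * (b1 * vol n)) * (ZZ n s2 / 2) \<le> edge_sum n (\<lambda>G. ?X G \<le> \<eta> * ex n)"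
      proof -
        have "exp (L * (b1 * vol n)) * (ZZ n s2 / 2) \<le> exp (L * (b1 * vol n)) * sum (wt n s2) Wn"
          using half by (intro mult_left_mono) auto
        also have "\<dots> = (\<Sum>G\<in>Wn. exp (L * (b1 * vol n)) * wt n s2 G)" by (simp add: sum_distrib_left)
        also have "\<dots> \<le> (\<Sum>G\<in>Wn. q n ^ card G)"
        proof (rule sum_mono)
          fix G assume G: "G \<in> Wn"
          have "L * (b1 * vol n) \<le> L * ?X G" using window(1)[OF G] L by (intro mult_left_mono) auto
          also have "\<dots> \<le> ln (1 / s2) * ?X G"
            unfolding L_def using ss z s0 by (intro mult_right_mono) (auto simp: ln_div)
          finally have "wt n s2 G * exp (L * (b1 * vol n)) \<le> wt n s2 G * exp (ln (1 / s2) * ?X G)"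
            using w0 by (intro mult_left_mono) auto
          then show "exp (L * (b1 * vol n)) * wt n s2 G \<le> q n ^ card G"
            unfolding qs[OF z(5)] by (simp add: mult.commute)
        qed
        also have "\<dots> \<le> edge_sum n (\<lambda>G. ?X G \<le> \<eta> * ex n)"
          unfolding edge_sum_def using finite_pairs q0 window by (intro sum_mono2) (auto simp: Wn_def)
        finally show ?thesis .
      qed
      have "ZZ n s \<le> exp (ln (s / s2) * mean_X n s) * ZZ n s2"
        by (rule ZZ_ratio[OF z(5) s0 q0])
      also have "\<dots> \<le> exp (\<rho>/4 * vol n) * ZZ n s2"
      proof -
        have "0 \<le> ln (s / s2)" using ss z by (simp add: ln_div)
        then have "ln (s / s2) * mean_X n s \<le> ln (s / s2) * (c ^ 3 * vol n)" using mX by (intro mult_left_mono)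
        also have "\<dots> = (ln (s / s2) * c ^ 3) * vol n" by simp
        also have "\<dots> \<le> \<rho>/4 * vol n" using lns vol by (intro mult_right_mono) auto
        finally show ?thesis using Zs by (intro mult_right_mono) auto
      qed
      finally have Zss: "ZZ n s \<le> exp (\<rho>/4 * vol n) * ZZ n s2" .
      have ex_eq: "exp (L * ((\<eta> + \<epsilon>) * \<beta> * vol n)) * (exp (- (\<rho> * vol n)) * (exp (\<rho>/4 * vol n) * ZZ n s2))
        = 2 * exp (- (\<rho>/2 * vol n)) * (exp (L * (b1 * vol n)) * (ZZ n s2 / 2))"
      proof -
        have "L * ((\<eta> + \<epsilon>) * \<beta> * vol n) = L * (b1 * vol n) + (L * (2 * \<epsilon> * \<beta>)) * vol n"
          unfolding b1_def by (simp add: algebra_simps)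
        then have "L * ((\<eta> + \<epsilon>) * \<beta> * vol n) + (- (\<rho> * vol n)) + \<rho>/4 * vol n = - (\<rho>/2 * vol n) + L * (b1 * vol n)"
          unfolding \<epsilon>(2) by (simp add: algebra_simps)
        then have "exp (L * ((\<eta> + \<epsilon>) * \<beta> * vol n)) * exp (- (\<rho> * vol n)) * exp (\<rho>/4 * vol n)
          = exp (- (\<rho>/2 * vol n)) * exp (L * (b1 * vol n))"
          by (simp only: exp_add[symmetric])
        then show ?thesis by (simp add: mult.assoc[symmetric])
      qed
      have "edge_sum n (\<lambda>G. \<delta> < \<bar>MC n G - 1/2\<bar> \<and> ?X G \<le> \<eta> * ex n)
        \<le> exp (L * ((\<eta> + \<epsilon>) * \<beta> * vol n)) * (exp (- (\<rho> * vol n)) * (exp (\<rho>/4 * vol n) * ZZ n s2))"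
        by (rule order_trans[OF num]) (intro mult_left_mono Zss; simp)
      also have "\<dots> \<le> 2 * exp (- (\<rho>/2 * vol n)) * edge_sum n (\<lambda>G. ?X G \<le> \<eta> * ex n)"
        unfolding ex_eq using den by (intro mult_left_mono) auto
      finally have fin_le: "edge_sum n (\<lambda>G. \<delta> < \<bar>MC n G - 1/2\<bar> \<and> ?X G \<le> \<eta> * ex n)
        \<le> 2 * exp (- (\<rho>/2 * vol n)) * edge_sum n (\<lambda>G. ?X G \<le> \<eta> * ex n)" .
      have "0 < exp (L * (b1 * vol n)) * (ZZ n s2 / 2)" using Zs by simp
      then have "0 < edge_sum n (\<lambda>G. ?X G \<le> \<eta> * ex n)" using den by linarith
      then show ?case using fin_le by (simp add: divide_le_eq)
    qed
  qed auto
qed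

end

section \<open>From activities back to edge probabilities, and the conclusion\<close>

lemma sparse_scaling:
  fixes p :: "nat \<Rightarrow> real"
  assumes "c > 0" and p: "p \<sim>[at_top] (\<lambda>n. c / sqrt (real n))"
  shows "(\<lambda>n. p n * sqrt n) \<longlonglongrightarrow> c" "p \<longlonglongrightarrow> 0"
    "(\<lambda>n. p n / (1 - p n) * sqrt n) \<longlonglongrightarrow> c"
proof -
  have "(\<lambda>n. p n * sqrt (real n)) \<sim>[at_top] (\<lambda>n. c / sqrt (real n) * sqrt (real n))"
    by (intro asymp_equiv_intros p)
  moreover have "(\<lambda>n. c / sqrt (real n) * sqrt (real n)) \<longlonglongrightarrow> c"
    by (rule tendsto_eventually) (use eventually_gt_at_top[of 0] in eventually_elim, simp)
  ultimately show 1: "(\<lambda>n. p n * sqrt n) \<longlonglongrightarrow> c"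
    using tendsto_asymp_equiv_cong by blast
  have "(\<lambda>n::nat. c / sqrt n) \<longlonglongrightarrow> 0" by real_asymp
  then show 2: "p \<longlonglongrightarrow> 0" using tendsto_asymp_equiv_cong[OF p] by blast
  have "(\<lambda>n. p n * sqrt n / (1 - p n)) \<longlonglongrightarrow> c / (1 - 0)"
    by (intro tendsto_intros 1 2) auto
  then show "(\<lambda>n. p n / (1 - p n) * sqrt n) \<longlonglongrightarrow> c" by simp
qed

theorem corollary1p6:
  fixes c \<eta> :: real and p :: "nat \<Rightarrow> real"
  assumes "c > 0" and "0 \<le> \<eta>" and "\<eta> < 1" and "ereal c < c_bar \<eta>"
    and "p \<sim>[at_top] (\<lambda>n. c / sqrt (real n))"
  shows "\<exists>\<delta> :: nat \<Rightarrow> real. \<delta> \<longlonglongrightarrow> 0 \<and>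
    (\<lambda>n. \<P>(G in measure_pmf (Gnp n (p n)). \<bar>MC n G - 1 / 2\<bar> \<le> \<delta> n \<bar>
            real (triangle_count n G) \<le> \<eta> * expected_triangles n (p n))) \<longlonglongrightarrow> 1"
proof -
  define q where "q n = p n / (1 - p n)" for n
  define ex where "ex n = expected_triangles n (p n)" for n
  note scale = sparse_scaling[OF assms(1,5)]
  \<comment> \<open>Gibbs weights use the activity \<open>p / (1 - p)\<close>, the expected triangle
    count uses \<open>p\<close>. Both satisfy the scaling with the same \<open>c\<close>, hence
    share the limit \<open>c ^ 3 / 6\<close>.\<close>
  interpret P: sparse_regime c p by unfold_locales (use assms scale in auto)
  interpret sparse_regime c q by unfold_locales (use assms scale in \<open>auto simp: q_def\<close>)
  have "\<forall>\<^sub>F n in sequentially. p n < 1" using scale(2) by (rule order_tendstoD) simp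
  with P.q_pos have p01: "\<forall>\<^sub>F n in sequentially. 0 < p n \<and> p n < 1" by eventually_elim simp
  have ex_eq: "\<forall>\<^sub>F n in sequentially. ex n = p n ^ 3 * real (n choose 3)"
    using p01 by eventually_elim (simp add: ex_def expected_triangles_eq)
  have ex_lim: "(\<lambda>n. ex n / vol n) \<longlonglongrightarrow> c ^ 3 / 6"
  proof (rule Lim_transform_eventually)
    show "(\<lambda>n. p n ^ 3 * real (n choose 3) / vol n) \<longlonglongrightarrow> c ^ 3 / 6"
      using P.q_cubed_lim by (simp add: vol_def P.vol_def)
    show "\<forall>\<^sub>F n in sequentially. p n ^ 3 * real (n choose 3) / vol n = ex n / vol n"
      using ex_eq by eventually_elim simp
  qed
  obtain y0 y where y: "0 < y0" "y0 < y" "y < 1" "s_of y * y ^ 3 = \<eta>"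
    "\<And>z. y0 < z \<Longrightarrow> z \<le> 1 \<Longrightarrow> - 2 * ln z / z\<^sup>2 < 1"
    using exists_replica_point[OF assms(2-4)] by blast
  have ratio: "(\<lambda>n. edge_sum n (\<lambda>G. \<delta> < \<bar>MC n G - 1/2\<bar> \<and> real (triangle_count n G) \<le> \<eta> * ex n)
    / edge_sum n (\<lambda>G. real (triangle_count n G) \<le> \<eta> * ex n)) \<longlonglongrightarrow> 0" if \<delta>: "0 < \<delta>" "\<delta> \<le> 1/2" for \<delta>
  proof (cases "\<eta> = 0")
    case True
    have "s_of y = 0" using y True by simp
    then have "replica 0 y" using replica_s_of[of y] y by simp
    from MC_conditional_zero[OF this \<delta>] show ?thesis using True by simp
  next
    case False
    then show ?thesis using MC_conditional_pos[OF y(1-4) _ assms(3) y(5) \<delta> ex_lim] assms(2) by simp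
  qed
  \<comment> \<open>The tolerance starts at 1/2, the largest value that \<open>ratio\<close>
    accepts.\<close>
  define F where "F k n = \<P>(G in measure_pmf (Gnp n (p n)). \<bar>MC n G - 1 / 2\<bar> \<le> 1 / real (k + 2) \<bar>
    real (triangle_count n G) \<le> \<eta> * ex n)" for k n :: nat
  have F_lim: "F k \<longlonglongrightarrow> 1" for k
  proof -
    define \<delta> where "\<delta> = 1 / real (k + 2)"
    have \<delta>: "0 < \<delta>" "\<delta> \<le> 1/2" by (auto simp: \<delta>_def field_simps)
    have "(\<lambda>n. 1 - edge_sum n (\<lambda>G. \<delta> < \<bar>MC n G - 1/2\<bar> \<and> real (triangle_count n G) \<le> \<eta> * ex n)
      / edge_sum n (\<lambda>G. real (triangle_count n G) \<le> \<eta> * ex n)) \<longlonglongrightarrow> 1 - 0"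
      by (intro tendsto_intros ratio \<delta>)
    moreover have "\<forall>\<^sub>F n in sequentially.
      1 - edge_sum n (\<lambda>G. \<delta> < \<bar>MC n G - 1/2\<bar> \<and> real (triangle_count n G) \<le> \<eta> * ex n)
      / edge_sum n (\<lambda>G. real (triangle_count n G) \<le> \<eta> * ex n) = F k n"
      using p01 q_pos ex_eq
    proof eventually_elim
      case (elim n)
      let ?A = "\<lambda>G. real (triangle_count n G) \<le> \<eta> * ex n"
      have meas: "measure (measure_pmf (Gnp n (p n))) {G. R G} = (1 - p n) ^ card (pairs n) * edge_sum n R" for R
        using measure_Gnp[of "p n" n R] elim by (simp add: edge_sum_def q_def)
      have ex0: "0 \<le> \<eta> * ex n" using elim assms by simp
      have fin: "finite {G. G \<in> Pow (pairs n) \<and> R G}" for R using finite_pairs by auto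
      \<comment> \<open>The empty graph always satisfies the condition, so the conditional
        probability is a genuine quotient.\<close>
      have pos: "0 < edge_sum n ?A"
        unfolding edge_sum_def using elim ex0
        by (intro sum_pos2[OF fin, of "{}"]) (auto simp: triangle_count_empty)
      have "edge_sum n ?A = edge_sum n (\<lambda>G. \<delta> < \<bar>MC n G - 1/2\<bar> \<and> ?A G)
          + edge_sum n (\<lambda>G. \<bar>MC n G - 1/2\<bar> \<le> \<delta> \<and> ?A G)"
        unfolding edge_sum_def using fin
        by (subst sum.union_disjoint[symmetric]) (auto intro!: sum.cong)
      then have "1 - edge_sum n (\<lambda>G. \<delta> < \<bar>MC n G - 1/2\<bar> \<and> ?A G) / edge_sum n ?A
        = edge_sum n (\<lambda>G. \<bar>MC n G - 1/2\<bar> \<le> \<delta> \<and> ?A G) / edge_sum n ?A"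
        using pos by (simp add: field_simps)
      also have "\<dots> = F k n"
        unfolding F_def \<delta>_def[symmetric] cond_prob_def using elim by (simp add: meas)
      finally show ?case .
    qed
    ultimately show ?thesis by (simp add: Lim_transform_eventually)
  qed
  have F_le: "F k n \<le> 1" for k n
  proof -
    have "measure (measure_pmf (Gnp n (p n))) {G. \<bar>MC n G - 1 / 2\<bar> \<le> 1 / real (k + 2) \<and> real (triangle_count n G) \<le> \<eta> * ex n}
      \<le> measure (measure_pmf (Gnp n (p n))) {G. real (triangle_count n G) \<le> \<eta> * ex n}"
      by (intro measure_pmf.finite_measure_mono) auto
    then show ?thesis unfolding F_def cond_prob_def by (simp add: divide_le_eq_1) (smt (verit) measure_nonneg)
  qed
  obtain \<kappa> where \<kappa>: "filterlim \<kappa> at_top sequentially" "(\<lambda>n. F (\<kappa> n) n) \<longlonglongrightarrow> 1"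
    using diagonal_sequence[of F] F_lim F_le by blast
  have "(\<lambda>k::nat. 1 / real (k + 2)) \<longlonglongrightarrow> 0" by real_asymp
  then have "(\<lambda>n. 1 / real (\<kappa> n + 2)) \<longlonglongrightarrow> 0" by (rule filterlim_compose[OF _ \<kappa>(1)])
  then show ?thesis using \<kappa>(2) unfolding F_def ex_def by blast
qed

end
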